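(* When restricted to input hypergraphs of bounded rank (that is, for every constant $R$, when restricted to input hypergraphs $G$ with $\mathsf{rank}(G)\le R$), $\#\textsc{HyperMotif}(\mathcal{V})$ is solvable in near-quadratic time $\tilde O(|G|^2)$ for arbitrary Venn diagrams $\mathcal{V}$, and it is solvable in near-linear time $\tilde O(|G|)$ for degenerate Venn diagrams $\mathcal{V}$.
   Context: A hypergraph $G$ is a pair of a finite vertex set $V(G)$ and a set $E(G)$ of edges, each a non-empty subset of $V(G)$; every vertex lies in at least one edge. For $A\subseteq E(G)$, $G[A]$ is the hypergraph with edge set $A$ and vertex set $\bigcup_{e\in A}e$. $\mathsf{rank}(G)$ is the maximum cardinality of an edge of $G$. $|G|$ is the size of (the encoding of) $G$, and $\tilde O$ hides polylogarithmic factors. A Venn diagram is a vector $\mathcal{V}=(\mathcal{V}_J)_{\emptyset\ne J\subseteq\{1,2,3\}}\in\{0,1\}^7$. A hypergraph $G$ with exactly three edges satisfies $\mathcal{V}$, written $\mathcal{V}(G)=1$, if there is an ordering $e_1,e_2,e_3$ of $E(G)$ such that for all non-empty $J\subseteq\{1,2,3\}$: $\mathcal{V}_J=1 \Leftrightarrow \left(\bigcap_{i\in J}e_i\right)\setminus\left(\bigcup_{i\in\{1,2,3\}\setminus J}e_i\right)\neq\emptyset$. Standing convention: only Venn diagrams that correspond to connected motifs with three pairwise distinct edges are considered, one per equivalence class under permutation of the three sets (26 in total). $\mathcal{V}$ is degenerate if every hypergraph $G$ with $\mathcal{V}(G)=1$ has two (distinct) edges $e,e'$ with $e\subseteq e'$.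 $\mathcal{M}(\mathcal{V}\to G):=\{A\subseteq E(G)\mid \#A=3 \wedge \mathcal{V}(G[A])=1\}$. The problem $\#\textsc{HyperMotif}(\mathcal{V})$ ($\mathcal V$ fixed) is: given a hypergraph $G$, compute $\#\mathcal{M}(\mathcal{V}\to G)$. *)

theory Defs
  imports Complex_Main "HOL-Library.Landau_Symbols" "HOL-Library.Log_Nat"
begin

section \<open>Hypergraphs\<close>

record 'a hypergraph =
  verts :: "'a set"
  edges :: "'a set set"

definition hypergraph :: "'a hypergraph \<Rightarrow> bool" where
  "hypergraph G \<longleftrightarrow>
     finite (verts G) \<and>
     (\<forall>e\<in>edges G. e \<noteq> {} \<and> e \<subseteq> verts G) \<and>
     (\<forall>v\<in>verts G. \<exists>e\<in>edges G. v \<in> e)"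

definition edge_induced :: "'a hypergraph \<Rightarrow> 'a set set \<Rightarrow> 'a hypergraph" where
  "edge_induced G A = \<lparr>verts = \<Union>A, edges = A\<rparr>"

text \<open>The rank of the hypergraph without edges is 0.\<close>

definition hrank :: "'a hypergraph \<Rightarrow> nat" where
  "hrank G = Max (insert 0 (card ` edges G))"

definition hconnected :: "'a hypergraph \<Rightarrow> bool" where
  "hconnected G \<longleftrightarrow>
     (\<forall>u\<in>verts G. \<forall>v\<in>verts G. (u, v) \<in> {(x, y). \<exists>e\<in>edges G. x \<in> e \<and> y \<in> e}\<^sup>*)"


section \<open>Venn diagrams and motifs\<close>

text \<open>A Venn diagram is a 0/1 vector indexed by the non-empty subsets of \<open>{1, 2, 3}\<close>.
  The values of the function at all other arguments are never inspected.\<close>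

type_synonym venn = "nat set \<Rightarrow> bool"

definition venn_sat :: "venn \<Rightarrow> 'a hypergraph \<Rightarrow> bool" where
  "venn_sat V G \<longleftrightarrow>
     (\<exists>e. bij_betw e {1, 2, 3::nat} (edges G) \<and>
        (\<forall>J. J \<noteq> {} \<and> J \<subseteq> {1, 2, 3} \<longrightarrow>
           (V J \<longleftrightarrow> (\<Inter>i\<in>J. e i) - (\<Union>i\<in>{1, 2, 3} - J. e i) \<noteq> {})))"

text \<open>Hypergraphs are finite, so nothing is lost by taking natural numbers as vertices
  when quantifying over all hypergraphs in the two definitions below.

  A Venn diagram is proper if it corresponds to connected motifs with three pairwise
  distinct edges; distinctness is part of \<open>venn_sat\<close>. Whether a hypergraph satisfying
  \<open>V\<close> is connected depends on \<open>V\<close> only. No representative is singled out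
  in a class of diagrams that agree up to a permutation of the three sets.\<close>

definition proper_venn :: "venn \<Rightarrow> bool" where
  "proper_venn V \<longleftrightarrow> (\<exists>G :: nat hypergraph. hypergraph G \<and> hconnected G \<and> venn_sat V G)"

definition degenerate :: "venn \<Rightarrow> bool" where
  "degenerate V \<longleftrightarrow>
     (\<forall>G :: nat hypergraph. hypergraph G \<and> venn_sat V G \<longrightarrow>
        (\<exists>e\<in>edges G. \<exists>e'\<in>edges G. e \<noteq> e' \<and> e \<subseteq> e'))"

definition motifs :: "venn \<Rightarrow> 'a hypergraph \<Rightarrow> 'a set set set" where
  "motifs V G = {A. A \<subseteq> edges G \<and> card A = 3 \<and> venn_sat V (edge_induced G A)}"


section \<open>Random access machines\<close>

text \<open>A RAM in the style of Cook and Reckhow under the logarithmic cost criterion: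
  registers \<open>X 0, X 1, \<dots>\<close> hold natural numbers, subtraction is truncated, the input is
  a finite sequence of numbers that can be read once from left to right, and reading past
  its end yields 0. A machine halts when the program counter leaves the program; its output is
  the content of register 0.\<close>

datatype instr =
    Const nat nat      \<comment> \<open>\<open>X i := c\<close>\<close>
  | Add nat nat nat    \<comment> \<open>\<open>X i := X j + X k\<close>\<close>
  | Sub nat nat nat    \<comment> \<open>\<open>X i := X j - X k\<close>\<close>
  | Mult nat nat nat   \<comment> \<open>\<open>X i := X j * X k\<close>\<close>
  | Div nat nat nat    \<comment> \<open>\<open>X i := X j div X k\<close>\<close>
  | Load nat nat       \<comment> \<open>\<open>X i := X (X j)\<close>\<close>
  | Store nat nat      \<comment> \<open>\<open>X (X i) := X j\<close>\<close>
  | Read nat           \<comment> \<open>\<open>X i := \<close> next input number\<close>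
  | Jpos nat nat       \<comment> \<open>\<open>if X j > 0 then goto l\<close>\<close>

type_synonym config = "nat \<times> (nat \<Rightarrow> nat) \<times> nat list"

definition next_input :: "nat list \<Rightarrow> nat" where
  "next_input x = (case x of [] \<Rightarrow> 0 | a # _ \<Rightarrow> a)"

fun exec_instr :: "instr \<Rightarrow> config \<Rightarrow> config" where
  "exec_instr (Const i c) (pc, X, x) = (Suc pc, X(i := c), x)"
| "exec_instr (Add i j k) (pc, X, x) = (Suc pc, X(i := X j + X k), x)"
| "exec_instr (Sub i j k) (pc, X, x) = (Suc pc, X(i := X j - X k), x)"
| "exec_instr (Mult i j k) (pc, X, x) = (Suc pc, X(i := X j * X k), x)"
| "exec_instr (Div i j k) (pc, X, x) = (Suc pc, X(i := X j div X k), x)"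
| "exec_instr (Load i j) (pc, X, x) = (Suc pc, X(i := X (X j)), x)"
| "exec_instr (Store i j) (pc, X, x) = (Suc pc, X(X i := X j), x)"
| "exec_instr (Read i) (pc, X, x) = (Suc pc, X(i := next_input x), tl x)"
| "exec_instr (Jpos j l) (pc, X, x) = ((if X j > 0 then l else Suc pc), X, x)"

text \<open>The number of binary digits, where 0 has one digit.\<close>

definition bits :: "nat \<Rightarrow> nat" where
  "bits n = max 1 (floorlog 2 n)"

text \<open>Every instruction is charged for the numbers and the computed addresses that it
  handles. Numbers in the program text (register indices, jump targets) contribute only
  constant factors and are not charged.\<close>

fun instr_cost :: "instr \<Rightarrow> config \<Rightarrow> nat" where
  "instr_cost (Const i c) (pc, X, x) = bits c"
| "instr_cost (Add i j k) (pc, X, x) = bits (X j) + bits (X k)"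
| "instr_cost (Sub i j k) (pc, X, x) = bits (X j) + bits (X k)"
| "instr_cost (Mult i j k) (pc, X, x) = bits (X j) + bits (X k)"
| "instr_cost (Div i j k) (pc, X, x) = bits (X j) + bits (X k)"
| "instr_cost (Load i j) (pc, X, x) = bits (X j) + bits (X (X j))"
| "instr_cost (Store i j) (pc, X, x) = bits (X i) + bits (X j)"
| "instr_cost (Read i) (pc, X, x) = bits (next_input x)"
| "instr_cost (Jpos j l) (pc, X, x) = bits (X j)"

text \<open>\<open>ram_run P c t c'\<close>: started in \<open>c\<close>, the program \<open>P\<close> halts in \<open>c'\<close> after
  instructions of total cost \<open>t\<close>.\<close>

inductive ram_run :: "instr list \<Rightarrow> config \<Rightarrow> nat \<Rightarrow> config \<Rightarrow> bool" for P where
  halt: "length P \<le> fst c \<Longrightarrow> ram_run P c 0 c"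
| step: "fst c < length P \<Longrightarrow> ram_run P (exec_instr (P ! fst c) c) t c' \<Longrightarrow>
         ram_run P c (instr_cost (P ! fst c) c + t) c'"

definition ram_computes :: "instr list \<Rightarrow> nat list \<Rightarrow> nat \<Rightarrow> nat \<Rightarrow> bool" where
  "ram_computes P x t y \<longleftrightarrow> (\<exists>pc X x'. ram_run P (0, \<lambda>_. 0, x) t (pc, X, x') \<and> X 0 = y)"


section \<open>Solving problems on hypergraphs in near-\<open>f\<close> time\<close>

text \<open>A hypergraph is given by the number of its edges followed by, for each edge,
  its cardinality and its vertices, in any order. The vertices are arbitrary natural numbers;
  the vertex set need not be listed because every vertex lies in an edge.\<close>

definition encodes :: "nat list \<Rightarrow> nat hypergraph \<Rightarrow> bool" where
  "encodes x G \<longleftrightarrow>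
     (\<exists>es. (\<forall>e\<in>set es. distinct e) \<and> distinct (map set es) \<and> set (map set es) = edges G \<and>
        x = length es # concat (map (\<lambda>e. length e # e) es))"

text \<open>The size in bits. It is the same for all encodings of a hypergraph.\<close>

definition enc_size :: "nat list \<Rightarrow> nat" where
  "enc_size x = sum_list (map bits x)"

definition soft_O :: "(nat \<Rightarrow> real) \<Rightarrow> (nat \<Rightarrow> real) set" where
  "soft_O f = (\<Union>k::nat. O(\<lambda>n. f n * ln (real n) ^ k))"

text \<open>One program has to be correct on all encodings of all hypergraphs in the class \<open>C\<close>.\<close>

definition solvable_in_soft_O ::
    "(nat hypergraph \<Rightarrow> nat) \<Rightarrow> nat hypergraph set \<Rightarrow> (nat \<Rightarrow> real) \<Rightarrow> bool" where
  "solvable_in_soft_O F C f \<longleftrightarrow>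
     (\<exists>P. \<exists>T\<in>soft_O f. \<forall>G\<in>C. \<forall>x. encodes x G \<longrightarrow>
        (\<exists>t. ram_computes P x t (F G) \<and> real t \<le> T (enc_size x)))"

definition HyperMotif :: "venn \<Rightarrow> nat hypergraph \<Rightarrow> nat" where
  "HyperMotif V G = card (motifs V G)"

definition rank_at_most :: "nat \<Rightarrow> nat hypergraph set" where
  "rank_at_most R = {G. hypergraph G \<and> hrank G \<le> R}"

end

theory Submission
  imports Defs "HOL-Combinatorics.Permutations"
begin

text \<open>
  Vertices are renamed to small numbers and every edge is padded with the extra vertex 0 to a
  vector of \<open>R\<close> slots. Since \<open>R\<close> is constant, an edge has only constantly many subsets, so one
  pass over the edges yields a table of the number of edges that contain a given vertex set and
  a table of the edges themselves. For two edges \<open>a\<close>, \<open>b\<close>, inclusion and exclusion over the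
  subsets of \<open>a \<union> b\<close> then gives the number of third edges with a prescribed trace on \<open>a \<union> b\<close>,
  and the edges inside \<open>a \<union> b\<close> can be looked up, so the third edges that fit \<open>V\<close> are counted with
  constantly many lookups. Running over all pairs is quadratic. If \<open>V\<close> is degenerate, then, up to
  a permutation, \<open>a \<subseteq> b\<close>, so it suffices to run over the edges \<open>b\<close> and look up their subsets.
  Every motif is counted once for each permutation that preserves \<open>V\<close>.
\<close>

section \<open>A structured language on top of the machine\<close>

text \<open>Every operand and every computed address is charged by its bit length, and this shapes
  the proof. All stored numbers are kept below a bound \<open>M\<close> polynomial in the number of
  edges, and each piece of code gets a weight, fixed by its text, that bounds its cost in units of
  \<open>bits M\<close>. Table addresses are numerals of constant length \<open>3 * R\<close> in
  base \<open>B\<close>, so they have few bits too. The tables may have far more cells than the time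
  allows to visit; they need no initialisation only because the memory starts with zeros. Tables are
  addressed by words rather than sets, so that lookups need no sorting: every word over the slots of
  an edge is entered. Whether a word exhausts its edge is read off the selection of slots, hence is
  known when the program is written. Tests are arithmetic expressions, and loops over subsets are
  unrolled. The trace of the third edge on the first two determines six of the seven regions; the
  seventh is empty iff the third edge lies inside their union. An inclusion between two edges means
  that certain regions are empty, so it is a property of the diagram, and one pair of indices serves
  all motifs of a degenerate diagram.\<close>

lemma bits_pos: "1 \<le> bits n"
  by (simp add: bits_def)

lemma bits_pos_simps [simp]: "Suc 0 \<le> bits n" "0 < bits n"
  using bits_pos[of n] by simp_all

lemma bits_le_iff: "1 \<le> k \<Longrightarrow> bits n \<le> k \<longleftrightarrow> n < 2 ^ k"
  using floorlog_le_iff[of 2 n k] by (auto simp: bits_def)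

lemma less_pow_bits: "n < 2 ^ bits n"
  using bits_le_iff[of "bits n" n] by simp

lemma bits_mono: "m \<le> n \<Longrightarrow> bits m \<le> bits n"
  using bits_le_iff[of "bits n" m] less_pow_bits[of n] by simp

lemma bits_mult: "bits (m * n) \<le> bits m + bits n"
proof -
  have "m * n < 2 ^ bits m * 2 ^ bits n"
    by (intro mult_strict_mono less_pow_bits) auto
  then show ?thesis
    by (subst bits_le_iff) (auto simp: power_add intro: trans_le_add1)
qed

lemma bits_add: "bits (m + n) \<le> bits m + bits n"
proof -
  obtain a b where ab: "bits m = Suc a" "bits n = Suc b"
    using bits_pos[of m] bits_pos[of n] by (metis Suc_le_D One_nat_def)
  have "(2::nat) ^ Suc a + 2 ^ Suc b \<le> 2 ^ (Suc a + Suc b)"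
  proof -
    have "(x::nat) \<ge> 1 \<Longrightarrow> y \<ge> 1 \<Longrightarrow> 2 * x + 2 * y \<le> 4 * (x * y)" for x y
    proof -
      assume "x \<ge> 1" "y \<ge> 1"
      then have "x \<le> x * y" "y \<le> x * y" by auto
      then show ?thesis by linarith
    qed
    from this[of "2 ^ a" "2 ^ b"] show ?thesis by (simp add: power_add)
  qed
  moreover have "m < 2 ^ Suc a" "n < 2 ^ Suc b"
    using less_pow_bits[of m] less_pow_bits[of n] by (simp_all only: ab)
  ultimately have "m + n < 2 ^ (Suc a + Suc b)" by linarith
  then show ?thesis
    using bits_le_iff[of "bits m + bits n" "m + n"] by (simp add: ab)
qed

text \<open>Differs from \<open>ram_run\<close> in that it may stop anywhere, so that runs of code
  fragments inside a larger program can be composed.\<close>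

inductive steps :: "instr list \<Rightarrow> config \<Rightarrow> nat \<Rightarrow> config \<Rightarrow> bool" for P where
  steps_refl: "steps P c 0 c"
| steps_step: "fst c < length P \<Longrightarrow> steps P (exec_instr (P ! fst c) c) t c' \<Longrightarrow>
         steps P c (instr_cost (P ! fst c) c + t) c'"

lemma steps_trans: "steps P c t c' \<Longrightarrow> steps P c' t' c'' \<Longrightarrow> steps P c (t + t') c''"
  by (induction rule: steps.induct) (auto simp: add.assoc intro: steps_step)

lemma steps_ram_run: "steps P c t c' \<Longrightarrow> length P \<le> fst c' \<Longrightarrow> ram_run P c t c'"
  by (induction rule: steps.induct) (auto intro: ram_run.intros)

lemma steps_instr:
  "steps (ys @ i # zs) (length ys, s) (instr_cost i (length ys, s)) (exec_instr i (length ys, s))"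
  using steps_step[of "(length ys, s)" "ys @ i # zs" 0, OF _ steps_refl] by simp

text \<open>Without jumps the program counter advances by one per instruction, so the effect on
  registers and input does not depend on the position of the code. \<open>srun\<close> and
  \<open>scost\<close> therefore use the dummy counter 0.\<close>

fun jump_free :: "instr \<Rightarrow> bool" where
  "jump_free (Jpos j l) = False"
| "jump_free _ = True"

fun srun :: "instr list \<Rightarrow> (nat \<Rightarrow> nat) \<times> nat list \<Rightarrow> (nat \<Rightarrow> nat) \<times> nat list" where
  "srun [] s = s"
| "srun (i # is) s = srun is (snd (exec_instr i (0, s)))"

fun scost :: "instr list \<Rightarrow> (nat \<Rightarrow> nat) \<times> nat list \<Rightarrow> nat" where
  "scost [] s = 0"
| "scost (i # is) s = instr_cost i (0, s) + scost is (snd (exec_instr i (0, s)))"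

lemma srun_append [simp]: "srun (is @ js) s = srun js (srun is s)"
  by (induction "is" arbitrary: s) auto

lemma scost_append [simp]: "scost (is @ js) s = scost is s + scost js (srun is s)"
  by (induction "is" arbitrary: s) auto

lemma exec_jump_free:
  "jump_free i \<Longrightarrow> exec_instr i (pc, s) = (Suc pc, snd (exec_instr i (0, s)))"
  by (cases i; cases s) auto

lemma cost_pc: "instr_cost i (pc, s) = instr_cost i (0, s)"
  by (cases i; cases s) auto

lemma steps_srun:
  assumes "list_all jump_free is"
  shows "steps (ys @ is @ zs) (length ys, s) (scost is s) (length ys + length is, srun is s)"
  using assms
proof (induction "is" arbitrary: ys s)
  case Nil
  then show ?case by (simp add: steps_refl)
next
  case (Cons i "is")
  have 1: "steps (ys @ i # is @ zs) (length ys, s) (instr_cost i (0, s))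
     (Suc (length ys), snd (exec_instr i (0, s)))"
    using steps_instr[of ys i "is @ zs" s] Cons.prems
    by (simp add: exec_jump_free[of _ "length ys"] cost_pc[of _ "length ys"])
  have "steps ((ys @ [i]) @ is @ zs) (length (ys @ [i]), snd (exec_instr i (0, s)))
      (scost is (snd (exec_instr i (0, s))))
      (length (ys @ [i]) + length is, srun is (snd (exec_instr i (0, s))))"
    using Cons.prems by (intro Cons.IH) auto
  then have 2: "steps (ys @ i # is @ zs) (Suc (length ys), snd (exec_instr i (0, s)))
      (scost is (snd (exec_instr i (0, s))))
      (length ys + length (i # is), srun is (snd (exec_instr i (0, s))))"
    by simp
  from steps_trans[OF 1 2] show ?case by simp
qed

text \<open>Scalar variables are the cells with index 0.\<close>

datatype name = Out | NumE | Base | Ix | Jx | Len | Vtx | Ids | Slot | Stamp | Cnt | IsEdge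

type_synonym mem = "name \<Rightarrow> nat \<Rightarrow> nat"

section \<open>Expressions, their compilation and their cost\<close>

datatype binop = Plus | Minus | Times | Quot

datatype exp = Lit nat | At name exp | Bin binop exp exp

fun apply_op :: "binop \<Rightarrow> nat \<Rightarrow> nat \<Rightarrow> nat" where
  "apply_op Plus x y = x + y"
| "apply_op Minus x y = x - y"
| "apply_op Times x y = x * y"
| "apply_op Quot x y = x div y"

fun eval :: "exp \<Rightarrow> mem \<Rightarrow> nat" where
  "eval (Lit c) m = c"
| "eval (At a e) m = m a (eval e m)"
| "eval (Bin f e1 e2) m = apply_op f (eval e1 m) (eval e2 m)"

abbreviation scalar :: "name \<Rightarrow> exp" where
  "scalar a \<equiv> At a (Lit 0)"

definition upd :: "mem \<Rightarrow> name \<Rightarrow> nat \<Rightarrow> nat \<Rightarrow> mem" where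
  "upd m a i v = m(a := (m a)(i := v))"

lemma upd_apply [simp]: "upd m a i v b j = (if b = a \<and> j = i then v else m b j)"
  by (simp add: upd_def)

fun code :: "name \<Rightarrow> nat" where
  "code Out = 0" | "code NumE = 1" | "code Base = 2" | "code Ix = 3" | "code Jx = 4"
| "code Len = 5" | "code Vtx = 6" | "code Ids = 7" | "code Slot = 8" | "code Stamp = 9"
| "code Cnt = 10" | "code IsEdge = 11"

text \<open>The addresses congruent to 15 modulo 16 hold the intermediate results of expressions.\<close>

definition reg :: "name \<Rightarrow> nat \<Rightarrow> nat" where
  "reg a i = 16 * i + code a"

definition tmp :: "nat \<Rightarrow> nat" where
  "tmp d = 16 * d + 15"

lemma code_less: "code a < 12"
  by (cases a) auto

lemma code_inj: "code a = code b \<Longrightarrow> a = b"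
  by (cases a; cases b; simp)

lemma reg_inj [simp]: "reg a i = reg b j \<longleftrightarrow> a = b \<and> i = j"
proof
  assume "reg a i = reg b j"
  then have eq: "16 * i + code a = 16 * j + code b" by (simp add: reg_def)
  then have "i = j" using code_less[of a] code_less[of b] by linarith
  with eq show "a = b \<and> i = j" by (simp add: code_inj)
qed auto

lemma tmp_inj [simp]: "tmp d = tmp d' \<longleftrightarrow> d = d'"
  by (simp add: tmp_def)

lemma tmp_neq_reg [simp]: "tmp d \<noteq> reg a i" "reg a i \<noteq> tmp d"
proof -
  show "tmp d \<noteq> reg a i"
    using code_less[of a] unfolding tmp_def reg_def by presburger
  then show "reg a i \<noteq> tmp d" by simp
qed

fun op_instr :: "binop \<Rightarrow> nat \<Rightarrow> nat \<Rightarrow> nat \<Rightarrow> instr" where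
  "op_instr Plus = Add"
| "op_instr Minus = Sub"
| "op_instr Times = Mult"
| "op_instr Quot = Div"

text \<open>Constants must first be loaded into a register. \<open>tmp (d + 1)\<close> is free for
  this, because code at depth \<open>d\<close> only has to preserve the temporaries below
  \<open>d\<close>.\<close>

definition addr_code :: "name \<Rightarrow> nat \<Rightarrow> instr list" where
  "addr_code a d = [Const (tmp (d + 1)) 16, Mult (tmp d) (tmp d) (tmp (d + 1)),
     Const (tmp (d + 1)) (code a), Add (tmp d) (tmp d) (tmp (d + 1))]"

fun cexp :: "exp \<Rightarrow> nat \<Rightarrow> instr list" where
  "cexp (Lit c) d = [Const (tmp d) c]"
| "cexp (At a e) d = cexp e d @ addr_code a d @ [Load (tmp d) (tmp d)]"
| "cexp (Bin f e1 e2) d =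
     cexp e1 d @ cexp e2 (Suc d) @ [op_instr f (tmp d) (tmp d) (tmp (Suc d))]"

lemma jump_free_op [simp]: "jump_free (op_instr f i j k)"
  by (cases f) auto

lemma jump_free_cexp [simp]: "list_all jump_free (cexp e d)"
  by (induction e arbitrary: d) (auto simp: addr_code_def)

text \<open>Temporaries are left out: their contents are arbitrary between commands.\<close>

definition agree :: "(nat \<Rightarrow> nat) \<Rightarrow> mem \<Rightarrow> bool" where
  "agree X m \<longleftrightarrow> (\<forall>a i. X (reg a i) = m a i)"

definition bounded :: "nat \<Rightarrow> mem \<Rightarrow> bool" where
  "bounded b m \<longleftrightarrow> (\<forall>a i. bits (m a i) \<le> b)"

lemma bounded_pos: "bounded b m \<Longrightarrow> 1 \<le> b"
  unfolding bounded_def using bits_pos order_trans by blast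

text \<open>The bit length of a value is at most this factor times a bound for all memory cells.
  Reading a cell resets the factor to 1, however large the address was; this is why keys may exceed
  the bound on stored values.\<close>

fun wval :: "exp \<Rightarrow> nat" where
  "wval (Lit c) = bits c"
| "wval (At a e) = 1"
| "wval (Bin f e1 e2) = wval e1 + wval e2"

text \<open>In the case of \<open>At\<close>, the term \<open>3 * wval e\<close> pays twice for
  computing the address and once for the charge of \<open>Load\<close>; 50 generously covers the
  constants 23 and 9 and the content that is read.\<close>

fun wexp :: "exp \<Rightarrow> nat" where
  "wexp (Lit c) = bits c"
| "wexp (At a e) = wexp e + 3 * wval e + 50"
| "wexp (Bin f e1 e2) = wexp e1 + wexp e2 + wval e1 + wval e2"

lemma bits_eval: "bounded b m \<Longrightarrow> bits (eval e m) \<le> wval e * b"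
proof (induction e)
  case (Lit c)
  then show ?case using bounded_pos[of b m] by simp
next
  case (At a e)
  then show ?case by (simp add: bounded_def)
next
  case (Bin f e1 e2)
  let ?x = "eval e1 m" and ?y = "eval e2 m"
  have "bits (apply_op f ?x ?y) \<le> bits ?x + bits ?y"
    using bits_add[of ?x ?y] bits_mult[of ?x ?y] bits_mono[of "?x - ?y" ?x]
      bits_mono[of "?x div ?y" ?x] by (cases f) auto
  with Bin show ?case by (simp add: algebra_simps)
qed

lemma bits_small [simp]: "bits 0 = 1" "bits (Suc 0) = 1" "bits 16 = 5"
proof -
  have "bits 0 \<le> 1" "bits (Suc 0) \<le> 1" by (subst bits_le_iff; simp)+
  then show "bits 0 = 1" "bits (Suc 0) = 1" using bits_pos by (metis le_antisym One_nat_def)+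
  have "bits 16 \<le> 5" "\<not> bits 16 \<le> 4" by (subst bits_le_iff; simp)+
  then show "bits 16 = 5" by simp
qed

lemma bits_code: "bits (code a) \<le> 4"
  using code_less[of a] by (subst bits_le_iff) auto

lemma bits_reg: "bits (16 * i) \<le> bits i + 5" "bits (reg a i) \<le> bits i + 9"
proof -
  show "bits (16 * i) \<le> bits i + 5"
    using bits_mult[of 16 i] by simp
  then show "bits (reg a i) \<le> bits i + 9"
    using bits_add[of "16 * i" "code a"] bits_code[of a] unfolding reg_def by linarith
qed

text \<open>With \<open>k\<close> bits in \<open>tmp d\<close>, the four instructions cost at most
  5, \<open>k + 5\<close>, 4 and \<open>(k + 5) + 4\<close>, which adds up to
  \<open>2 * k + 23\<close>.\<close>

lemma addr_code_run:
  "\<exists>X'. srun (addr_code a d) (X, x) = (X', x) \<and> X' (tmp d) = reg a (X (tmp d)) \<and>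
     (\<forall>r. r \<noteq> tmp d \<longrightarrow> r \<noteq> tmp (Suc d) \<longrightarrow> X' r = X r) \<and>
     scost (addr_code a d) (X, x) \<le> 2 * bits (X (tmp d)) + 23"
  using bits_reg(1)[of "X (tmp d)"] bits_code[of a]
  by (auto simp: addr_code_def reg_def mult.commute)

text \<open>The temporaries form a stack. That those below \<open>d\<close> survive is needed for
  \<open>Bin\<close>: the first operand waits in \<open>tmp d\<close> while the second is evaluated
  one level higher.\<close>

lemma cexp_run:
  assumes "agree X m"
  shows "\<exists>X'. srun (cexp e d) (X, x) = (X', x) \<and> agree X' m \<and> X' (tmp d) = eval e m \<and>
     (\<forall>d'<d. X' (tmp d') = X (tmp d')) \<and>
     (bounded b m \<longrightarrow> scost (cexp e d) (X, x) \<le> wexp e * b)"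
  using assms
proof (induction e arbitrary: X d)
  case (Lit c)
  then show ?case using bounded_pos[of b m] by (auto simp: agree_def)
next
  case (At a e)
  obtain X1 where X1: "srun (cexp e d) (X, x) = (X1, x)" "agree X1 m" "X1 (tmp d) = eval e m"
     "\<forall>d'<d. X1 (tmp d') = X (tmp d')"
     "bounded b m \<Longrightarrow> scost (cexp e d) (X, x) \<le> wexp e * b"
    using At.IH[OF At.prems, of d] by auto
  obtain X2 where X2: "srun (addr_code a d) (X1, x) = (X2, x)" "X2 (tmp d) = reg a (X1 (tmp d))"
     "\<And>r. r \<noteq> tmp d \<Longrightarrow> r \<noteq> tmp (Suc d) \<Longrightarrow> X2 r = X1 r"
     "scost (addr_code a d) (X1, x) \<le> 2 * bits (X1 (tmp d)) + 23"
    using addr_code_run[of a d X1 x] by auto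
  have X2r: "X2 (reg c i) = m c i" for c i
    using X1(2) X2(3)[of "reg c i"] by (simp add: agree_def)
  let ?X = "X2(tmp d := eval (At a e) m)"
  have "srun (cexp (At a e) d) (X, x) = (?X, x)"
    by (simp add: X1 X2 X2r)
  moreover have "agree ?X m" by (simp add: agree_def X2r)
  moreover have "\<forall>d'<d. ?X (tmp d') = X (tmp d')" using X1 X2 by simp
  moreover have "scost (cexp (At a e) d) (X, x) \<le> wexp (At a e) * b" if b: "bounded b m"
  proof -
    have "scost (cexp (At a e) d) (X, x) \<le>
      wexp e * b + (2 * bits (eval e m) + 23) + (bits (eval e m) + 9) + bits (m a (eval e m))"
      using X1 X2 b bits_reg(2)[of a "eval e m"] by (simp add: X2r)
    also have "\<dots> \<le> wexp e * b + 3 * (wval e * b) + 33 * b"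
    proof -
      have "bits (m a (eval e m)) \<le> b" using b by (simp add: bounded_def)
      moreover have "bits (eval e m) \<le> wval e * b" using bits_eval[OF b] .
      ultimately show ?thesis using bounded_pos[OF b] by linarith
    qed
    also have "\<dots> \<le> wexp (At a e) * b" by (simp add: algebra_simps)
    finally show ?thesis .
  qed
  moreover have "?X (tmp d) = eval (At a e) m" by simp
  ultimately show ?case by blast
next
  case (Bin f e1 e2)
  obtain X1 where X1: "srun (cexp e1 d) (X, x) = (X1, x)" "agree X1 m" "X1 (tmp d) = eval e1 m"
     "\<forall>d'<d. X1 (tmp d') = X (tmp d')"
     "bounded b m \<Longrightarrow> scost (cexp e1 d) (X, x) \<le> wexp e1 * b"
    using Bin.IH(1)[OF Bin.prems, of d] by auto
  obtain X2 where X2: "srun (cexp e2 (Suc d)) (X1, x) = (X2, x)" "agree X2 m"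
     "X2 (tmp (Suc d)) = eval e2 m"
     "\<forall>d'<Suc d. X2 (tmp d') = X1 (tmp d')"
     "bounded b m \<Longrightarrow> scost (cexp e2 (Suc d)) (X1, x) \<le> wexp e2 * b"
    using Bin.IH(2)[OF X1(2), of "Suc d"] by auto
  let ?X = "X2(tmp d := eval (Bin f e1 e2) m)"
  have op: "exec_instr (op_instr f i j k) (pc, Y, x) =
    (Suc pc, Y(i := apply_op f (Y j) (Y k)), x)"
    "instr_cost (op_instr f i j k) (pc, Y, x) = bits (Y j) + bits (Y k)" for i j k pc Y
    by (cases f; simp)+
  have "srun (cexp (Bin f e1 e2) d) (X, x) = (?X, x)"
    using X1 X2 by (simp add: op)
  moreover have "agree ?X m" using X2 by (simp add: agree_def)
  moreover have "\<forall>d'<d. ?X (tmp d') = X (tmp d')" using X1 X2 by simp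
  moreover have "scost (cexp (Bin f e1 e2) d) (X, x) \<le> wexp (Bin f e1 e2) * b" if b: "bounded b m"
    using X1 X2 b bits_eval[OF b, of e1] bits_eval[OF b, of e2] by (simp add: op algebra_simps)
  moreover have "?X (tmp d) = eval (Bin f e1 e2) m" by simp
  ultimately show ?case by blast
qed

section \<open>Commands, their compilation and their running time\<close>

datatype com =
    Skip
  | Put name exp exp
  | Get name
  | Seq com com
  | Cond exp com
  | While exp com

text \<open>Kept apart from \<open>ccom\<close> because the jump over a body needs the length of the
  body, which does not depend on its position.\<close>

fun clen :: "com \<Rightarrow> nat" where
  "clen Skip = 0"
| "clen (Put a e1 e2) = length (cexp e1 0) + 4 + length (cexp e2 1) + 1"
| "clen (Get a) = 1"
| "clen (Seq c1 c2) = clen c1 + clen c2"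
| "clen (Cond e c) = length (cexp e 0) + 3 + clen c"
| "clen (While e c) = length (cexp e 0) + 3 + clen c + 2"

text \<open>The first argument is the position of the code in the program.\<close>

fun ccom :: "nat \<Rightarrow> com \<Rightarrow> instr list" where
  "ccom pc Skip = []"
| "ccom pc (Put a e1 e2) =
     cexp e1 0 @ addr_code a 0 @ cexp e2 1 @ [Store (tmp 0) (tmp 1)]"
| "ccom pc (Get a) = [Read (reg a 0)]"
| "ccom pc (Seq c1 c2) = ccom pc c1 @ ccom (pc + clen c1) c2"
| "ccom pc (Cond e c) =
     (let p = pc + length (cexp e 0) + 3
      in cexp e 0 @ [Jpos (tmp 0) p, Const (tmp 0) 1, Jpos (tmp 0) (p + clen c)] @ ccom p c)"
| "ccom pc (While e c) =
     (let p = pc + length (cexp e 0) + 3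
      in cexp e 0 @ [Jpos (tmp 0) p, Const (tmp 0) 1, Jpos (tmp 0) (p + clen c + 2)] @ ccom p c @
         [Const (tmp 0) 1, Jpos (tmp 0) pc])"

lemma length_ccom [simp]: "length (ccom pc c) = clen c"
  by (induction c arbitrary: pc) (auto simp: Let_def addr_code_def)

text \<open>The surrounding code \<open>ys\<close>, \<open>zs\<close> and the temporaries in
  \<open>X\<close> are arbitrary, so that a command can be placed anywhere and after any other
  command.\<close>

definition run :: "com \<Rightarrow> mem \<times> nat list \<Rightarrow> nat \<Rightarrow> mem \<times> nat list \<Rightarrow> bool" where
  "run c s T s' \<longleftrightarrow> (\<forall>ys zs X. agree X (fst s) \<longrightarrow> (\<exists>X' t. t \<le> T \<and> agree X' (fst s') \<and>
     steps (ys @ ccom (length ys) c @ zs) (length ys, X, snd s) t (length ys + clen c, X', snd s')))"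

text \<open>\<open>Get\<close> weighs 0 because its cost is the length of an input token, which is
  accounted for separately. \<open>While\<close> is counted for a single round. In
  \<open>Put\<close>, 32 is 23 for the address plus 9 for the charge of \<open>Store\<close> on
  it.\<close>

fun wcom :: "com \<Rightarrow> nat" where
  "wcom Skip = 0"
| "wcom (Put a e1 e2) = wexp e1 + wexp e2 + 3 * wval e1 + wval e2 + 32"
| "wcom (Get a) = 0"
| "wcom (Seq c1 c2) = wcom c1 + wcom c2"
| "wcom (Cond e c) = wexp e + wval e + 3 + wcom c"
| "wcom (While e c) = wexp e + wval e + 5 + wcom c"

lemma run_Put:
  assumes "bounded b m"
  shows "run (Put a e1 e2) (m, x) (wcom (Put a e1 e2) * b) (upd m a (eval e1 m) (eval e2 m), x)"
  unfolding run_def fst_conv snd_conv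
proof (intro allI impI)
  fix ys zs :: "instr list" and X :: "nat \<Rightarrow> nat"
  assume X: "agree X m"
  obtain X1 where X1: "srun (cexp e1 0) (X, x) = (X1, x)" "agree X1 m" "X1 (tmp 0) = eval e1 m"
     "scost (cexp e1 0) (X, x) \<le> wexp e1 * b"
    using cexp_run[OF X, of e1 0 x b] assms by auto
  obtain X2 where X2: "srun (addr_code a 0) (X1, x) = (X2, x)" "X2 (tmp 0) = reg a (X1 (tmp 0))"
     "\<And>r. r \<noteq> tmp 0 \<Longrightarrow> r \<noteq> tmp (Suc 0) \<Longrightarrow> X2 r = X1 r"
     "scost (addr_code a 0) (X1, x) \<le> 2 * bits (X1 (tmp 0)) + 23"
    using addr_code_run[of a 0 X1 x] by auto
  have "agree X2 m" using X1(2) X2(3) by (simp add: agree_def)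
  then obtain X3 where X3: "srun (cexp e2 1) (X2, x) = (X3, x)" "agree X3 m"
     "X3 (tmp (Suc 0)) = eval e2 m" "X3 (tmp 0) = X2 (tmp 0)"
     "scost (cexp e2 1) (X2, x) \<le> wexp e2 * b"
    using cexp_run[of X2 m e2 1 x b] assms by auto
  let ?c = "ccom (length ys) (Put a e1 e2)"
  let ?X = "X3(reg a (eval e1 m) := eval e2 m)"
  have fin: "srun ?c (X, x) = (?X, x)" "agree ?X (upd m a (eval e1 m) (eval e2 m))"
    using X1 X2 X3 by (simp_all add: agree_def)
  have "scost ?c (X, x) \<le> wexp e1 * b + (2 * bits (eval e1 m) + 23) + wexp e2 * b
     + (bits (eval e1 m) + 9) + bits (eval e2 m)"
    using X1 X2 X3 bits_reg(2)[of a "eval e1 m"] by simp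
  also have "\<dots> \<le> wcom (Put a e1 e2) * b"
    using bits_eval[OF assms, of e1] bits_eval[OF assms, of e2] bounded_pos[OF assms]
    by (simp add: algebra_simps)
  finally have cost: "scost ?c (X, x) \<le> wcom (Put a e1 e2) * b" .
  have "steps (ys @ ?c @ zs) (length ys, X, x) (scost ?c (X, x)) (length ys + length ?c, srun ?c (X, x))"
    by (intro steps_srun) (simp add: addr_code_def)
  then show "\<exists>X' t. t \<le> wcom (Put a e1 e2) * b \<and> agree X' (upd m a (eval e1 m) (eval e2 m)) \<and>
     steps (ys @ ?c @ zs) (length ys, X, x) t (length ys + clen (Put a e1 e2), X', x)"
    using fin cost by (metis length_ccom)
qed

lemma run_Get: "run (Get a) (m, x) (bits (next_input x)) (upd m a 0 (next_input x), tl x)"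
  unfolding run_def fst_conv snd_conv
proof (intro allI impI)
  fix ys zs :: "instr list" and X :: "nat \<Rightarrow> nat"
  assume "agree X m"
  then have "agree (X(reg a 0 := next_input x)) (upd m a 0 (next_input x))"
    by (simp add: agree_def)
  moreover have "steps (ys @ ccom (length ys) (Get a) @ zs) (length ys, X, x)
      (bits (next_input x)) (length ys + clen (Get a), X(reg a 0 := next_input x), tl x)"
    using steps_instr[of ys "Read (reg a 0)" zs "(X, x)"] by simp
  ultimately show "\<exists>X' t. t \<le> bits (next_input x) \<and> agree X' (upd m a 0 (next_input x)) \<and>
     steps (ys @ ccom (length ys) (Get a) @ zs) (length ys, X, x) t (length ys + clen (Get a), X', tl x)"
    by blast
qed

lemma run_Skip: "run Skip s 0 s"
  unfolding run_def using steps_refl by fastforce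

lemma run_Seq:
  assumes "run c1 s T1 s1" "run c2 s1 T2 s2"
  shows "run (Seq c1 c2) s (T1 + T2) s2"
  unfolding run_def
proof (intro allI impI)
  fix ys zs :: "instr list" and X :: "nat \<Rightarrow> nat"
  assume X: "agree X (fst s)"
  let ?c1 = "ccom (length ys) c1" and ?c2 = "ccom (length ys + clen c1) c2"
  obtain X1 t1 where 1: "t1 \<le> T1" "agree X1 (fst s1)"
    "steps (ys @ ?c1 @ ?c2 @ zs) (length ys, X, snd s) t1 (length ys + clen c1, X1, snd s1)"
    using assms(1) X unfolding run_def by blast
  obtain X2 t2 where 2: "t2 \<le> T2" "agree X2 (fst s2)"
    "steps ((ys @ ?c1) @ ?c2 @ zs) (length ys + clen c1, X1, snd s1) t2
       (length ys + clen c1 + clen c2, X2, snd s2)"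
    using assms(2)[unfolded run_def, rule_format, OF 1(2), of "ys @ ?c1" zs] by auto
  have "steps (ys @ ccom (length ys) (Seq c1 c2) @ zs) (length ys, X, snd s) (t1 + t2)
     (length ys + clen (Seq c1 c2), X2, snd s2)"
    using steps_trans[OF 1(3) 2(3)[simplified]] by (simp add: add.assoc)
  then show "\<exists>X' t. t \<le> T1 + T2 \<and> agree X' (fst s2) \<and>
     steps (ys @ ccom (length ys) (Seq c1 c2) @ zs) (length ys, X, snd s) t
       (length ys + clen (Seq c1 c2), X', snd s2)"
    using 1 2 add_mono by blast
qed

text \<open>The machine only jumps on positive registers, so \<open>Const (tmp 0) 1\<close> followed
  by \<open>Jpos\<close> acts as an unconditional jump. These two instructions cost 1 each, which
  the summand 3 covers.\<close>

lemma branch_steps: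
  assumes X: "agree X m" and b: "bounded b m"
  shows "\<exists>X' t. agree X' m \<and> t \<le> (wexp e + wval e + 3) * b \<and>
    steps (ys @ cexp e 0 @ [Jpos (tmp 0) p, Const (tmp 0) 1, Jpos (tmp 0) q] @ zs)
      (length ys, X, x) t (if 0 < eval e m then p else q, X', x)"
proof -
  obtain X1 where X1: "srun (cexp e 0) (X, x) = (X1, x)" "agree X1 m" "X1 (tmp 0) = eval e m"
     "scost (cexp e 0) (X, x) \<le> wexp e * b"
    using cexp_run[OF X, of e 0 x b] b by auto
  let ?P = "ys @ cexp e 0 @ [Jpos (tmp 0) p, Const (tmp 0) 1, Jpos (tmp 0) q] @ zs"
  let ?l = "length ys + length (cexp e 0)"
  have 1: "steps ?P (length ys, X, x) (scost (cexp e 0) (X, x)) (?l, X1, x)"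
    using steps_srun[OF jump_free_cexp, of ys e 0 "[Jpos (tmp 0) p, Const (tmp 0) 1, Jpos (tmp 0) q] @ zs" "(X, x)"] X1
    by simp
  have 2: "steps ?P (?l, X1, x) (bits (eval e m)) (if 0 < eval e m then p else Suc ?l, X1, x)"
    using steps_instr[of "ys @ cexp e 0" "Jpos (tmp 0) p" "[Const (tmp 0) 1, Jpos (tmp 0) q] @ zs" "(X1, x)"] X1
    by simp
  have base: "scost (cexp e 0) (X, x) + bits (eval e m) \<le> (wexp e + wval e) * b"
    using bits_eval[OF b, of e] X1 by (simp add: algebra_simps)
  show ?thesis
  proof (cases "0 < eval e m")
    case True
    have "scost (cexp e 0) (X, x) + bits (eval e m) \<le> (wexp e + wval e + 3) * b"
      using base by (simp add: algebra_simps)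
    with steps_trans[OF 1 2] X1 True show ?thesis by auto
  next
    case False
    have 0: "(if 0 < eval e m then p else Suc ?l) = Suc ?l" using False by simp
    let ?X = "X1(tmp 0 := 1)"
    have 3: "steps ?P (Suc ?l, X1, x) 1 (Suc (Suc ?l), ?X, x)"
      using steps_instr[of "ys @ cexp e 0 @ [Jpos (tmp 0) p]" "Const (tmp 0) 1" "[Jpos (tmp 0) q] @ zs" "(X1, x)"]
      by simp
    have 4: "steps ?P (Suc (Suc ?l), ?X, x) 1 (q, ?X, x)"
      using steps_instr[of "ys @ cexp e 0 @ [Jpos (tmp 0) p, Const (tmp 0) 1]" "Jpos (tmp 0) q" zs "(?X, x)"]
      by simp
    have "steps ?P (length ys, X, x) (scost (cexp e 0) (X, x) + bits (eval e m) + 1 + 1) (q, ?X, x)"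
      using steps_trans[OF steps_trans[OF steps_trans[OF 1 2[unfolded 0]] 3] 4] .
    moreover have "scost (cexp e 0) (X, x) + bits (eval e m) + 1 + 1 \<le> (wexp e + wval e + 3) * b"
      using base bounded_pos[OF b] by (simp add: algebra_simps)
    moreover have "agree ?X m" using X1 by (simp add: agree_def)
    ultimately show ?thesis using False by auto
  qed
qed

lemma run_Cond_false:
  assumes "bounded b m" "eval e m = 0"
  shows "run (Cond e c) (m, x) ((wexp e + wval e + 3) * b) (m, x)"
  unfolding run_def fst_conv snd_conv
proof (intro allI impI)
  fix ys zs :: "instr list" and X :: "nat \<Rightarrow> nat"
  assume X: "agree X m"
  let ?p = "length ys + length (cexp e 0) + 3"
  obtain X1 t where "agree X1 m" "t \<le> (wexp e + wval e + 3) * b"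
    "steps (ys @ cexp e 0 @ [Jpos (tmp 0) ?p, Const (tmp 0) 1, Jpos (tmp 0) (?p + clen c)] @ ccom ?p c @ zs)
      (length ys, X, x) t (?p + clen c, X1, x)"
    using branch_steps[OF X assms(1), of e ys ?p "?p + clen c" "ccom ?p c @ zs" x] assms(2) by auto
  then show "\<exists>X' t. t \<le> (wexp e + wval e + 3) * b \<and> agree X' m \<and>
     steps (ys @ ccom (length ys) (Cond e c) @ zs) (length ys, X, x) t (length ys + clen (Cond e c), X', x)"
    by (intro exI[of _ X1] exI[of _ t]) (simp add: Let_def add.assoc)
qed

lemma run_Cond_true:
  assumes "bounded b m" "0 < eval e m" "run c (m, x) T s'"
  shows "run (Cond e c) (m, x) ((wexp e + wval e + 3) * b + T) s'"
  unfolding run_def fst_conv snd_conv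
proof (intro allI impI)
  fix ys zs :: "instr list" and X :: "nat \<Rightarrow> nat"
  assume X: "agree X m"
  let ?p = "length ys + length (cexp e 0) + 3"
  let ?j = "[Jpos (tmp 0) ?p, Const (tmp 0) 1, Jpos (tmp 0) (?p + clen c)]"
  obtain X1 t1 where 1: "agree X1 m" "t1 \<le> (wexp e + wval e + 3) * b"
    "steps (ys @ cexp e 0 @ ?j @ ccom ?p c @ zs) (length ys, X, x) t1 (?p, X1, x)"
    using branch_steps[OF X assms(1), of e ys ?p "?p + clen c" "ccom ?p c @ zs" x] assms(2) by auto
  have p: "length (ys @ cexp e 0 @ ?j) = ?p" by simp
  obtain X2 t2 where 2: "t2 \<le> T" "agree X2 (fst s')"
    "steps ((ys @ cexp e 0 @ ?j) @ ccom ?p c @ zs) (?p, X1, x) t2 (?p + clen c, X2, snd s')"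
    using assms(3)[unfolded run_def fst_conv snd_conv, rule_format, OF 1(1), of "ys @ cexp e 0 @ ?j" zs]
    unfolding p by blast
  have "steps (ys @ ccom (length ys) (Cond e c) @ zs) (length ys, X, x) (t1 + t2)
     (length ys + clen (Cond e c), X2, snd s')"
    using steps_trans[OF 1(3) 2(3)[unfolded append_assoc]] by (simp add: Let_def add.assoc)
  then show "\<exists>X' t. t \<le> (wexp e + wval e + 3) * b + T \<and> agree X' (fst s') \<and>
     steps (ys @ ccom (length ys) (Cond e c) @ zs) (length ys, X, x) t (length ys + clen (Cond e c), X', snd s')"
    using 1 2 add_mono by blast
qed

lemma run_While_false:
  assumes "bounded b m" "eval e m = 0"
  shows "run (While e c) (m, x) ((wexp e + wval e + 5) * b) (m, x)"
  unfolding run_def fst_conv snd_conv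
proof (intro allI impI)
  fix ys zs :: "instr list" and X :: "nat \<Rightarrow> nat"
  assume X: "agree X m"
  let ?p = "length ys + length (cexp e 0) + 3"
  let ?z = "[Const (tmp 0) 1, Jpos (tmp 0) (length ys)]"
  obtain X1 t where 1: "agree X1 m" "t \<le> (wexp e + wval e + 3) * b"
    "steps (ys @ cexp e 0 @ [Jpos (tmp 0) ?p, Const (tmp 0) 1, Jpos (tmp 0) (?p + clen c + 2)] @
        ccom ?p c @ ?z @ zs)
      (length ys, X, x) t (?p + clen c + 2, X1, x)"
    using branch_steps[OF X assms(1), of e ys ?p "?p + clen c + 2" "ccom ?p c @ ?z @ zs" x] assms(2)
    by auto
  have "t \<le> (wexp e + wval e + 5) * b"
    using 1(2) by (simp add: algebra_simps)
  with 1 show "\<exists>X' t. t \<le> (wexp e + wval e + 5) * b \<and> agree X' m \<and>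
     steps (ys @ ccom (length ys) (While e c) @ zs) (length ys, X, x) t
       (length ys + clen (While e c), X', x)"
    by (intro exI[of _ X1] exI[of _ t]) (simp add: Let_def ac_simps)
qed

text \<open>The weight 5 consists of the 3 from \<open>branch_steps\<close> and 2 for the
  unconditional jump back to the test.\<close>

lemma run_While_true:
  assumes "bounded b m" "0 < eval e m" "run c (m, x) T s1" "run (While e c) s1 T' s'"
  shows "run (While e c) (m, x) ((wexp e + wval e + 5) * b + T + T') s'"
  unfolding run_def fst_conv snd_conv
proof (intro allI impI)
  fix ys zs :: "instr list" and X :: "nat \<Rightarrow> nat"
  assume X: "agree X m"
  let ?p = "length ys + length (cexp e 0) + 3"
  let ?j = "[Jpos (tmp 0) ?p, Const (tmp 0) 1, Jpos (tmp 0) (?p + clen c + 2)]"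
  let ?z = "[Const (tmp 0) 1, Jpos (tmp 0) (length ys)]"
  let ?P = "ys @ cexp e 0 @ ?j @ ccom ?p c @ ?z @ zs"
  obtain X1 t1 where 1: "agree X1 m" "t1 \<le> (wexp e + wval e + 3) * b"
    "steps ?P (length ys, X, x) t1 (?p, X1, x)"
    using branch_steps[OF X assms(1), of e ys ?p "?p + clen c + 2" "ccom ?p c @ ?z @ zs" x] assms(2)
    by auto
  have p: "length (ys @ cexp e 0 @ ?j) = ?p" by simp
  obtain X2 t2 where 2: "t2 \<le> T" "agree X2 (fst s1)"
    "steps ((ys @ cexp e 0 @ ?j) @ ccom ?p c @ ?z @ zs) (?p, X1, x) t2 (?p + clen c, X2, snd s1)"
    using assms(3)[unfolded run_def fst_conv snd_conv, rule_format, OF 1(1), of "ys @ cexp e 0 @ ?j" "?z @ zs"]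
    unfolding p by blast
  let ?X = "X2(tmp 0 := 1)"
  have 3: "steps ?P (?p + clen c, X2, snd s1) 1 (Suc (?p + clen c), ?X, snd s1)"
    using steps_instr[of "ys @ cexp e 0 @ ?j @ ccom ?p c" "Const (tmp 0) 1"
        "Jpos (tmp 0) (length ys) # zs" "(X2, snd s1)"]
    by (simp add: ac_simps eval_nat_numeral)
  have 4: "steps ?P (Suc (?p + clen c), ?X, snd s1) 1 (length ys, ?X, snd s1)"
    using steps_instr[of "ys @ cexp e 0 @ ?j @ ccom ?p c @ [Const (tmp 0) 1]"
        "Jpos (tmp 0) (length ys)" zs "(?X, snd s1)"]
    by (simp add: ac_simps eval_nat_numeral)
  have "agree ?X (fst s1)" using 2 by (simp add: agree_def)
  then obtain X3 t3 where 5: "t3 \<le> T'" "agree X3 (fst s')"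
    "steps (ys @ ccom (length ys) (While e c) @ zs) (length ys, ?X, snd s1) t3
       (length ys + clen (While e c), X3, snd s')"
    using assms(4)[unfolded run_def, rule_format, of ?X ys zs] by blast
  have P: "ys @ ccom (length ys) (While e c) @ zs = ?P"
    by (simp add: Let_def add.assoc)
  have "steps ?P (length ys, X, x) (t1 + (t2 + (1 + (1 + t3)))) (length ys + clen (While e c), X3, snd s')"
    using 2(3) by (intro steps_trans[OF 1(3)] steps_trans[OF _ steps_trans[OF 3 steps_trans[OF 4 5(3)[unfolded P]]]])
      simp
  moreover have "t1 + (t2 + (1 + (1 + t3))) \<le> (wexp e + wval e + 5) * b + T + T'"
    using 1(2) 2(1) 5(1) bounded_pos[OF assms(1)] by (simp add: algebra_simps)
  ultimately show "\<exists>X' t. t \<le> (wexp e + wval e + 5) * b + T + T' \<and> agree X' (fst s') \<and>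
     steps (ys @ ccom (length ys) (While e c) @ zs) (length ys, X, x) t
       (length ys + clen (While e c), X', snd s')"
    using 5(2) unfolding P by blast
qed

lemma run_mono: "run c s T s' \<Longrightarrow> T \<le> T' \<Longrightarrow> run c s T' s'"
  unfolding run_def by (meson le_trans)

section \<open>Hoare logic for total correctness with time bounds\<close>

definition hoare ::
  "(mem \<Rightarrow> nat list \<Rightarrow> bool) \<Rightarrow> com \<Rightarrow> nat \<Rightarrow> (mem \<Rightarrow> nat list \<Rightarrow> bool) \<Rightarrow> bool" where
  "hoare P c T Q \<longleftrightarrow> (\<forall>m x. P m x \<longrightarrow> (\<exists>m' x'. run c (m, x) T (m', x') \<and> Q m' x'))"


lemma hoare_conseq:
  "hoare P c T Q \<Longrightarrow> (\<And>m x. P' m x \<Longrightarrow> P m x) \<Longrightarrow> (\<And>m x. Q m x \<Longrightarrow> Q' m x) \<Longrightarrow> T \<le> T' \<Longrightarrow>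
   hoare P' c T' Q'"
  unfolding hoare_def using run_mono by meson

lemma hoare_ex: "(\<And>y. hoare (P y) c T Q) \<Longrightarrow> hoare (\<lambda>m x. \<exists>y. P y m x) c T Q"
  unfolding hoare_def by blast

lemma hoare_Skip: "(\<And>m x. P m x \<Longrightarrow> Q m x) \<Longrightarrow> hoare P Skip T Q"
  unfolding hoare_def using run_mono[OF run_Skip] by blast

lemma hoare_Put:
  "(\<And>m x. P m x \<Longrightarrow> bounded b m \<and> Q (upd m a (eval e1 m) (eval e2 m)) x) \<Longrightarrow>
   hoare P (Put a e1 e2) (wcom (Put a e1 e2) * b) Q"
  unfolding hoare_def using run_Put by blast

lemma hoare_Get:
  "(\<And>m x. P m x \<Longrightarrow> bits (next_input x) \<le> T \<and> Q (upd m a 0 (next_input x)) (tl x)) \<Longrightarrow>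
   hoare P (Get a) T Q"
  unfolding hoare_def using run_mono[OF run_Get] by blast

lemma hoare_Seq: "hoare P c1 T1 Q \<Longrightarrow> hoare Q c2 T2 S \<Longrightarrow> hoare P (Seq c1 c2) (T1 + T2) S"
  unfolding hoare_def using run_Seq by (metis prod.collapse)

lemma hoare_Cond:
  assumes "\<And>m x. P m x \<Longrightarrow> bounded b m"
    and "hoare (\<lambda>m x. P m x \<and> 0 < eval e m) c T Q"
    and "\<And>m x. P m x \<Longrightarrow> eval e m = 0 \<Longrightarrow> Q m x"
  shows "hoare P (Cond e c) (wcom (Cond e Skip) * b + T) Q"
  unfolding hoare_def
proof (intro allI impI)
  fix m x
  assume P: "P m x"
  show "\<exists>m' x'. run (Cond e c) (m, x) (wcom (Cond e Skip) * b + T) (m', x') \<and> Q m' x'"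
  proof (cases "eval e m = 0")
    case True
    show ?thesis
      using run_mono[OF run_Cond_false[OF assms(1)[OF P] True], of "wcom (Cond e Skip) * b + T" c x]
        assms(3)[OF P True] by (intro exI[of _ m] exI[of _ x]) simp
  next
    case False
    then obtain m' x' where "run c (m, x) T (m', x')" "Q m' x'"
      using assms(2) P unfolding hoare_def by blast
    with run_Cond_true[OF assms(1)[OF P], of e c x T "(m', x')"] False show ?thesis by auto
  qed
qed

text \<open>The counter is not reset. \<open>read_edges\<close> relies on the zeros of the initial
  memory, the later loops store 0 beforehand.\<close>

definition For :: "name \<Rightarrow> exp \<Rightarrow> com \<Rightarrow> com" where
  "For i e c = While (Bin Minus e (scalar i)) (Seq c (Put i (Lit 0) (Bin Plus (scalar i) (Lit 1))))"

text \<open>The bound \<open>e\<close> is evaluated again in every round, so the invariant has to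
  fix its value. The body must leave the counter alone and the memory bounded, since the increment
  runs after it. There are \<open>n + 1\<close> tests, the last of which fails.\<close>

lemma hoare_For:
  assumes inv: "\<And>k m x. k \<le> n \<Longrightarrow> I k m x \<Longrightarrow> m i 0 = k \<and> eval e m = n \<and> bounded b m"
    and body: "\<And>k. k < n \<Longrightarrow>
      hoare (I k) c (T k) (\<lambda>m x. m i 0 = k \<and> bounded b m \<and> I (Suc k) (upd m i 0 (Suc k)) x)"
  shows "hoare (I 0) (For i e c) ((\<Sum>k<n. T k) + (n + 1) * wcom (For i e Skip) * b) (I n)"
proof -
  let ?e = "Bin Minus e (scalar i)" and ?p = "Put i (Lit 0) (Bin Plus (scalar i) (Lit 1))"
  let ?w = "wcom (For i e Skip) * b"
  have w: "?w = (wexp ?e + wval ?e + 5) * b + wcom ?p * b"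
    by (simp add: For_def algebra_simps)
  \<comment> \<open>Generalised to loops entered at any \<open>k\<close>, for an induction downwards
    from \<open>n\<close>.\<close>
  have "hoare (I k) (For i e c) ((\<Sum>j=k..<n. T j) + (n - k + 1) * ?w) (I n)" if "k \<le> n" for k
    using that
  proof (induction rule: inc_induct)
    case base
    have "run (For i e c) (m, x) ?w (m, x)" if "I n m x" for m x
    proof -
      have "run (For i e c) (m, x) ((wexp ?e + wval ?e + 5) * b) (m, x)"
        unfolding For_def using inv[OF le_refl that] by (intro run_While_false) auto
      then show ?thesis by (rule run_mono) (simp add: w)
    qed
    then show ?case unfolding hoare_def by auto
  next
    case (step k)
    show ?case unfolding hoare_def
    proof (intro allI impI)
      fix m x
      assume I: "I k m x"
      obtain m1 x1 where 1: "run c (m, x) (T k) (m1, x1)" "m1 i 0 = k" "bounded b m1"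
        "I (Suc k) (upd m1 i 0 (Suc k)) x1"
        using body[of k] I step.hyps unfolding hoare_def by blast
      obtain m' x' where 2: "run (For i e c) (upd m1 i 0 (Suc k), x1)
          ((\<Sum>j=Suc k..<n. T j) + (n - Suc k + 1) * ?w) (m', x')" "I n m' x'"
        using step.IH 1(4) unfolding hoare_def by blast
      have "run ?p (m1, x1) (wcom ?p * b) (upd m1 i 0 (Suc k), x1)"
        using run_Put[OF 1(3), of i "Lit 0" "Bin Plus (scalar i) (Lit 1)" x1] 1(2) by simp
      then have "run (Seq c ?p) (m, x) (T k + wcom ?p * b) (upd m1 i 0 (Suc k), x1)"
        using run_Seq 1(1) by blast
      then have "run (For i e c) (m, x) ((wexp ?e + wval ?e + 5) * b + (T k + wcom ?p * b)
          + ((\<Sum>j=Suc k..<n. T j) + (n - Suc k + 1) * ?w)) (m', x')"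
        using 2(1) inv[of k m x] I step.hyps unfolding For_def by (intro run_While_true) auto
      moreover have "(wexp ?e + wval ?e + 5) * b + (T k + wcom ?p * b)
          + ((\<Sum>j=Suc k..<n. T j) + (n - Suc k + 1) * ?w) = (\<Sum>j=k..<n. T j) + (n - k + 1) * ?w"
      proof -
        obtain d where d: "n = Suc k + d" using step.hyps by (metis Suc_leI le_iff_add)
        have "(\<Sum>j=k..<n. T j) = T k + (\<Sum>j=Suc k..<n. T j)"
          using step.hyps by (simp add: sum.atLeast_Suc_lessThan)
        moreover have "(n - k + 1) * ?w = ?w + (n - Suc k + 1) * ?w"
          by (simp add: d)
        ultimately show ?thesis using w by linarith
      qed
      ultimately have "run (For i e c) (m, x) ((\<Sum>j=k..<n. T j) + (n - k + 1) * ?w) (m', x')"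
        by (simp only:)
      with 2(2) show "\<exists>m' x'. run (For i e c) (m, x) ((\<Sum>j=k..<n. T j) + (n - k + 1) * ?w) (m', x') \<and> I n m' x'"
        by blast
    qed
  qed
  from this[of 0] show ?thesis by (simp add: atLeast0LessThan algebra_simps)
qed

definition seqs :: "com list \<Rightarrow> com" where
  "seqs cs = foldr Seq cs Skip"

lemma hoare_seqs:
  assumes "\<And>k. k < length cs \<Longrightarrow> hoare (I k) (cs ! k) (T k) (I (Suc k))"
  shows "hoare (I 0) (seqs cs) (\<Sum>k<length cs. T k) (I (length cs))"
  using assms
proof (induction cs arbitrary: I T)
  case Nil
  then show ?case by (simp add: seqs_def hoare_Skip)
next
  case (Cons c cs)
  have "hoare (I 0) c (T 0) (I (Suc 0))" using Cons.prems[of 0] by simp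
  moreover have "hoare (I (Suc 0)) (seqs cs) (\<Sum>k<length cs. T (Suc k)) (I (Suc (length cs)))"
    using Cons.prems[of "Suc k" for k] by (intro Cons.IH[of "\<lambda>k. I (Suc k)" "\<lambda>k. T (Suc k)"]) fastforce
  ultimately have "hoare (I 0) (seqs (c # cs)) (T 0 + (\<Sum>k<length cs. T (Suc k))) (I (Suc (length cs)))"
    unfolding seqs_def by (simp add: hoare_Seq)
  then show ?case by (simp add: sum.lessThan_Suc_shift del: sum.lessThan_Suc)
qed

lemma wcom_seqs: "wcom (seqs cs) = (\<Sum>c\<leftarrow>cs. wcom c)"
  by (induction cs) (auto simp: seqs_def)

lemma ram_computes_hoare:
  assumes "hoare (\<lambda>m y. m = (\<lambda>_ _. 0) \<and> y = x) c T (\<lambda>m y. m Out 0 = r)"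
  shows "\<exists>t\<le>T. ram_computes (ccom 0 c) x t r"
proof -
  obtain m y where "run c (\<lambda>_ _. 0, x) T (m, y)" "m Out 0 = r"
    using assms unfolding hoare_def by blast
  then have "\<exists>X' t. t \<le> T \<and> agree X' m \<and>
     steps ([] @ ccom (length []) c @ []) (length [], \<lambda>_. 0, x) t (length [] + clen c, X', y)"
    unfolding run_def fst_conv snd_conv
    by (elim allE[of _ "[]"] allE[of _ "\<lambda>_. 0"] impE) (auto simp: agree_def)
  then obtain X t where t: "t \<le> T" and X: "agree X m"
    and st: "steps (ccom 0 c) (0, \<lambda>_. 0, x) t (clen c, X, y)"
    by auto
  have "ram_run (ccom 0 c) (0, \<lambda>_. 0, x) t (clen c, X, y)"
    using st by (rule steps_ram_run) simp
  \<comment> \<open>\<open>Out\<close> has code 0, so its cell with index 0 is the output register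
    0.\<close>
  moreover have "X 0 = r"
    using X \<open>m Out 0 = r\<close> unfolding agree_def reg_def by (metis add_0 code.simps(1) mult_0_right)
  ultimately show ?thesis
    unfolding ram_computes_def using t by blast
qed

section \<open>Ordered triples of edges\<close>

definition three :: "nat set" where
  "three = {1, 2, 3}"

lemma three_simps [simp]: "finite three" "card three = 3"
  by (simp_all add: three_def)

text \<open>Membership-vector form of the condition in \<open>venn_sat\<close>. For
  \<open>J = {}\<close> it would speak of points outside all three sets, which is why
  \<open>fits\<close> and \<open>region_iff\<close> are confined to non-empty
  \<open>J\<close>.\<close>

definition region :: "(nat \<Rightarrow> 'a set) \<Rightarrow> nat set \<Rightarrow> bool" where
  "region e J \<longleftrightarrow> (\<exists>v. \<forall>i\<in>three. v \<in> e i \<longleftrightarrow> i \<in> J)"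

definition fits :: "venn \<Rightarrow> (nat \<Rightarrow> 'a set) \<Rightarrow> bool" where
  "fits V e \<longleftrightarrow> (\<forall>J. J \<noteq> {} \<and> J \<subseteq> three \<longrightarrow> V J = region e J)"

lemma fitsI: "(\<And>J. J \<noteq> {} \<Longrightarrow> J \<subseteq> three \<Longrightarrow> V J = region e J) \<Longrightarrow> fits V e"
  unfolding fits_def by simp

lemma fitsD: "fits V e \<Longrightarrow> J \<noteq> {} \<Longrightarrow> J \<subseteq> three \<Longrightarrow> V J = region e J"
  unfolding fits_def by simp

definition triple :: "'b \<Rightarrow> 'b \<Rightarrow> 'b \<Rightarrow> nat \<Rightarrow> 'b" where
  "triple a b c i = (if i = 1 then a else if i = 2 then b else c)"

lemma triple_simps [simp]: "triple a b c (Suc 0) = a" "triple a b c 2 = b" "triple a b c 3 = c"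
  by (simp_all add: triple_def)

lemma region_iff:
  assumes "J \<noteq> {}" "J \<subseteq> three"
  shows "(\<Inter>i\<in>J. e i) - (\<Union>i\<in>three - J. e i) \<noteq> {} \<longleftrightarrow> region e J"
proof -
  have "v \<in> (\<Inter>i\<in>J. e i) - (\<Union>i\<in>A - J. e i) \<longleftrightarrow> (\<forall>i\<in>A. v \<in> e i \<longleftrightarrow> i \<in> J)"
    if "J \<subseteq> A" for v A using that by blast
  from this[OF assms(2)] show ?thesis unfolding region_def by (metis ex_in_conv)
qed

lemma fits_cong: "(\<And>i. i \<in> three \<Longrightarrow> e i = f i) \<Longrightarrow> fits V e = fits V f"
  unfolding fits_def region_def by simp

lemma fits_triple: "fits V (triple (e 1) (e 2) (e 3)) = fits V e"
  by (rule fits_cong) (auto simp: three_def)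

lemma venn_sat_iff: "venn_sat V G \<longleftrightarrow> (\<exists>e. bij_betw e three (edges G) \<and> fits V e)"
  unfolding venn_sat_def fits_def three_def[symmetric] using region_iff by metis

text \<open>Justifies counting with renamed vertices: a renaming that is injective on the three
  edges carries each region onto the corresponding one.\<close>

lemma fits_image:
  assumes "inj_on \<rho> (\<Union>i\<in>three. e i)"
  shows "fits V (\<lambda>i. \<rho> ` e i) = fits V e"
proof -
  have "region (\<lambda>i. \<rho> ` e i) J = region e J" if J: "J \<noteq> {}" "J \<subseteq> three" for J
  proof
    assume "region (\<lambda>i. \<rho> ` e i) J"
    then obtain u where u: "\<forall>i\<in>three. u \<in> \<rho> ` e i \<longleftrightarrow> i \<in> J" unfolding region_def by blast
    with J obtain k where k: "k \<in> three" "u \<in> \<rho> ` e k" by blast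
    then obtain v where v: "v \<in> e k" "u = \<rho> v" by blast
    have "v \<in> e i \<longleftrightarrow> u \<in> \<rho> ` e i" if "i \<in> three" for i
      using assms k v that by (auto simp: inj_on_def)
    with u show "region e J" unfolding region_def by blast
  next
    assume "region e J"
    then obtain v where v: "\<forall>i\<in>three. v \<in> e i \<longleftrightarrow> i \<in> J" unfolding region_def by blast
    with J obtain k where k: "k \<in> three" "v \<in> e k" by blast
    have "v \<in> e i \<longleftrightarrow> \<rho> v \<in> \<rho> ` e i" if "i \<in> three" for i
      using assms k that by (auto simp: inj_on_def)
    with v show "region (\<lambda>i. \<rho> ` e i) J" unfolding region_def by blast
  qed
  then show ?thesis unfolding fits_def by auto
qed

lemma fits_comp:
  assumes "\<pi> permutes three"
  shows "fits (\<lambda>J. V (\<pi> ` J)) (e \<circ> \<pi>) = fits V e"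
proof -
  have reg: "region (e \<circ> \<pi>) J = region e (\<pi> ` J)" for J
  proof -
    have "(\<forall>i\<in>three. v \<in> (e \<circ> \<pi>) i \<longleftrightarrow> i \<in> J) \<longleftrightarrow> (\<forall>i\<in>\<pi> ` three. v \<in> e i \<longleftrightarrow> i \<in> \<pi> ` J)" for v
      using permutes_inj[OF assms] by (simp add: inj_image_mem_iff)
    then show ?thesis unfolding region_def permutes_image[OF assms] by simp
  qed
  have sub: "\<pi> ` J \<subseteq> three \<longleftrightarrow> J \<subseteq> three" for J
    by (auto simp: permutes_in_image[OF assms])
  show ?thesis
  proof
    assume l: "fits (\<lambda>J. V (\<pi> ` J)) (e \<circ> \<pi>)"
    show "fits V e"
    proof (rule fitsI)
      fix J assume J: "J \<noteq> {}" "J \<subseteq> three"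
      have im: "\<pi> ` inv \<pi> ` J = J"
        using image_f_inv_f[OF permutes_surj[OF assms]] .
      have "inv \<pi> ` J \<noteq> {}" "inv \<pi> ` J \<subseteq> three"
        using J sub[of "inv \<pi> ` J"] unfolding im by simp_all
      from fitsD[OF l this] have "V (\<pi> ` inv \<pi> ` J) = region (e \<circ> \<pi>) (inv \<pi> ` J)" .
      then show "V J = region e J" unfolding reg im .
    qed
  next
    assume r: "fits V e"
    show "fits (\<lambda>J. V (\<pi> ` J)) (e \<circ> \<pi>)"
      by (rule fitsI) (simp add: reg fitsD[OF r] sub)
  qed
qed

lemma fits_eq: "fits V e \<Longrightarrow> fits W e \<longleftrightarrow> (\<forall>J. J \<noteq> {} \<and> J \<subseteq> three \<longrightarrow> W J = V J)"
  using fitsD fitsI by metis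

text \<open>The inclusion says that every region \<open>J\<close> with \<open>i \<in> J\<close> and
  \<open>k \<notin> J\<close> is empty. This can be read off the diagram, so one fitting triple
  decides it for all of them, over any vertex type.\<close>

lemma fits_transfer:
  assumes "fits V e" "fits V f" "i \<in> three" "k \<in> three" "e i \<subseteq> e k"
  shows "f i \<subseteq> f k"
proof
  fix v assume v: "v \<in> f i"
  let ?J = "{j \<in> three. v \<in> f j}"
  have "region f ?J" unfolding region_def by blast
  moreover have J: "?J \<noteq> {}" "?J \<subseteq> three" using v assms(3) by blast+
  ultimately have "region e ?J" using fitsD[OF assms(1) J] fitsD[OF assms(2) J] by simp
  then obtain u where "\<forall>j\<in>three. u \<in> e j \<longleftrightarrow> j \<in> ?J" unfolding region_def by blast
  with v assms(3,4,5) show "v \<in> f k" by blast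
qed

lemma proper_venn_fits:
  assumes "proper_venn V"
  obtains G :: "nat hypergraph" and e where "hypergraph G" "bij_betw e three (edges G)" "fits V e"
  using assms unfolding proper_venn_def venn_sat_iff by blast

text \<open>Equality is two inclusions; these transfer to the motif that witnesses
  \<open>proper_venn\<close>, whose edges are distinct.\<close>

lemma fits_inj:
  assumes "proper_venn V" "fits V f"
  shows "inj_on f three"
proof (rule inj_onI)
  fix i k assume ik: "i \<in> three" "k \<in> three" "f i = f k"
  obtain G :: "nat hypergraph" and e where e: "bij_betw e three (edges G)" "fits V e"
    using proper_venn_fits[OF assms(1)] by metis
  have "e i = e k"
    using fits_transfer[OF assms(2) e(2)] ik by (metis subset_antisym subset_refl)
  with e(1) ik show "i = k" unfolding bij_betw_def inj_on_def by blast
qed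

section \<open>Automorphisms of a diagram and orderings of a motif\<close>

definition automorphisms :: "venn \<Rightarrow> (nat \<Rightarrow> nat) set" where
  "automorphisms V =
     {\<pi>. \<pi> permutes three \<and> (\<forall>J. J \<noteq> {} \<and> J \<subseteq> three \<longrightarrow> V (\<pi> ` J) = V J)}"

lemma card_automorphisms_pos: "0 < card (automorphisms V)"
proof -
  have "finite (automorphisms V)"
    unfolding automorphisms_def using finite_permutations[of three] by (rule rev_finite_subset) auto
  moreover have "id \<in> automorphisms V" unfolding automorphisms_def using permutes_id by simp
  ultimately show ?thesis by (metis card_gt_0_iff empty_iff)
qed

text \<open>Relative to one fitting enumeration \<open>e\<close>, each ordering of \<open>A\<close>
  is \<open>e \<circ> \<pi>\<close> for a unique permutation \<open>\<pi>\<close>, and by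
  \<open>fits_comp\<close> and \<open>fits_eq\<close> it fits exactly when \<open>\<pi>\<close>
  preserves \<open>V\<close>. So the number does not depend on \<open>A\<close>.\<close>

lemma card_fibre:
  assumes e: "bij_betw e three A" "fits V e"
  shows "card {(a, b, c). {a, b, c} = A \<and> fits V (triple a b c)} = card (automorphisms V)"
proof -
  have inj: "inj_on e three" and im: "e ` three = A" using e(1) by (auto simp: bij_betw_def)
  have cardA: "card A = 3" using card_image[OF inj] im by simp
  have aut: "fits V (e \<circ> \<pi>) \<longleftrightarrow> \<pi> \<in> automorphisms V" if "\<pi> permutes three" for \<pi>
    using fits_eq[of "\<lambda>J. V (\<pi> ` J)" "e \<circ> \<pi>" V] fits_comp[OF that, of V e] e(2) that
    unfolding automorphisms_def by auto
  have "bij_betw (\<lambda>\<pi>. (e (\<pi> 1), e (\<pi> 2), e (\<pi> 3))) (automorphisms V)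
    {(a, b, c). {a, b, c} = A \<and> fits V (triple a b c)}"
  proof (rule bij_betw_imageI)
    show "inj_on (\<lambda>\<pi>. (e (\<pi> 1), e (\<pi> 2), e (\<pi> 3))) (automorphisms V)"
    proof (rule inj_onI)
      fix \<pi> \<sigma> assume as: "\<pi> \<in> automorphisms V" "\<sigma> \<in> automorphisms V"
        "(e (\<pi> 1), e (\<pi> 2), e (\<pi> 3)) = (e (\<sigma> 1), e (\<sigma> 2), e (\<sigma> 3))"
      then have p: "\<pi> permutes three" "\<sigma> permutes three" by (auto simp: automorphisms_def)
      have "\<pi> i = \<sigma> i" if "i \<in> three" for i
      proof -
        have "e (\<pi> i) = e (\<sigma> i)" using as(3) that by (auto simp: three_def)
        then show ?thesis
          using inj that permutes_in_image[OF p(1)] permutes_in_image[OF p(2)] by (meson inj_onD)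
      qed
      moreover have "\<pi> i = \<sigma> i" if "i \<notin> three" for i
        using p that by (metis permutes_not_in)
      ultimately show "\<pi> = \<sigma>" by blast
    qed
    show "(\<lambda>\<pi>. (e (\<pi> 1), e (\<pi> 2), e (\<pi> 3))) ` automorphisms V =
      {(a, b, c). {a, b, c} = A \<and> fits V (triple a b c)}" (is "?l = ?r")
    proof (intro equalityI subsetI)
      fix t assume "t \<in> ?l"
      then obtain \<pi> where \<pi>: "\<pi> \<in> automorphisms V" "t = (e (\<pi> 1), e (\<pi> 2), e (\<pi> 3))" by blast
      then have p: "\<pi> permutes three" by (simp add: automorphisms_def)
      have "{e (\<pi> 1), e (\<pi> 2), e (\<pi> 3)} = e ` \<pi> ` three" by (simp add: three_def)
      then have "{e (\<pi> 1), e (\<pi> 2), e (\<pi> 3)} = A" unfolding permutes_image[OF p] im .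
      moreover have "fits V (triple (e (\<pi> 1)) (e (\<pi> 2)) (e (\<pi> 3)))"
        using aut[OF p] \<pi>(1) fits_triple[of V "e \<circ> \<pi>"] by simp
      ultimately show "t \<in> ?r" using \<pi> by simp
    next
      fix t assume "t \<in> ?r"
      then obtain a b c where t: "t = (a, b, c)" "{a, b, c} = A" "fits V (triple a b c)" by auto
      define g where "g = triple a b c"
      have gim: "g ` three = A" using t by (simp add: g_def three_def)
      then have ginj: "inj_on g three" using cardA by (intro eq_card_imp_inj_on) auto
      \<comment> \<open>The identity outside of \<open>three\<close>, as \<open>permutes\<close>
        demands.\<close>
      define \<pi> where "\<pi> i = (if i \<in> three then inv_into three e (g i) else i)" for i
      have e\<pi>: "e (\<pi> i) = g i" "\<pi> i \<in> three" if "i \<in> three" for i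
      proof -
        have "g i \<in> e ` three" using gim im that by blast
        then show "e (\<pi> i) = g i" "\<pi> i \<in> three"
          unfolding \<pi>_def using that f_inv_into_f inv_into_into by (metis (full_types))+
      qed
      have "inj_on \<pi> three" using ginj e\<pi> by (metis inj_on_def)
      then have "bij_betw \<pi> three three"
        using e\<pi> endo_inj_surj[of three \<pi>] by (auto simp: bij_betw_def)
      then have p: "\<pi> permutes three" by (intro bij_imp_permutes) (auto simp: \<pi>_def)
      have "fits V (e \<circ> \<pi>)"
        using t(3) e\<pi> by (subst fits_cong[of _ g]) (simp_all add: g_def)
      then have "\<pi> \<in> automorphisms V" using aut[OF p] by simp
      moreover have "t = (e (\<pi> 1), e (\<pi> 2), e (\<pi> 3))" using t e\<pi> by (simp add: g_def three_def)
      ultimately show "t \<in> ?l" by blast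
    qed
  qed
  from bij_betw_same_card[OF this] show ?thesis ..
qed

text \<open>The fitting triples are grouped by their set of entries. By \<open>fits_inj\<close> the
  entries are distinct, so this set is a motif, and by \<open>card_fibre\<close> all groups have the
  same size.\<close>

lemma card_motifs:
  assumes fin: "finite (edges G)" and V: "proper_venn V"
  shows "card (motifs V G) * card (automorphisms V) =
    card {(a, b, c). a \<in> edges G \<and> b \<in> edges G \<and> c \<in> edges G \<and> fits V (triple a b c)}"
    (is "_ = card ?T")
proof -
  let ?F = "\<lambda>A. {(a, b, c). {a, b, c} = A \<and> fits V (triple a b c)}"
  have ind: "edges (edge_induced G A) = A" for A by (simp add: edge_induced_def)
  have T: "?T = (\<Union>A\<in>motifs V G. ?F A)"
  proof (intro equalityI subsetI)
    fix t assume "t \<in> ?T"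
    then obtain a b c where t: "t = (a, b, c)" "{a, b, c} \<subseteq> edges G" "fits V (triple a b c)" by auto
    have inj: "inj_on (triple a b c) three" using fits_inj[OF V t(3)] .
    moreover have im: "triple a b c ` three = {a, b, c}" by (simp add: three_def)
    ultimately have "bij_betw (triple a b c) three {a, b, c}" by (simp add: bij_betw_def)
    moreover have "card {a, b, c} = 3" using card_image[OF inj] unfolding im by simp
    ultimately have "{a, b, c} \<in> motifs V G"
      unfolding motifs_def venn_sat_iff ind using t by blast
    with t show "t \<in> (\<Union>A\<in>motifs V G. ?F A)" by blast
  next
    fix t assume "t \<in> (\<Union>A\<in>motifs V G. ?F A)"
    then show "t \<in> ?T" unfolding motifs_def by auto
  qed
  have finm: "finite (motifs V G)"
    unfolding motifs_def using fin by (rule_tac finite_subset[of _ "Pow (edges G)"]) auto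
  have "card ?T = (\<Sum>A\<in>motifs V G. card (?F A))"
    unfolding T
  proof (rule card_UN_disjoint[OF finm])
    show "\<forall>A\<in>motifs V G. finite (?F A)"
    proof
      fix A assume "A \<in> motifs V G"
      then have "finite A" using fin unfolding motifs_def by (auto intro: finite_subset)
      then show "finite (?F A)" by (rule_tac finite_subset[of _ "A \<times> A \<times> A"]) auto
    qed
  qed auto
  also have "\<dots> = (\<Sum>A\<in>motifs V G. card (automorphisms V))"
  proof (rule sum.cong[OF refl])
    fix A assume "A \<in> motifs V G"
    then obtain e where "bij_betw e three A" "fits V e"
      unfolding motifs_def venn_sat_iff ind by blast
    then show "card (?F A) = card (automorphisms V)" by (rule card_fibre)
  qed
  finally show ?thesis by simp
qed

section \<open>Permuting the three sets; normal form of degenerate diagrams\<close>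

lemma venn_sat_permute:
  assumes \<pi>: "\<pi> permutes three"
  shows "venn_sat (\<lambda>J. V (\<pi> ` J)) G = venn_sat V G"
proof
  assume "venn_sat V G"
  then obtain e where "bij_betw e three (edges G)" "fits V e" unfolding venn_sat_iff by blast
  then have "bij_betw (e \<circ> \<pi>) three (edges G)" "fits (\<lambda>J. V (\<pi> ` J)) (e \<circ> \<pi>)"
    using bij_betw_trans[OF permutes_imp_bij[OF \<pi>]] fits_comp[OF \<pi>] by blast+
  then show "venn_sat (\<lambda>J. V (\<pi> ` J)) G" unfolding venn_sat_iff by blast
next
  assume "venn_sat (\<lambda>J. V (\<pi> ` J)) G"
  then obtain e where e: "bij_betw e three (edges G)" "fits (\<lambda>J. V (\<pi> ` J)) e"
    unfolding venn_sat_iff by blast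
  have inv: "inv \<pi> permutes three" using \<pi> by (rule permutes_inv)
  have eq: "(e \<circ> inv \<pi>) \<circ> \<pi> = e"
    using permutes_inv_o(2)[OF \<pi>] by (simp add: comp_assoc)
  have "fits V (e \<circ> inv \<pi>)" using fits_comp[OF \<pi>, of V "e \<circ> inv \<pi>"] e(2) unfolding eq by blast
  moreover have "bij_betw (e \<circ> inv \<pi>) three (edges G)"
    using bij_betw_trans[OF permutes_imp_bij[OF inv] e(1)] .
  ultimately show "venn_sat V G" unfolding venn_sat_iff by blast
qed

lemma permutes_three:
  assumes "i \<in> three" "k \<in> three" "i \<noteq> k"
  obtains \<pi> where "\<pi> permutes three" "\<pi> 1 = i" "\<pi> 2 = k"
proof -
  let ?s = "transpose 1 i"
  have 1: "?s permutes three" using assms by (intro permutes_swap_id) (auto simp: three_def)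
  have k: "transpose 1 i k \<in> three" "transpose 1 i k \<noteq> 1"
    using permutes_in_image[OF 1] assms by (auto simp: transpose_def three_def)
  then have 2: "transpose 2 (transpose 1 i k) permutes three" by (intro permutes_swap_id) (auto simp: three_def)
  \<comment> \<open>The inner transposition fixes 1 and sends 2 to the preimage of \<open>k\<close>
    under the outer one, which then sends 1 to \<open>i\<close> and that preimage to
    \<open>k\<close>.\<close>
  let ?p = "?s \<circ> transpose 2 (transpose 1 i k)"
  have "?p permutes three" using permutes_compose[OF 2 1] .
  moreover have "transpose 2 (transpose 1 i k) 1 = 1"
    using k(2) by (intro transpose_apply_other) auto
  then have "?p 1 = i" "?p 2 = k" by simp_all
  ultimately show ?thesis by (rule that)
qed

text \<open>In the definition of \<open>degenerate\<close> the nested pair may vary with the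
  hypergraph. The witness of \<open>proper_venn\<close> supplies one pair of indices,
  \<open>fits_transfer\<close> spreads it to all triples, and \<open>\<pi>\<close> moves it to
  positions 1 and 2.\<close>

lemma degenerate_permute:
  assumes V: "proper_venn V" "degenerate V"
  obtains \<pi> where "\<pi> permutes three"
    "\<And>f :: nat \<Rightarrow> nat set. fits (\<lambda>J. V (\<pi> ` J)) f \<Longrightarrow> f 1 \<subseteq> f 2"
proof -
  obtain G :: "nat hypergraph" and e where
    e: "hypergraph G" "bij_betw e three (edges G)" "fits V e"
    using proper_venn_fits[OF V(1)] by metis
  then have "venn_sat V G" unfolding venn_sat_iff by blast
  with V(2) e(1) obtain a b where "a \<in> edges G" "b \<in> edges G" "a \<noteq> b" "a \<subseteq> b"
    unfolding degenerate_def by blast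
  then obtain i k where ik: "i \<in> three" "k \<in> three" "i \<noteq> k" "e i \<subseteq> e k"
    using e(2) unfolding bij_betw_def by (metis imageE)
  obtain \<pi> where \<pi>: "\<pi> permutes three" "\<pi> 1 = i" "\<pi> 2 = k"
    using permutes_three[OF ik(1-3)] by blast
  have "fits (\<lambda>J. V (\<pi> ` J)) (e \<circ> \<pi>)" using e(3) fits_comp[OF \<pi>(1)] by blast
  then have "f 1 \<subseteq> f 2" if "fits (\<lambda>J. V (\<pi> ` J)) f" for f :: "nat \<Rightarrow> nat set"
    using fits_transfer[OF _ that, of "e \<circ> \<pi>" 1 2] ik(4) \<pi> by (simp add: three_def)
  with \<pi>(1) show ?thesis by (rule that)
qed

section \<open>Counting by table lookups\<close>

text \<open>Truncated subtraction from 1 is the test for zero. All Boolean conditions are built from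
  it, so that counting needs no branches.\<close>

definition isz :: "exp \<Rightarrow> exp" where
  "isz e = Bin Minus (Lit 1) e"

definition nz :: "exp \<Rightarrow> exp" where
  "nz e = isz (isz e)"

definition esum :: "exp list \<Rightarrow> exp" where
  "esum es = foldr (Bin Plus) es (Lit 0)"

definition eprod :: "exp list \<Rightarrow> exp" where
  "eprod es = foldr (Bin Times) es (Lit 1)"

text \<open>One of the truncated differences vanishes, so their sum is the absolute
  difference.\<close>

definition eeq :: "exp \<Rightarrow> exp \<Rightarrow> exp" where
  "eeq a b = isz (Bin Plus (Bin Minus a b) (Bin Minus b a))"

definition emem :: "exp \<Rightarrow> exp list \<Rightarrow> exp" where
  "emem a bs = nz (esum (map (eeq a) bs))"

definition eiff :: "bool \<Rightarrow> exp \<Rightarrow> exp" where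
  "eiff b e = (if b then nz e else isz e)"

lemma eval_isz [simp]: "eval (isz e) m = of_bool (eval e m = 0)"
  by (simp add: isz_def)

lemma eval_nz [simp]: "eval (nz e) m = of_bool (eval e m \<noteq> 0)"
  by (simp add: nz_def)

lemma eval_esum [simp]: "eval (esum es) m = (\<Sum>e\<leftarrow>es. eval e m)"
  by (induction es) (auto simp: esum_def)

lemma eval_eprod [simp]: "eval (eprod es) m = (\<Prod>e\<leftarrow>es. eval e m)"
  by (induction es) (auto simp: eprod_def)

lemma eval_eeq [simp]: "eval (eeq a b) m = of_bool (eval a m = eval b m)"
  unfolding eeq_def by auto

lemma eval_emem [simp]: "eval (emem a bs) m = of_bool (eval a m \<in> (\<lambda>e. eval e m) ` set bs)"
  unfolding emem_def by (auto simp: sum_list_eq_0_iff image_iff)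

lemma eval_eiff [simp]: "eval (eiff b e) m = of_bool (b = (eval e m \<noteq> 0))"
  unfolding eiff_def by auto

lemma prod_list_of_bool: "(\<Prod>x\<leftarrow>xs. of_bool (P x)) = (of_bool (\<forall>x\<in>set xs. P x) :: nat)"
  by (induction xs) auto

text \<open>A numeral in base \<open>B\<close>, least significant digit first. It ignores trailing
  zeros, hence is injective only among words of equal length; all table words have length
  \<open>3 * R\<close>.\<close>

definition key :: "nat \<Rightarrow> nat list \<Rightarrow> nat" where
  "key B ws = foldr (\<lambda>w acc. w + B * acc) ws 0"

definition ekey :: "exp list \<Rightarrow> exp" where
  "ekey ws = foldr (\<lambda>e acc. Bin Plus e (Bin Times (scalar Base) acc)) ws (Lit 0)"

lemma eval_ekey [simp]: "eval (ekey ws) m = key (m Base 0) (map (\<lambda>e. eval e m) ws)"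
  by (induction ws) (auto simp: ekey_def key_def)

lemma key_inj:
  assumes "length v = length w" "set v \<subseteq> {..<B}" "set w \<subseteq> {..<B}" "key B v = key B w"
  shows "v = w"
  using assms
proof (induction v w rule: list_induct2)
  case (Cons x v y w)
  then have eq: "x + B * key B v = y + B * key B w" and xy: "x < B" "y < B"
    by (simp_all add: key_def)
  have "x = y" using arg_cong[OF eq, of "\<lambda>z. z mod B"] xy by simp
  with eq xy Cons show ?case by simp
qed simp

text \<open>\<open>ecount\<close> removes the negative conditions by inclusion and exclusion:
  the edges containing \<open>W\<close> but not \<open>u\<close> are those containing \<open>W\<close> minus those containing
  \<open>W \<union> {u}\<close>. The vertex 0 belongs to all padded edges, so it can fill up the keys.\<close>

fun ecount :: "(exp \<times> bool) list \<Rightarrow> exp list \<Rightarrow> exp" where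
  "ecount [] w = At Cnt (ekey w)"
| "ecount ((u, b) # r) w =
     (if b then ecount r (u # w) else Bin Minus (ecount r (Lit 0 # w)) (ecount r (u # w)))"

definition masked :: "exp list \<Rightarrow> bool list \<Rightarrow> exp list" where
  "masked cs p = map (\<lambda>(c, b). if b then c else Lit 0) (zip cs p)"

definition patterns :: "nat \<Rightarrow> bool list list" where
  "patterns n = List.n_lists n [False, True]"

text \<open>The slots of a masked list are distinct apart from zeros, hence requiring the slots
  outside of the mask to be nonzero selects one mask per set.\<close>

definition ecover :: "nat \<Rightarrow> exp list \<Rightarrow> bool list \<Rightarrow> exp" where
  "ecover R cs p = Bin Times
     (eprod (map (\<lambda>(c, b). if b then Lit 1 else nz c) (zip cs p)))
     (At IsEdge (ekey (masked cs p @ replicate (3 * R - length cs) (Lit 0))))"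

text \<open>Vertices of \<open>bs\<close> that occur in \<open>as\<close> are replaced by 0 instead
  of being removed, so that the length is known in advance and nonzero entries stay
  distinct.\<close>

definition merged :: "exp list \<Rightarrow> exp list \<Rightarrow> exp list" where
  "merged as bs = as @ map (\<lambda>b. Bin Times b (isz (emem b as))) bs"

text \<open>The trace of the third edge is the constant pattern \<open>p\<close>, so only the first
  two edges are inspected at run time. \<open>nz c\<close> discards the padding vertex.\<close>

definition eregion :: "exp list \<Rightarrow> exp list \<Rightarrow> bool list \<Rightarrow> nat set \<Rightarrow> exp" where
  "eregion as bs p J = esum (map (\<lambda>(c, b). eprod
     [nz c, eiff (1 \<in> J) (emem c as), eiff (2 \<in> J) (emem c bs), eiff (3 \<in> J) (Lit (of_bool b))])
     (zip (merged as bs) p))"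

text \<open>The region of the third edge alone is not visible on the vertices of the first two edges;
  whether it is empty is decided by \<open>ecover\<close>.\<close>

definition inner_regions :: "nat set list" where
  "inner_regions = [{1}, {2}, {1, 2}, {1, 3}, {2, 3}, {1, 2, 3}]"

definition econd :: "venn \<Rightarrow> exp list \<Rightarrow> exp list \<Rightarrow> bool list \<Rightarrow> exp" where
  "econd V as bs p = eprod (map (\<lambda>J. eiff (V J) (eregion as bs p J)) inner_regions)"

text \<open>A third edge has a private vertex iff it is not covered by the first two. So
  \<open>V {3}\<close> decides between the uncovered edges with trace \<open>p\<close>, obtained as
  a difference, and the covered ones.\<close>

definition epair :: "nat \<Rightarrow> venn \<Rightarrow> exp list \<Rightarrow> exp list \<Rightarrow> exp" where
  "epair R V as bs = (let cs = merged as bs in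
     esum (map (\<lambda>p. Bin Times (econd V as bs p)
       (if V {3} then Bin Minus (ecount (zip cs p) (replicate R (Lit 0))) (ecover R cs p)
        else ecover R cs p))
       (patterns (2 * R))))"

text \<open>Slot \<open>R\<close> is not stored; it stands for the padding vertex 0, which every
  selection may therefore choose.\<close>

definition eslot :: "nat \<Rightarrow> name \<Rightarrow> nat \<Rightarrow> exp" where
  "eslot R x s =
     (if s < R then At Slot (Bin Plus (Bin Times (Lit R) (scalar x)) (Lit s)) else Lit 0)"

definition eslots :: "nat \<Rightarrow> name \<Rightarrow> exp list" where
  "eslots R x = map (eslot R x) [0..<R]"

definition esub :: "nat \<Rightarrow> venn \<Rightarrow> exp" where
  "esub R V = esum (map (\<lambda>q. Bin Times (ecover R (eslots R Jx) q)
     (epair R V (masked (eslots R Jx) q) (eslots R Jx))) (patterns R))"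

section \<open>Values of the counting expressions over correct tables\<close>

lemma set_patterns: "set (patterns n) = {p. length p = n}"
  by (auto simp: patterns_def set_n_lists)

lemma distinct_patterns: "distinct (patterns n)"
  by (simp add: patterns_def distinct_n_lists)

lemma sum_card_fibres:
  assumes "finite X" "finite P" "f ` X \<subseteq> P"
  shows "(\<Sum>p\<in>P. card {x \<in> X. f x = p}) = card X"
  using sum.group[OF assms, of "\<lambda>_. 1 :: nat"] by (simp only: card_eq_sum)

text \<open>Zeros are padding and may repeat.\<close>

definition nz_distinct :: "nat list \<Rightarrow> bool" where
  "nz_distinct xs \<longleftrightarrow>
     (\<forall>j<length xs. \<forall>k<length xs. xs ! j = xs ! k \<longrightarrow> xs ! j \<noteq> 0 \<longrightarrow> j = k)"

lemma nz_distinct_merge: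
  assumes "nz_distinct xs" "nz_distinct ys"
  shows "nz_distinct (xs @ map (\<lambda>y. y * of_bool (y \<notin> set xs)) ys)"
  unfolding nz_distinct_def
proof (intro allI impI)
  fix j k
  let ?zs = "xs @ map (\<lambda>y. y * of_bool (y \<notin> set xs)) ys"
  assume jk: "j < length ?zs" "k < length ?zs" "?zs ! j = ?zs ! k" "?zs ! j \<noteq> 0"
  have in_ys: "?zs ! i = ys ! (i - length xs)" "?zs ! i \<notin> set xs"
    if "\<not> i < length xs" "i < length ?zs" "?zs ! i \<noteq> 0" for i
  proof -
    have "?zs ! i = ys ! (i - length xs) * of_bool (ys ! (i - length xs) \<notin> set xs)"
      using that(1,2) by (simp add: nth_append)
    with that(3) show "?zs ! i = ys ! (i - length xs)" "?zs ! i \<notin> set xs"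
      by (cases "ys ! (i - length xs) \<in> set xs"; simp)+
  qed
  consider "j < length xs" "k < length xs" | "\<not> j < length xs" "\<not> k < length xs"
    | "(j < length xs) \<noteq> (k < length xs)" by blast
  then show "j = k"
  proof cases
    case 1
    then show ?thesis using jk assms(1) by (auto simp: nth_append nz_distinct_def)
  next
    case 2
    then have "ys ! (j - length xs) = ys ! (k - length xs)" "ys ! (j - length xs) \<noteq> 0"
      using in_ys[of j] in_ys[of k] jk by auto
    moreover have "j - length xs < length ys" "k - length xs < length ys" using 2 jk by auto
    ultimately have "j - length xs = k - length xs" using assms(2) unfolding nz_distinct_def by blast
    with 2 show ?thesis by simp
  next
    case 3
    have "?zs ! i \<in> set xs" if "i < length xs" for i using that by (simp add: nth_append)
    with 3 jk in_ys[of j] in_ys[of k] show ?thesis by metis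
  qed
qed

text \<open>\<open>vec i s\<close> is slot \<open>s\<close> of edge \<open>i\<close>, with 0 for an
  empty slot. Slot \<open>R\<close> is always empty, so ranges over \<open>{..R}\<close> contain the
  padding vertex: \<open>S i\<close> is the padded edge and \<open>E i\<close> the edge
  itself.\<close>

locale slots =
  fixes R n B :: nat and vec :: "nat \<Rightarrow> nat \<Rightarrow> nat"
  assumes vec_less: "i < n \<Longrightarrow> vec i s < B"
    and vec_outside: "R \<le> s \<Longrightarrow> vec i s = 0"
    and vec_distinct: "i < n \<Longrightarrow> s < R \<Longrightarrow> t < R \<Longrightarrow> vec i s = vec i t \<Longrightarrow> vec i s \<noteq> 0 \<Longrightarrow> s = t"
    and vec_inj: "i < n \<Longrightarrow> j < n \<Longrightarrow> vec i ` {..R} = vec j ` {..R} \<Longrightarrow> i = j"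
    and B_pos: "0 < B"
begin

definition S :: "nat \<Rightarrow> nat set" where
  "S i = vec i ` {..R}"

definition E :: "nat \<Rightarrow> nat set" where
  "E i = S i - {0}"

lemma zero_in_S [simp]: "0 \<in> S i"
  unfolding S_def using vec_outside[of R i] by (metis atMost_iff image_eqI order_refl)

lemma S_inj: "i < n \<Longrightarrow> j < n \<Longrightarrow> S i = S j \<Longrightarrow> i = j"
  unfolding S_def by (rule vec_inj)

text \<open>The length \<open>3 * R\<close> leaves \<open>2 * R\<close> positions for the vertices
  of two edges and \<open>R\<close> more, enough to name all empty slots of an edge, as required by
  \<open>edge_word\<close>.\<close>

definition selections :: "nat list list" where
  "selections = List.n_lists (3 * R) [0..<Suc R]"

lemma set_selections: "set selections = {\<sigma>. length \<sigma> = 3 * R \<and> set \<sigma> \<subseteq> {..R}}"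
  by (auto simp: selections_def set_n_lists)

text \<open>A selection that names every slot yields a word with all vertices of the edge. The
  condition on \<open>\<sigma>\<close> does not involve the input, so it is decided when the program
  is generated.\<close>

definition edge_word :: "nat \<Rightarrow> nat list \<Rightarrow> bool" where
  "edge_word i w \<longleftrightarrow> (\<exists>\<sigma>\<in>set selections. {..<R} \<subseteq> set \<sigma> \<and> w = map (vec i) \<sigma>)"

definition words :: "nat list set" where
  "words = {w. length w = 3 * R \<and> set w \<subseteq> {..<B}}"

definition tables :: "mem \<Rightarrow> bool" where
  "tables m \<longleftrightarrow> m Base 0 = B \<and>
     (\<forall>w\<in>words. m Cnt (key B w) = card {i. i < n \<and> set w \<subseteq> S i} \<and>
        m IsEdge (key B w) = of_bool (\<exists>i<n. edge_word i w))"

definition slots_loaded :: "mem \<Rightarrow> bool" where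
  "slots_loaded m \<longleftrightarrow> (\<forall>i<n. \<forall>s<R. m Slot (R * i + s) = vec i s)"

definition count_from :: "venn \<Rightarrow> nat \<Rightarrow> nat \<Rightarrow> nat" where
  "count_from V i j = card {k. k < n \<and> fits V (triple (E i) (E j) (E k))}"

definition total :: "venn \<Rightarrow> nat" where
  "total V = (\<Sum>i<n. \<Sum>j<n. count_from V i j)"

text \<open>From right to left, each entry of \<open>ws\<close> is named by its slot and
  \<open>R\<close> of the zeros name the empty slots. By \<open>vec_distinct\<close> a vertex sits
  in only one slot, so no slot is missed.\<close>

lemma edge_word_iff:
  assumes i: "i < n" and w: "length (ws @ replicate k 0) = 3 * R" and k: "R \<le> k"
  shows "edge_word i (ws @ replicate k 0) \<longleftrightarrow> S i = insert 0 (set ws)"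
proof
  assume "edge_word i (ws @ replicate k 0)"
  then obtain \<sigma> where \<sigma>: "set \<sigma> \<subseteq> {..R}" "{..<R} \<subseteq> set \<sigma>" "ws @ replicate k 0 = map (vec i) \<sigma>"
    unfolding edge_word_def set_selections by blast
  then have "set ws \<union> set (replicate k 0) = vec i ` set \<sigma>" by (metis set_append set_map)
  then have eq: "insert 0 (set ws) = insert 0 (vec i ` set \<sigma>)" by (cases "k = 0") auto
  have "S i \<subseteq> insert 0 (vec i ` set \<sigma>)"
  proof
    fix v assume "v \<in> S i"
    then obtain s where "s \<le> R" "v = vec i s" by (auto simp: S_def)
    with \<sigma>(2) vec_outside[of s i] show "v \<in> insert 0 (vec i ` set \<sigma>)" by (cases "s < R") auto
  qed
  moreover have "insert 0 (vec i ` set \<sigma>) \<subseteq> S i"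
    using \<sigma>(1) zero_in_S[of i] unfolding S_def by blast
  ultimately show "S i = insert 0 (set ws)" using eq by simp
next
  assume eq: "S i = insert 0 (set ws)"
  define g where "g v = (if v = 0 then R else (SOME s. s < R \<and> vec i s = v))" for v
  have g: "g v \<le> R \<and> vec i (g v) = v" "v \<noteq> 0 \<Longrightarrow> g v < R" if v: "v \<in> S i" for v
  proof -
    have "g v < R \<and> vec i (g v) = v" if "v \<noteq> 0"
    proof -
      obtain s where "s \<le> R" "v = vec i s" using v by (auto simp: S_def)
      then have "s < R \<and> vec i s = v" using that vec_outside[of s i] by (cases "s < R") auto
      then have "(SOME s. s < R \<and> vec i s = v) < R \<and> vec i (SOME s. s < R \<and> vec i s = v) = v"
        by (rule someI)
      with that show ?thesis by (simp add: g_def)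
    qed
    then show "g v \<le> R \<and> vec i (g v) = v" "v \<noteq> 0 \<Longrightarrow> g v < R"
      using vec_outside[of R i] by (cases "v = 0"; simp add: g_def)+
  qed
  \<comment> \<open>Names slot \<open>s\<close> if it is empty and falls back to the always empty
    slot \<open>R\<close> otherwise; the value is 0 in both cases.\<close>
  define h where "h s = (if vec i s = 0 then s else R)" for s
  define \<sigma> where "\<sigma> = map g ws @ map h [0..<R] @ replicate (k - R) R"
  have h: "h s \<le> R" "vec i (h s) = 0" if "s < R" for s
    using that vec_outside[of R i] by (auto simp: h_def)
  have "map (vec i) \<sigma> = ws @ replicate k 0"
  proof -
    have "map (vec i) (map g ws) = ws" using eq g by (auto intro!: map_idI)
    moreover have "map (vec i) (map h [0..<R]) = replicate R 0"
      using h by (intro replicate_eqI) auto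
    moreover have "replicate R 0 @ replicate (k - R) 0 = replicate k (0::nat)"
      using k by (simp flip: replicate_add)
    ultimately show ?thesis using vec_outside[of R i] by (simp add: \<sigma>_def)
  qed
  moreover have "length \<sigma> = 3 * R" using w k by (simp add: \<sigma>_def)
  moreover have "set \<sigma> \<subseteq> {..R}" using eq g h by (auto simp: \<sigma>_def)
  moreover have "{..<R} \<subseteq> set \<sigma>"
  proof
    fix s assume "s \<in> {..<R}"
    then have s: "s < R" by simp
    show "s \<in> set \<sigma>"
    proof (cases "vec i s = 0")
      case True
      then have "s = h s" by (simp add: h_def)
      with s show ?thesis unfolding \<sigma>_def by auto
    next
      case False
      have "vec i s \<in> S i" using s by (auto simp: S_def)
      with False eq have "vec i s \<in> set ws" by auto
      moreover have "g (vec i s) = s"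
        using g[OF \<open>vec i s \<in> S i\<close>] False s vec_distinct[OF i] by metis
      ultimately show ?thesis unfolding \<sigma>_def by (metis UnCI image_eqI set_append set_map)
    qed
  qed
  ultimately show "edge_word i (ws @ replicate k 0)"
    unfolding edge_word_def set_selections by (intro bexI[of _ \<sigma>]) auto
qed

text \<open>The trace of edge \<open>i\<close>. Since \<open>0 \<in> S i\<close>, zeros always give
  \<open>True\<close>, and a pattern with \<open>False\<close> at a zero belongs to no edge.\<close>

definition pattern :: "nat list \<Rightarrow> nat \<Rightarrow> bool list" where
  "pattern cv i = map (\<lambda>c. c \<in> S i) cv"

context
  fixes m :: mem
  assumes m: "tables m"
begin

abbreviation val :: "exp \<Rightarrow> nat" where
  "val e \<equiv> eval e m"

text \<open>Each step moves one entry from \<open>r\<close> to \<open>w\<close>, a 0 where the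
  condition is dropped, so the final key has length \<open>3 * R\<close>. Truncation is harmless,
  since the subtrahend counts a subset.\<close>

lemma eval_ecount:
  assumes "length r + length w = 3 * R" "\<forall>e\<in>fst ` set r \<union> set w. val e < B"
  shows "val (ecount r w) =
    card {i. i < n \<and> val ` set w \<subseteq> S i \<and> (\<forall>(u, b)\<in>set r. (val u \<in> S i) = b)}"
  using assms
proof (induction r w rule: ecount.induct)
  case (1 w)
  then have "map val w \<in> words" by (auto simp: words_def)
  with m show ?case by (simp add: tables_def)
next
  case (2 u b r w)
  show ?case
  proof (cases b)
    case True
    with 2 show ?thesis by (auto intro!: arg_cong[of _ _ card])
  next
    case False
    let ?A = "{i. i < n \<and> val ` set w \<subseteq> S i \<and> (\<forall>(u, b)\<in>set r. (val u \<in> S i) = b)}"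
    have "val (ecount r (Lit 0 # w)) = card ?A"
      using 2 False B_pos by (auto intro!: arg_cong[of _ _ card])
    moreover have "val (ecount r (u # w)) = card {i \<in> ?A. val u \<in> S i}"
      using 2 False by (auto intro!: arg_cong[of _ _ card])
    moreover have "card ?A - card {i \<in> ?A. val u \<in> S i} = card (?A - {i \<in> ?A. val u \<in> S i})"
      by (intro card_Diff_subset[symmetric]) auto
    moreover have "?A - {i \<in> ?A. val u \<in> S i} =
        {i. i < n \<and> val ` set w \<subseteq> S i \<and> (\<forall>(u, b)\<in>set ((u, b) # r). (val u \<in> S i) = b)}"
      using False by auto
    ultimately show ?thesis using False by simp
  qed
qed

lemma eval_ecount_pattern:
  assumes "length cs = 2 * R" "length p = 2 * R" "\<forall>c\<in>set cs. val c < B"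
  shows "val (ecount (zip cs p) (replicate R (Lit 0))) = card {i. i < n \<and> pattern (map val cs) i = p}"
proof -
  have "(\<forall>(u, b)\<in>set (zip cs p). (val u \<in> S i) = b) \<longleftrightarrow> pattern (map val cs) i = p" for i
    using assms(1,2) by (auto simp: pattern_def set_zip list_eq_iff_nth_eq)
  moreover have "val ` set (replicate R (Lit 0)) \<subseteq> S i" for i
    by auto
  moreover have "\<forall>e\<in>fst ` set (zip cs p) \<union> set (replicate R (Lit 0)). val e < B"
    using assms(3) B_pos by (auto dest: set_zip_leftD)
  ultimately show ?thesis using assms by (subst eval_ecount) simp_all
qed

lemma set_masked:
  "length p = length cs \<Longrightarrow>
   insert 0 (val ` set (masked cs p)) = insert 0 {val (cs ! j) | j. j < length cs \<and> p ! j}"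
  by (auto simp: masked_def set_zip image_iff) (metis (full_types))

text \<open>A covered edge is determined by its trace, and edges are distinct, so the number is 0 or
  1. The second part identifies the edge, which \<open>eval_esub\<close> needs.\<close>

lemma eval_ecover:
  assumes len: "length cs \<le> 2 * R" "length p = length cs"
    and cs: "\<forall>c\<in>set cs. val c < B" "nz_distinct (map val cs)"
  shows "val (ecover R cs p) = card {i. i < n \<and> pattern (map val cs) i = p \<and>
     S i \<subseteq> insert 0 (val ` set cs)}" (is "_ = card ?X")
    and "i < n \<Longrightarrow> pattern (map val cs) i = p \<Longrightarrow> S i \<subseteq> insert 0 (val ` set cs) \<Longrightarrow>
      S i = insert 0 (val ` set (masked cs p))"
proof -
  let ?M = "insert 0 (val ` set (masked cs p))"
  have pat: "pattern (map val cs) i = p \<longleftrightarrow> (\<forall>j<length cs. val (cs ! j) \<in> S i \<longleftrightarrow> p ! j)" for i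
    using len(2) by (auto simp: pattern_def list_eq_iff_nth_eq)
  note M = set_masked[OF len(2)]
  show XM: "S i = ?M" if "i < n" "pattern (map val cs) i = p" "S i \<subseteq> insert 0 (val ` set cs)" for i
  proof
    show "S i \<subseteq> ?M"
    proof
      fix v assume v: "v \<in> S i"
      show "v \<in> ?M"
      proof (cases "v = 0")
        case False
        with v that(3) obtain j where "j < length cs" "v = val (cs ! j)"
          by (metis imageE in_set_conv_nth insert_iff subsetD)
        with v that(2) show ?thesis unfolding M pat by blast
      qed simp
    qed
    show "?M \<subseteq> S i" using that(2) unfolding M pat by auto
  qed
  have edge: "m IsEdge (key B (map val (masked cs p @ replicate (3 * R - length cs) (Lit 0)))) =
      card {i. i < n \<and> S i = ?M}"
  proof -
    let ?ws = "map val (masked cs p)" and ?k = "3 * R - length cs"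
    have l: "length (?ws @ replicate ?k 0) = 3 * R" using len by (simp add: masked_def)
    have "?ws @ replicate ?k 0 \<in> words"
      using cs(1) B_pos l
      by (auto simp: words_def masked_def dest!: set_zip_leftD split: if_splits)
    then have "m IsEdge (key B (?ws @ replicate ?k 0)) =
        of_bool (\<exists>i<n. edge_word i (?ws @ replicate ?k 0))"
      using m unfolding tables_def by blast
    also have "(\<exists>i<n. edge_word i (?ws @ replicate ?k 0)) \<longleftrightarrow> (\<exists>i<n. S i = ?M)"
      using edge_word_iff[OF _ l] len(1) by auto
    also have "of_bool (\<exists>i<n. S i = ?M) = card {i. i < n \<and> S i = ?M}"
    proof (cases "\<exists>i<n. S i = ?M")
      case True
      then obtain i where "i < n" "S i = ?M" by blast
      then have "{i. i < n \<and> S i = ?M} = {i}" using S_inj by auto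
      with True show ?thesis by simp
    next
      case False
      then have "{i. i < n \<and> S i = ?M} = {}" by blast
      with False show ?thesis by (simp only: card.empty of_bool_eq)
    qed
    finally show ?thesis by simp
  qed
  \<comment> \<open>If this fails, a zero is unmasked and both sides vanish. If it holds, an
    unmasked entry is nonzero, hence occurs only once and is not in the masked set.\<close>
  define exact where "exact \<longleftrightarrow> (\<forall>j<length cs. \<not> p ! j \<longrightarrow> val (cs ! j) \<noteq> 0)"
  have "val (eprod (map (\<lambda>(c, b). if b then Lit 1 else nz c) (zip cs p))) =
      (\<Prod>(c, b)\<leftarrow>zip cs p. of_bool (b \<or> val c \<noteq> 0))"
    by (auto intro!: arg_cong[of _ _ prod_list])
  also have "\<dots> = of_bool (\<forall>(c, b)\<in>set (zip cs p). b \<or> val c \<noteq> 0)"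
    using prod_list_of_bool[of "\<lambda>(c, b). b \<or> val c \<noteq> 0" "zip cs p"] by (simp add: case_prod_unfold)
  also have "(\<forall>(c, b)\<in>set (zip cs p). b \<or> val c \<noteq> 0) = exact"
    using len(2) by (auto simp: exact_def set_zip)
  finally have ex: "val (eprod (map (\<lambda>(c, b). if b then Lit 1 else nz c) (zip cs p))) = of_bool exact" .
  have "of_bool exact * card {i. i < n \<and> S i = ?M} = card ?X"
  proof (cases exact)
    case True
    have "pattern (map val cs) i = p \<and> S i \<subseteq> insert 0 (val ` set cs)" if "S i = ?M" for i
    proof
      show "pattern (map val cs) i = p" unfolding pat that M
      proof (intro allI impI iffI)
        fix j assume j: "j < length cs"
          "val (cs ! j) \<in> insert 0 {val (cs ! j) |j. j < length cs \<and> p ! j}"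
        show "p ! j"
        proof (rule ccontr)
          assume np: "\<not> p ! j"
          with True j have "val (cs ! j) \<noteq> 0" by (simp add: exact_def)
          moreover from this j obtain k where "k < length cs" "p ! k" "val (cs ! j) = val (cs ! k)"
            by auto
          ultimately have "j = k" using cs(2) j by (auto simp: nz_distinct_def)
          with np \<open>p ! k\<close> show False by simp
        qed
      qed auto
      show "S i \<subseteq> insert 0 (val ` set cs)" unfolding that M by auto
    qed
    then have "i < n \<and> pattern (map val cs) i = p \<and> S i \<subseteq> insert 0 (val ` set cs) \<longleftrightarrow>
        i < n \<and> S i = ?M" for i
      using XM[of i] by (metis (no_types))
    with True show ?thesis by simp
  next
    case False
    then obtain j where "j < length cs" "\<not> p ! j" "val (cs ! j) = 0" by (auto simp: exact_def)
    then have "pattern (map val cs) i \<noteq> p" for i unfolding pat by (metis zero_in_S)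
    with False show ?thesis by simp
  qed
  with ex edge m show "val (ecover R cs p) = card ?X"
    by (simp add: ecover_def tables_def del: eval_eprod)
qed

definition edge_of :: "exp list \<Rightarrow> nat set" where
  "edge_of es = val ` set es - {0}"

lemma map_merged:
  "map val (merged as bs) =
     map val as @ map (\<lambda>y. y * of_bool (y \<notin> set (map val as))) (map val bs)"
  by (simp add: merged_def)

lemma set_merged:
  "insert 0 (val ` set (merged as bs)) = insert 0 (val ` set as \<union> val ` set bs)"
proof -
  have gen: "insert 0 (A \<union> (\<lambda>y. y * of_bool (y \<notin> A)) ` C) = insert 0 (A \<union> C)" for A C :: "nat set"
  proof -
    have abs: "insert 0 (A \<union> D) = insert 0 (A \<union> C)"
      if "D \<subseteq> insert 0 C" "\<And>x. x \<in> C \<Longrightarrow> x \<in> A \<union> D" for D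
      using that by blast
    have "(\<lambda>y. y * of_bool (y \<notin> A)) ` C \<subseteq> insert 0 C" by auto
    moreover have "x \<in> A \<union> (\<lambda>y. y * of_bool (y \<notin> A)) ` C" if "x \<in> C" for x
      using that by (cases "x \<in> A") (auto intro: rev_image_eqI)
    ultimately show ?thesis by (rule abs)
  qed
  have "val ` set (merged as bs) = set (map val (merged as bs))" by simp
  also have "\<dots> = val ` set as \<union> (\<lambda>y. y * of_bool (y \<notin> val ` set as)) ` (val ` set bs)"
    unfolding map_merged by (simp only: set_append set_map)
  finally show ?thesis using gen by simp
qed

lemma eval_econd:
  assumes len: "length as = R" "length bs = R"
  shows "val (econd V as bs (pattern (map val (merged as bs)) i)) =
    of_bool (\<forall>J\<in>set inner_regions.
      V J = region (triple (edge_of as) (edge_of bs) (E i)) J)"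
proof -
  let ?cs = "merged as bs" and ?e = "triple (edge_of as) (edge_of bs) (E i)"
  let ?p = "pattern (map val ?cs) i"
  have reg: "val (eregion as bs ?p J) \<noteq> 0 \<longleftrightarrow> region ?e J" if "J \<in> set inner_regions" for J
  proof -
    have "val (eregion as bs ?p J) \<noteq> 0 \<longleftrightarrow> (\<exists>c\<in>set ?cs. val c \<noteq> 0 \<and>
       (1 \<in> J \<longleftrightarrow> val c \<in> val ` set as) \<and> (2 \<in> J \<longleftrightarrow> val c \<in> val ` set bs) \<and> (3 \<in> J \<longleftrightarrow> val c \<in> S i))"
      by (auto simp: eregion_def pattern_def zip_map2 zip_same_conv_map sum_list_eq_0_iff
          Let_def prod_list_zero_iff)
    also have "\<dots> \<longleftrightarrow> (\<exists>v\<in>insert 0 (val ` set ?cs). v \<noteq> 0 \<and>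
       (1 \<in> J \<longleftrightarrow> v \<in> val ` set as) \<and> (2 \<in> J \<longleftrightarrow> v \<in> val ` set bs) \<and> (3 \<in> J \<longleftrightarrow> v \<in> S i))"
      by auto
    \<comment> \<open>Each inner region contains 1 or 2, so all its vertices occur in the merged
      list.\<close>
    also have "\<dots> \<longleftrightarrow> (\<exists>v. v \<noteq> 0 \<and> 
       (1 \<in> J \<longleftrightarrow> v \<in> val ` set as) \<and> (2 \<in> J \<longleftrightarrow> v \<in> val ` set bs) \<and> (3 \<in> J \<longleftrightarrow> v \<in> S i))"
      using that unfolding set_merged inner_regions_def by auto
    also have "\<dots> \<longleftrightarrow> region ?e J"
    proof -
      have "J \<subseteq> three" "J \<noteq> {}" using that by (auto simp: inner_regions_def three_def)
      then have "(v \<noteq> 0 \<and> (1 \<in> J \<longleftrightarrow> v \<in> val ` set as) \<and> (2 \<in> J \<longleftrightarrow> v \<in> val ` set bs) \<and>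
          (3 \<in> J \<longleftrightarrow> v \<in> S i)) \<longleftrightarrow> (\<forall>k\<in>three. v \<in> ?e k \<longleftrightarrow> k \<in> J)" for v
        by (auto simp: edge_of_def E_def three_def)
      then show ?thesis unfolding region_def by simp
    qed
    finally show ?thesis .
  qed
  show ?thesis
    using reg prod_list_of_bool[of "\<lambda>J. V J = (val (eregion as bs ?p J) \<noteq> 0)" inner_regions]
    by (simp add: econd_def comp_def cong: map_cong)
qed

lemma fits_iff_regions:
  "fits V e \<longleftrightarrow> (\<forall>J\<in>set inner_regions. V J = region e J) \<and> V {3} = region e {3}"
proof -
  have regions: "J \<noteq> {} \<and> J \<subseteq> three \<longleftrightarrow> J \<in> set inner_regions \<or> J = {3}" for J
  proof
    assume J: "J \<noteq> {} \<and> J \<subseteq> three"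
    then have "J \<in> Pow {1, 2, 3}" by (simp add: three_def)
    with J show "J \<in> set inner_regions \<or> J = {3}"
      unfolding Pow_insert Pow_empty inner_regions_def by auto
  qed (auto simp: inner_regions_def three_def)
  show ?thesis unfolding fits_def regions by auto
qed

text \<open>Third edges are grouped by trace. The inner regions depend on the trace alone, so
  \<open>econd\<close> is constant on a group; only the region \<open>{3}\<close> tells its members
  apart, and it is empty exactly for covered edges.\<close>

lemma eval_epair:
  assumes len: "length as = R" "length bs = R"
    and less: "\<forall>e\<in>set as \<union> set bs. val e < B"
    and dist: "nz_distinct (map val as)" "nz_distinct (map val bs)"
  shows "val (epair R V as bs) =
    card {i. i < n \<and> fits V (triple (edge_of as) (edge_of bs) (E i))}"
proof -
  let ?cs = "merged as bs"
  let ?f = "\<lambda>i. triple (edge_of as) (edge_of bs) (E i)"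
  let ?pat = "\<lambda>i. pattern (map val ?cs) i"
  let ?in = "\<lambda>i. S i \<subseteq> insert 0 (val ` set ?cs)"
  define c where "c i \<longleftrightarrow> (\<forall>J\<in>set inner_regions. V J = region (?f i) J)" for i
  have ec: "val (econd V as bs (?pat i)) = of_bool (c i)" for i
    unfolding c_def by (rule eval_econd[OF len])
  have fits_c: "fits V (?f i) \<longleftrightarrow> c i \<and> V {3} = region (?f i) {3}" for i
    unfolding c_def by (rule fits_iff_regions)
  have lcs: "length ?cs = 2 * R" using len by (simp add: merged_def)
  have lt: "\<forall>c\<in>set ?cs. val c < B" using less B_pos by (auto simp: merged_def)
  have nzd: "nz_distinct (map val ?cs)"
    unfolding map_merged by (rule nz_distinct_merge[OF dist])
  have r3: "region (?f i) {3} \<longleftrightarrow> \<not> ?in i" for i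
    unfolding set_merged by (auto simp: region_def three_def edge_of_def E_def)
  have summand: "val (Bin Times (econd V as bs p)
       (if V {3} then Bin Minus (ecount (zip ?cs p) (replicate R (Lit 0))) (ecover R ?cs p)
        else ecover R ?cs p)) = card {i \<in> {i. i < n \<and> fits V (?f i)}. ?pat i = p}"
    (is "val (Bin Times _ ?e) = _")
    if p: "p \<in> set (patterns (2 * R))" for p
  proof -
    have lp: "length p = 2 * R" using p by (simp add: set_patterns)
    let ?P = "{i. i < n \<and> ?pat i = p}" and ?Q = "{i. i < n \<and> ?pat i = p \<and> ?in i}"
    have cov: "val (ecover R ?cs p) = card ?Q"
      using eval_ecover(1)[of ?cs p] lcs lp lt nzd by simp
    have cnt: "val (ecount (zip ?cs p) (replicate R (Lit 0))) = card ?P"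
      using eval_ecount_pattern[OF lcs lp lt] .
    have e: "val ?e = card {i. i < n \<and> ?pat i = p \<and> V {3} = region (?f i) {3}}"
    proof (cases "V {3}")
      case True
      have "card (?P - ?Q) = card ?P - card ?Q" by (intro card_Diff_subset) auto
      moreover have "?P - ?Q = {i. i < n \<and> ?pat i = p \<and> V {3} = region (?f i) {3}}"
        unfolding r3 using True by auto
      ultimately show ?thesis using True cov cnt by simp
    qed (simp add: cov r3)
    show ?thesis
    \<comment> \<open>\<open>eval_econd\<close> speaks only of traces of actual edges. For any other
      pattern the count is 0, whatever \<open>econd\<close> yields.\<close>
    proof (cases "\<exists>i<n. ?pat i = p")
      case True
      then obtain i where i: "i < n" "?pat i = p" by blast
      then have econd: "val (econd V as bs p) = of_bool (c i)" using ec[of i] by simp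
      have "c j \<longleftrightarrow> c i" if "?pat j = p" for j
      proof -
        have "of_bool (c j) = (of_bool (c i) :: nat)" using ec[of j] econd that by simp
        then show ?thesis by (simp only: of_bool_eq_iff)
      qed
      then have "{j \<in> {j. j < n \<and> fits V (?f j)}. ?pat j = p} =
          (if c i then {j. j < n \<and> ?pat j = p \<and> V {3} = region (?f j) {3}} else {})"
        unfolding fits_c by auto
      then show ?thesis unfolding eval.simps apply_op.simps e econd by simp
    next
      case False
      then have empty: "{i. i < n \<and> ?pat i = p \<and> V {3} = region (?f i) {3}} = {}"
        "{i \<in> {i. i < n \<and> fits V (?f i)}. ?pat i = p} = {}" by blast+
      show ?thesis unfolding eval.simps apply_op.simps e empty by simp
    qed
  qed
  have "val (epair R V as bs) =
     (\<Sum>p\<in>set (patterns (2 * R)). card {i \<in> {i. i < n \<and> fits V (?f i)}. ?pat i = p})"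
    using summand
    by (simp add: epair_def Let_def comp_def sum_list_distinct_conv_sum_set distinct_patterns
        del: eval.simps cong: sum.cong)
  also have "\<dots> = card {i. i < n \<and> fits V (?f i)}"
  proof (rule sum_card_fibres)
    show "?pat ` {i. i < n \<and> fits V (?f i)} \<subseteq> set (patterns (2 * R))"
      using lcs by (auto simp: set_patterns pattern_def)
  qed (simp, rule finite_set)
  finally show ?thesis .
qed

context
  assumes loaded: "slots_loaded m"
begin

lemma map_eslots:
  "m x 0 = i \<Longrightarrow> i < n \<Longrightarrow> map val (eslots R x) = map (vec i) [0..<R]"
  using loaded by (auto simp: eslots_def slots_loaded_def eslot_def)

lemma eslots_props:
  assumes "m x 0 = i" "i < n"
  shows "length (eslots R x) = R" "\<forall>e\<in>set (eslots R x). val e < B"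
    "nz_distinct (map val (eslots R x))" "insert 0 (val ` set (eslots R x)) = S i"
    "edge_of (eslots R x) = E i"
proof -
  show "length (eslots R x) = R" by (simp add: eslots_def)
  have "val ` set (eslots R x) = set (map val (eslots R x))" by simp
  then have img: "val ` set (eslots R x) = vec i ` {..<R}"
    unfolding map_eslots[OF assms] by (auto simp: lessThan_atLeast0)
  have "e \<in> set (eslots R x) \<Longrightarrow> val e \<in> vec i ` {..<R}" for e
    unfolding img[symmetric] by simp
  then show "\<forall>e\<in>set (eslots R x). val e < B"
    using vec_less[OF assms(2)] by fastforce
  show "nz_distinct (map val (eslots R x))"
    unfolding map_eslots[OF assms] nz_distinct_def
    using vec_distinct[OF assms(2)] by simp
  have "insert 0 (vec i ` {..<R}) = S i"
    unfolding S_def lessThan_Suc_atMost[symmetric] lessThan_Suc using vec_outside[of R i] by simp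
  then show S: "insert 0 (val ` set (eslots R x)) = S i" unfolding img .
  show "edge_of (eslots R x) = E i"
    unfolding edge_of_def E_def S[symmetric] by blast
qed

lemma eval_epair_slots:
  assumes "m Ix 0 = i" "i < n" "m Jx 0 = j" "j < n"
  shows "val (epair R V (eslots R Ix) (eslots R Jx)) =
    card {k. k < n \<and> fits V (triple (E i) (E j) (E k))}"
  using eval_epair[of "eslots R Ix" "eslots R Jx" V]
    eslots_props[OF assms(1,2)] eslots_props[OF assms(3,4)] by auto

lemma nz_distinct_masked:
  assumes "nz_distinct (map val cs)" "length q = length cs"
  shows "nz_distinct (map val (masked cs q))"
  unfolding nz_distinct_def
proof (intro allI impI)
  fix j k
  assume jk: "j < length (map val (masked cs q))" "k < length (map val (masked cs q))"
    "map val (masked cs q) ! j = map val (masked cs q) ! k" "map val (masked cs q) ! j \<noteq> 0"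
  have "map val (masked cs q) ! i = (if q ! i then val (cs ! i) else 0)" if "i < length cs" for i
    using that assms(2) by (simp add: masked_def)
  then show "j = k"
    using jk assms unfolding nz_distinct_def
    by (auto simp: masked_def split: if_splits)
qed

text \<open>By \<open>sub\<close> only edges \<open>i\<close> inside edge \<open>j\<close>
  contribute. Grouped by their trace on edge \<open>j\<close> there is at most one per pattern, and
  its vertices are the masked slots.\<close>

lemma eval_esub:
  assumes j: "m Jx 0 = j" "j < n"
    and sub: "\<And>f :: nat \<Rightarrow> nat set. fits V f \<Longrightarrow> f 1 \<subseteq> f 2"
  shows "val (esub R V) = (\<Sum>i<n. card {k. k < n \<and> fits V (triple (E i) (E j) (E k))})"
proof -
  let ?cs = "eslots R Jx"
  let ?N = "\<lambda>i. card {k. k < n \<and> fits V (triple (E i) (E j) (E k))}"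
  let ?pat = "pattern (map val ?cs)"
  let ?X = "{i. i < n \<and> S i \<subseteq> S j}"
  note cs = eslots_props[OF j]
  have summand: "val (Bin Times (ecover R ?cs q) (epair R V (masked ?cs q) ?cs)) =
     (\<Sum>i\<in>{i \<in> ?X. ?pat i = q}. ?N i)" if q: "q \<in> set (patterns R)" for q
  proof -
    have lq: "length q = length ?cs" using q cs(1) by (simp add: set_patterns)
    have cov: "val (ecover R ?cs q) = card {i \<in> ?X. ?pat i = q}"
    proof -
      have "val (ecover R ?cs q) = card {i. i < n \<and> ?pat i = q \<and> S i \<subseteq> S j}"
        using eval_ecover(1)[OF _ lq cs(2,3)] unfolding cs(1,4) by simp
      then show ?thesis by (simp add: conj_commute conj_left_commute)
    qed
    have "?N i = val (epair R V (masked ?cs q) ?cs)" if i: "i \<in> ?X" "?pat i = q" for i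
    proof -
      have "S i = insert 0 (val ` set (masked ?cs q))"
        using eval_ecover(2)[OF _ lq cs(2,3), of i] i unfolding cs(1,4) by simp
      then have "edge_of (masked ?cs q) = E i" by (simp add: edge_of_def E_def)
      moreover have "\<forall>e\<in>set (masked ?cs q) \<union> set ?cs. val e < B"
        using cs(2) B_pos by (auto simp: masked_def dest!: set_zip_leftD)
      moreover have "length (masked ?cs q) = R" using lq cs(1) by (simp add: masked_def)
      ultimately show ?thesis
        using eval_epair[of "masked ?cs q" ?cs V] nz_distinct_masked[OF cs(3) lq] cs by simp
    qed
    then show ?thesis using cov by simp
  qed
  have "val (esub R V) = (\<Sum>q\<in>set (patterns R). \<Sum>i\<in>{i \<in> ?X. ?pat i = q}. ?N i)"
    using summand
    by (simp add: esub_def comp_def sum_list_distinct_conv_sum_set distinct_patterns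
        del: eval.simps cong: sum.cong)
  also have "\<dots> = (\<Sum>i\<in>?X. ?N i)"
  proof (rule sum.group)
    show "?pat ` ?X \<subseteq> set (patterns R)"
      using cs(1) by (auto simp: set_patterns pattern_def)
  qed (simp, rule finite_set)
  also have "\<dots> = (\<Sum>i<n. ?N i)"
  proof (rule sum.mono_neutral_left)
    have "?N i = 0" if "\<not> S i \<subseteq> S j" for i
    proof -
      have "\<not> E i \<subseteq> E j" using that unfolding E_def by auto
      then have "\<not> fits V (triple (E i) (E j) (E k))" for k
        using sub[of "triple (E i) (E j) (E k)"] by auto
      then show ?thesis by simp
    qed
    then show "\<forall>i\<in>{..<n} - ?X. ?N i = 0" by blast
  qed auto
  finally show ?thesis .
qed

end

end

end

section \<open>Filling the tables and running over the edges\<close>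

definition bump :: "name \<Rightarrow> exp \<Rightarrow> com" where
  "bump x e = Put x (Lit 0) (Bin Plus (scalar x) e)"

text \<open>Different selections of slots may yield the same word. \<open>Stamp\<close> records the last edge that
  was counted for a word (off by one, as 0 means none).\<close>

definition enter_word :: "nat \<Rightarrow> nat list \<Rightarrow> com" where
  "enter_word R \<sigma> = (let k = ekey (map (eslot R Ix) \<sigma>); i = Bin Plus (scalar Ix) (Lit 1) in
     Seq (Put Cnt k (Bin Plus (At Cnt k) (isz (eeq (At Stamp k) i))))
    (Seq (Put Stamp k i)
         (if {..<R} \<subseteq> set \<sigma> then Put IsEdge k (Lit 1) else Skip)))"

definition index_edges :: "nat \<Rightarrow> com" where
  "index_edges R = Seq (Put Ix (Lit 0) (Lit 0)) (For Ix (scalar NumE)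
     (seqs (map (enter_word R) (List.n_lists (3 * R) [0..<Suc R]))))"

definition count_all :: "nat \<Rightarrow> venn \<Rightarrow> com" where
  "count_all R V = Seq (Put Ix (Lit 0) (Lit 0)) (For Ix (scalar NumE)
     (Seq (Put Jx (Lit 0) (Lit 0)) (For Jx (scalar NumE)
       (bump Out (epair R V (eslots R Ix) (eslots R Jx))))))"

definition count_nested :: "nat \<Rightarrow> venn \<Rightarrow> com" where
  "count_nested R V = Seq (Put Jx (Lit 0) (Lit 0)) (For Jx (scalar NumE) (bump Out (esub R V)))"

lemma wcom_For: "wcom (For i e c) = wcom (For i e Skip) + wcom c"
  by (simp add: For_def)

lemma hoare_For_const:
  assumes "\<And>k m x. k \<le> n \<Longrightarrow> I k m x \<Longrightarrow> m i 0 = k \<and> eval e m = n \<and> bounded b m"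
    and "\<And>k. k < n \<Longrightarrow>
      hoare (I k) c T (\<lambda>m x. m i 0 = k \<and> bounded b m \<and> I (Suc k) (upd m i 0 (Suc k)) x)"
  shows "hoare (I 0) (For i e c) ((n + 1) * (wcom (For i e Skip) * b + T)) (I n)"
  using hoare_For[of n I i e b c "\<lambda>_. T", OF assms]
  by (rule hoare_conseq) (auto simp: algebra_simps)

definition small :: "nat \<Rightarrow> mem \<Rightarrow> bool" where
  "small M m \<longleftrightarrow> (\<forall>a i. m a i \<le> M)"

lemma small_bounded: "small M m \<Longrightarrow> bounded (bits M) m"
  unfolding small_def bounded_def using bits_mono by blast

lemma small_upd: "small M m \<Longrightarrow> v \<le> M \<Longrightarrow> small M (upd m a i v)"
  by (simp add: small_def)

section \<open>Building the tables\<close>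

context slots
begin

text \<open>Selections may reorder and repeat slots, so they produce every word over
  \<open>S i\<close>. Hence entering all selections counts edge \<open>i\<close> for exactly the
  words it contains.\<close>

lemma word_iff:
  assumes "w \<in> words"
  shows "w \<in> map (vec i) ` set selections \<longleftrightarrow> set w \<subseteq> S i"
proof
  assume "w \<in> map (vec i) ` set selections"
  then show "set w \<subseteq> S i" unfolding set_selections S_def by fastforce
next
  assume w: "set w \<subseteq> S i"
  define g where "g v = (SOME s. s \<le> R \<and> vec i s = v)" for v
  have g: "g v \<le> R \<and> vec i (g v) = v" if "v \<in> S i" for v
  proof -
    from that have "\<exists>s. s \<le> R \<and> vec i s = v" by (auto simp: S_def)
    then show ?thesis unfolding g_def by (rule someI_ex)
  qed
  have "map (vec i) (map g w) = w" using w g by (auto intro!: map_idI)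
  moreover have "map g w \<in> set selections"
    using assms w g by (auto simp: set_selections words_def)
  ultimately show "w \<in> map (vec i) ` set selections" by (metis imageI)
qed

lemma selection_word: "i < n \<Longrightarrow> \<sigma> \<in> set selections \<Longrightarrow> map (vec i) \<sigma> \<in> words"
  using vec_less by (auto simp: set_selections words_def)

lemma eval_word:
  assumes "m Base 0 = B" "m Ix 0 = i" "i < n" "slots_loaded m" "\<sigma> \<in> set selections"
  shows "eval (ekey (map (eslot R Ix) \<sigma>)) m = key B (map (vec i) \<sigma>)"
proof -
  have "eval (eslot R Ix s) m = vec i s" if "s \<le> R" for s
    using assms that vec_outside[of s i] by (auto simp: eslot_def slots_loaded_def)
  then have "map (\<lambda>e. eval e m) (map (eslot R Ix) \<sigma>) = map (vec i) \<sigma>"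
    using assms(5) by (auto simp: set_selections)
  then show ?thesis unfolding eval_ekey assms(1) by (simp only:)
qed

lemma slots_loaded_cong: "(\<And>i. m Slot i = m' Slot i) \<Longrightarrow> slots_loaded m = slots_loaded m'"
  by (simp add: slots_loaded_def)

context
  fixes M b :: nat
begin

definition ready :: "mem \<Rightarrow> bool" where
  "ready m \<longleftrightarrow> m NumE 0 = n \<and> m Base 0 = B \<and> slots_loaded m \<and> small M m"

definition counting :: "mem \<Rightarrow> bool" where
  "counting m \<longleftrightarrow> ready m \<and> tables m"

text \<open>The tables have a cell for each of the \<open>B ^ (3 * R)\<close> words, too many to
  clear; the zeros come from the initial memory.\<close>

definition fresh :: "mem \<Rightarrow> bool" where
  "fresh m \<longleftrightarrow> ready m \<and> m Out 0 = 0 \<and> (\<forall>k. m Stamp k = 0 \<and> m Cnt k = 0 \<and> m IsEdge k = 0)"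

text \<open>Bounds for the stored values: \<open>B\<close> for \<open>Base\<close>,
  \<open>Suc n\<close> for loop counters, stamps and table counts, \<open>n * (n * n)\<close> for
  the number of ordered triples in \<open>Out\<close>. Keys may be larger, but occur only inside
  expressions.\<close>

context
  assumes M: "B \<le> M" "Suc n \<le> M" "n * (n * n) \<le> M" and b: "b = bits M"
begin

lemma bounded_b: "small M m \<Longrightarrow> bounded b m"
  unfolding b by (rule small_bounded)

lemma ready_upd:
  assumes "ready m" "v \<le> M" "a \<notin> {NumE, Base, Slot}"
  shows "ready (upd m a i v)"
  using assms slots_loaded_cong[of "upd m a i v" m] unfolding ready_def by (auto simp: small_upd)

text \<open>The state while edge \<open>i\<close> is being entered, with the selections in
  \<open>D\<close> done. The bound on stamps guarantees that no word looks already counted when edge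
  \<open>Suc i\<close> begins.\<close>

definition indexed :: "nat \<Rightarrow> nat list set \<Rightarrow> mem \<Rightarrow> bool" where
  "indexed i D m \<longleftrightarrow> (\<forall>w\<in>words.
     m Cnt (key B w) = card {i'. i' < i \<and> set w \<subseteq> S i'} + of_bool (w \<in> map (vec i) ` D) \<and>
     (m Stamp (key B w) = Suc i \<longleftrightarrow> w \<in> map (vec i) ` D) \<and>
     m Stamp (key B w) \<le> Suc i \<and>
     m IsEdge (key B w) = of_bool ((\<exists>i'<i. edge_word i' w) \<or>
       (\<exists>\<sigma>\<in>D. {..<R} \<subseteq> set \<sigma> \<and> w = map (vec i) \<sigma>)))"

definition index_inv :: "nat \<Rightarrow> nat list set \<Rightarrow> mem \<Rightarrow> nat list \<Rightarrow> bool" where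
  "index_inv i D m x \<longleftrightarrow> ready m \<and> m Ix 0 = i \<and> m Out 0 = 0 \<and> indexed i D m"

lemma indexed_cong:
  "(\<And>k. m Cnt k = m' Cnt k) \<Longrightarrow> (\<And>k. m Stamp k = m' Stamp k) \<Longrightarrow> (\<And>k. m IsEdge k = m' IsEdge k) \<Longrightarrow>
   indexed i D m = indexed i D m'"
  by (simp add: indexed_def)

lemma indexed_step:
  assumes ind: "indexed i D m" and i: "i < n" and \<sigma>: "\<sigma> \<in> set selections" "D \<subseteq> set selections"
    and k: "k = key B (map (vec i) \<sigma>)"
    and Cnt: "\<And>l. m' Cnt l = m Cnt l + of_bool (l = k \<and> m Stamp l \<noteq> Suc i)"
    and Stamp: "\<And>l. m' Stamp l = (if l = k then Suc i else m Stamp l)"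
    and IsEdge: "\<And>l. m' IsEdge l = (if l = k \<and> {..<R} \<subseteq> set \<sigma> then 1 else m IsEdge l)"
  shows "indexed i (insert \<sigma> D) m'"
  unfolding indexed_def
proof (intro ballI)
  fix w assume w: "w \<in> words"
  let ?w = "map (vec i) \<sigma>"
  have "?w \<in> words" using selection_word[OF i \<sigma>(1)] .
  then have kw: "key B w = k \<longleftrightarrow> w = ?w"
    using w key_inj[of w ?w B] by (auto simp: words_def k)
  note I = ind[unfolded indexed_def, rule_format, OF w]
  have IE: "m' IsEdge (key B w) = of_bool ((\<exists>i'<i. edge_word i' w) \<or>
       (\<exists>\<sigma>'\<in>insert \<sigma> D. {..<R} \<subseteq> set \<sigma>' \<and> w = map (vec i) \<sigma>'))"
  proof (cases "w = ?w \<and> {..<R} \<subseteq> set \<sigma>")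
    case True
    then show ?thesis unfolding IsEdge kw by simp
  next
    case False
    then have "m' IsEdge (key B w) = m IsEdge (key B w)" unfolding IsEdge kw by auto
    moreover from False have "(\<exists>\<sigma>'\<in>insert \<sigma> D. {..<R} \<subseteq> set \<sigma>' \<and> w = map (vec i) \<sigma>') \<longleftrightarrow>
       (\<exists>\<sigma>'\<in>D. {..<R} \<subseteq> set \<sigma>' \<and> w = map (vec i) \<sigma>')" by auto
    ultimately show ?thesis using I by simp
  qed
  show "m' Cnt (key B w) =
       card {i'. i' < i \<and> set w \<subseteq> S i'} + of_bool (w \<in> map (vec i) ` insert \<sigma> D) \<and>
     (m' Stamp (key B w) = Suc i) = (w \<in> map (vec i) ` insert \<sigma> D) \<and>
     m' Stamp (key B w) \<le> Suc i \<and>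
     m' IsEdge (key B w) = of_bool ((\<exists>i'<i. edge_word i' w) \<or>
       (\<exists>\<sigma>'\<in>insert \<sigma> D. {..<R} \<subseteq> set \<sigma>' \<and> w = map (vec i) \<sigma>'))"
  proof (intro conjI)
    show "m' Cnt (key B w) =
       card {i'. i' < i \<and> set w \<subseteq> S i'} + of_bool (w \<in> map (vec i) ` insert \<sigma> D)"
      unfolding Cnt kw image_insert insert_iff using I by (cases "w = ?w") simp_all
    show "(m' Stamp (key B w) = Suc i) = (w \<in> map (vec i) ` insert \<sigma> D)"
      unfolding Stamp kw image_insert insert_iff using I by (cases "w = ?w") simp_all
    show "m' Stamp (key B w) \<le> Suc i" unfolding Stamp using I by simp
  qed (rule IE)
qed

text \<open>Once all selections are done, \<open>word_iff\<close> turns having been entered into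
  \<open>set w \<subseteq> S i\<close>, and the old stamps are too small for the next edge.\<close>

lemma indexed_next:
  assumes "indexed i (set selections) m"
  shows "indexed (Suc i) {} m"
  unfolding indexed_def
proof (intro ballI)
  fix w assume w: "w \<in> words"
  note I = assms[unfolded indexed_def, rule_format, OF w]
  have "card {i'. i' < Suc i \<and> set w \<subseteq> S i'} =
      card {i'. i' < i \<and> set w \<subseteq> S i'} + of_bool (set w \<subseteq> S i)"
  proof -
    have "{i'. i' < Suc i \<and> set w \<subseteq> S i'} =
      (if set w \<subseteq> S i then insert i {i'. i' < i \<and> set w \<subseteq> S i'} else {i'. i' < i \<and> set w \<subseteq> S i'})"
      by (auto simp: less_Suc_eq)
    then show ?thesis by simp
  qed
  moreover have "(\<exists>i'<Suc i. edge_word i' w) \<longleftrightarrow> (\<exists>i'<i. edge_word i' w) \<or>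
       (\<exists>\<sigma>\<in>set selections. {..<R} \<subseteq> set \<sigma> \<and> w = map (vec i) \<sigma>)"
    unfolding Ex_less_Suc edge_word_def[of i] by auto
  ultimately show "m Cnt (key B w) =
       card {i'. i' < Suc i \<and> set w \<subseteq> S i'} + of_bool (w \<in> map (vec (Suc i)) ` {}) \<and>
     (m Stamp (key B w) = Suc (Suc i)) = (w \<in> map (vec (Suc i)) ` {}) \<and>
     m Stamp (key B w) \<le> Suc (Suc i) \<and>
     m IsEdge (key B w) = of_bool ((\<exists>i'<Suc i. edge_word i' w) \<or>
       (\<exists>\<sigma>\<in>{}. {..<R} \<subseteq> set \<sigma> \<and> w = map (vec (Suc i)) \<sigma>))"
    using I unfolding word_iff[OF w] by auto
qed

lemma Cnt_le:
  assumes "indexed i D m" "i < n" "w \<in> words" "m Stamp (key B w) \<noteq> Suc i"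
  shows "Suc (m Cnt (key B w)) \<le> M"
proof -
  have "m Cnt (key B w) = card {i'. i' < i \<and> set w \<subseteq> S i'}"
    using assms unfolding indexed_def by auto
  also have "\<dots> \<le> card {..<i}" by (intro card_mono) auto
  finally show ?thesis using assms(2) M(2) by simp
qed

lemma hoare_enter_word:
  assumes i: "i < n" and \<sigma>: "\<sigma> \<in> set selections" "D \<subseteq> set selections"
  shows "hoare (index_inv i D) (enter_word R \<sigma>) (wcom (enter_word R \<sigma>) * b) (index_inv i (insert \<sigma> D))"
  unfolding hoare_def
proof (intro allI impI)
  fix m x
  assume inv: "index_inv i D m x"
  then have m: "ready m" "m Ix 0 = i" "m Out 0 = 0" "indexed i D m"
    by (simp_all add: index_inv_def)
  let ?k = "key B (map (vec i) \<sigma>)" and ?e = "ekey (map (eslot R Ix) \<sigma>)"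
  let ?m1 = "upd m Cnt ?k (m Cnt ?k + of_bool (m Stamp ?k \<noteq> Suc i))"
  let ?m2 = "upd ?m1 Stamp ?k (Suc i)"
  let ?m3 = "if {..<R} \<subseteq> set \<sigma> then upd ?m2 IsEdge ?k 1 else ?m2"
  have ek: "eval ?e m' = ?k" if "ready m'" "m' Ix 0 = i" for m'
    using that eval_word[of m' i \<sigma>] i \<sigma> by (simp add: ready_def)
  have "m Cnt ?k + of_bool (m Stamp ?k \<noteq> Suc i) \<le> M"
    using Cnt_le[OF m(4) i selection_word[OF i \<sigma>(1)]] m(1) by (auto simp: ready_def small_def)
  then have r1: "ready ?m1" by (intro ready_upd[OF m(1)]) auto
  have r2: "ready ?m2" using i M(2) by (intro ready_upd[OF r1]) auto
  have r3: "ready ?m3" using ready_upd[OF r2, of 1 IsEdge] r2 M(2) by simp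
  note bd = bounded_b
  let ?i = "Bin Plus (scalar Ix) (Lit 1)"
  let ?c = "if {..<R} \<subseteq> set \<sigma> then Put IsEdge ?e (Lit 1) else Skip"
  have 1: "run (Put Cnt ?e (Bin Plus (At Cnt ?e) (isz (eeq (At Stamp ?e) ?i)))) (m, x)
      (wcom (Put Cnt ?e (Bin Plus (At Cnt ?e) (isz (eeq (At Stamp ?e) ?i)))) * b) (?m1, x)"
    using run_Put[of b m Cnt ?e "Bin Plus (At Cnt ?e) (isz (eeq (At Stamp ?e) ?i))" x] m ek[OF m(1,2)]
    by (simp add: ready_def bd)
  have 2: "run (Put Stamp ?e ?i) (?m1, x) (wcom (Put Stamp ?e ?i) * b) (?m2, x)"
    using run_Put[of b ?m1 Stamp ?e ?i x] r1 m ek[OF r1] by (simp add: ready_def bd)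
  have 3: "run ?c (?m2, x) (wcom ?c * b) (?m3, x)"
    using run_Put[of b ?m2 IsEdge ?e "Lit 1" x] r2 m ek[OF r2] run_Skip[of "(?m2, x)"]
    by (simp add: ready_def bd)
  have "run (enter_word R \<sigma>) (m, x) (wcom (enter_word R \<sigma>) * b) (?m3, x)"
    using run_Seq[OF 1 run_Seq[OF 2 3]] by (simp add: enter_word_def Let_def algebra_simps)
  moreover have "index_inv i (insert \<sigma> D) ?m3 x"
    unfolding index_inv_def
  proof (intro conjI)
    show "indexed i (insert \<sigma> D) ?m3"
      by (rule indexed_step[OF m(4) i \<sigma> refl]) auto
  qed (use m r3 in auto)
  ultimately show "\<exists>m' x'. run (enter_word R \<sigma>) (m, x) (wcom (enter_word R \<sigma>) * b) (m', x') \<and>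
      index_inv i (insert \<sigma> D) m' x'" by blast
qed

lemma counting_upd:
  assumes "counting m" "v \<le> M" "a \<in> {Ix, Jx, Out}"
  shows "counting (upd m a i v)"
  using assms ready_upd[of m v a i] unfolding counting_def tables_def by auto

lemma hoare_index_edges:
  "hoare (\<lambda>m x. fresh m) (index_edges R) ((n + 1) * (wcom (index_edges R) * b))
     (\<lambda>m x. counting m \<and> m Out 0 = 0)"
proof -
  let ?body = "seqs (map (enter_word R) selections)"
  let ?p = "Put Ix (Lit 0) (Lit 0)"
  have body: "hoare (index_inv i {}) ?body (wcom ?body * b) (index_inv i (set selections))"
    if i: "i < n" for i
  proof -
    let ?cs = "map (enter_word R) selections"
    have "hoare (index_inv i (set (take 0 selections))) (seqs ?cs)
        (\<Sum>k<length ?cs. wcom (?cs ! k) * b) (index_inv i (set (take (length ?cs) selections)))"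
    proof (rule hoare_seqs)
      fix k assume "k < length ?cs"
      then have k: "k < length selections" by simp
      have "hoare (index_inv i (set (take k selections))) (enter_word R (selections ! k))
        (wcom (enter_word R (selections ! k)) * b)
        (index_inv i (insert (selections ! k) (set (take k selections))))"
        by (intro hoare_enter_word i nth_mem k set_take_subset)
      then show "hoare (index_inv i (set (take k selections))) (?cs ! k) (wcom (?cs ! k) * b)
        (index_inv i (set (take (Suc k) selections)))"
        using k by (simp add: take_Suc_conv_app_nth)
    qed
    moreover have "(\<Sum>k<length ?cs. wcom (?cs ! k) * b) = wcom ?body * b"
      by (simp only: wcom_seqs sum_list_sum_nth length_map atLeast0LessThan sum_distrib_right nth_map)
        simp
    ultimately show ?thesis by (simp add: atLeast0LessThan)
  qed
  have loop: "hoare (index_inv 0 {}) (For Ix (scalar NumE) ?body)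
      ((n + 1) * (wcom (For Ix (scalar NumE) Skip) * b + wcom ?body * b)) (index_inv n {})"
  proof (rule hoare_For_const)
    show "m Ix 0 = k \<and> eval (scalar NumE) m = n \<and> bounded b m" if "index_inv k {} m x" for k m x
      using that by (simp add: index_inv_def ready_def bounded_b)
    show "hoare (index_inv k {}) ?body (wcom ?body * b)
        (\<lambda>m x. m Ix 0 = k \<and> bounded b m \<and> index_inv (Suc k) {} (upd m Ix 0 (Suc k)) x)"
      if k: "k < n" for k
    proof (rule hoare_conseq[OF body[OF k]])
      fix m x assume inv: "index_inv k (set selections) m x"
      then have "ready (upd m Ix 0 (Suc k))"
        using k M(2) by (intro ready_upd) (auto simp: index_inv_def)
      moreover have "indexed (Suc k) {} (upd m Ix 0 (Suc k))"
        using indexed_next[of k m] inv indexed_cong[of "upd m Ix 0 (Suc k)" m]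
        by (simp add: index_inv_def)
      ultimately show "m Ix 0 = k \<and> bounded b m \<and> index_inv (Suc k) {} (upd m Ix 0 (Suc k)) x"
        using inv by (simp add: index_inv_def ready_def bounded_b)
    qed auto
  qed
  have init: "hoare (\<lambda>m x. fresh m) ?p (wcom ?p * b) (index_inv 0 {})"
  proof (rule hoare_Put)
    fix m and x :: "nat list" assume f: "fresh m"
    then have "ready (upd m Ix 0 0)" by (intro ready_upd) (auto simp: fresh_def)
    moreover have "indexed 0 {} (upd m Ix 0 0)" using f by (simp add: indexed_def fresh_def)
    ultimately show "bounded b m \<and> index_inv 0 {} (upd m Ix (eval (Lit 0) m) (eval (Lit 0) m)) x"
      using f by (simp add: index_inv_def fresh_def ready_def bounded_b)
  qed
  have e: "index_edges R = Seq ?p (For Ix (scalar NumE) ?body)"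
    by (simp add: index_edges_def selections_def)
  show ?thesis unfolding e
  proof (rule hoare_conseq[OF hoare_Seq[OF init loop]])
    fix m x assume "index_inv n {} m x"
    then show "counting m \<and> m Out 0 = 0"
      by (auto simp: index_inv_def indexed_def counting_def tables_def ready_def)
  next
    show "wcom ?p * b + (n + 1) * (wcom (For Ix (scalar NumE) Skip) * b + wcom ?body * b)
      \<le> (n + 1) * (wcom (Seq ?p (For Ix (scalar NumE) ?body)) * b)"
    proof -
      have "p + (n + 1) * (q + r) \<le> (n + 1) * (p + (q + r))" for p q r :: nat
        by (simp add: algebra_simps)
      then show ?thesis
        unfolding wcom.simps(4) wcom_For[of _ _ ?body] distrib_right .
    qed
  qed
qed

section \<open>The counting loops\<close>

lemma count_from_le: "count_from V i j \<le> n"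
proof -
  have "count_from V i j \<le> card {..<n}" unfolding count_from_def by (intro card_mono) auto
  then show ?thesis by simp
qed

lemma partial_le:
  assumes "i < n" "j \<le> n"
  shows "(\<Sum>i'<i. \<Sum>j'<n. count_from V i' j') + (\<Sum>j'<j. count_from V i j') \<le> M"
proof -
  have 1: "(\<Sum>j'<k. count_from V i' j') \<le> n * n" if "k \<le> n" for i' k
  proof -
    have "(\<Sum>j'<k. count_from V i' j') \<le> (\<Sum>j'<k. n)" by (intro sum_mono count_from_le)
    also have "\<dots> \<le> n * n" using that by simp
    finally show ?thesis .
  qed
  have "(\<Sum>i'<i. \<Sum>j'<n. count_from V i' j') \<le> (\<Sum>i'<i. n * n)" by (intro sum_mono 1) simp
  then have "(\<Sum>i'<i. \<Sum>j'<n. count_from V i' j') + (\<Sum>j'<j. count_from V i j') \<le> Suc i * (n * n)"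
    using 1[OF assms(2), of i] by simp
  also have "\<dots> \<le> n * (n * n)" using assms by (intro mult_le_mono1) simp
  finally show ?thesis using M(3) by simp
qed

lemma hoare_count_all:
  "hoare (\<lambda>m x. counting m \<and> m Out 0 = 0) (count_all R V)
     ((n + 1) * ((n + 1) * (wcom (count_all R V) * b))) (\<lambda>m x. counting m \<and> m Out 0 = total V)"
proof -
  let ?s = "\<lambda>i j. (\<Sum>i'<i. \<Sum>j'<n. count_from V i' j') + (\<Sum>j'<j. count_from V i j')"
  let ?I = "\<lambda>i j m (x :: nat list). counting m \<and> m Ix 0 = i \<and> m Jx 0 = j \<and> m Out 0 = ?s i j"
  let ?J = "\<lambda>i m (x :: nat list). counting m \<and> m Ix 0 = i \<and> m Out 0 = ?s i 0"
  let ?b = "bump Out (epair R V (eslots R Ix) (eslots R Jx))"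
  let ?pi = "Put Ix (Lit 0) (Lit 0)" and ?pj = "Put Jx (Lit 0) (Lit 0)"
  let ?fj = "For Jx (scalar NumE) ?b"
  have cb: "bounded b m \<and> m NumE 0 = n" if "counting m" for m
    using that by (simp add: counting_def ready_def bounded_b)
  have body: "hoare (?I i j) ?b (wcom ?b * b)
      (\<lambda>m x. m Jx 0 = j \<and> bounded b m \<and> ?I i (Suc j) (upd m Jx 0 (Suc j)) x)"
    if ij: "i < n" "j < n" for i j
    unfolding bump_def
  proof (rule hoare_Put)
    fix m x assume I: "?I i j m x"
    then have ev: "eval (epair R V (eslots R Ix) (eslots R Jx)) m = count_from V i j"
      using eval_epair_slots[of m i j V] ij
      unfolding counting_def ready_def count_from_def by simp
    have le: "?s i (Suc j) \<le> M" using partial_le[of i "Suc j" V] ij by simp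
    let ?m = "upd m Out 0 (?s i (Suc j))"
    have c: "counting ?m" "counting (upd ?m Jx 0 (Suc j))"
      using I le ij M(2) by (auto intro!: counting_upd)
    have "upd m Out (eval (Lit 0) m) (eval (Bin Plus (scalar Out) (epair R V (eslots R Ix) (eslots R Jx))) m) = ?m"
      using I ev by (simp add: add.assoc)
    then show "bounded b m \<and>
      upd m Out (eval (Lit 0) m) (eval (Bin Plus (scalar Out) (epair R V (eslots R Ix) (eslots R Jx))) m) Jx 0 = j \<and>
      bounded b (upd m Out (eval (Lit 0) m) (eval (Bin Plus (scalar Out) (epair R V (eslots R Ix) (eslots R Jx))) m)) \<and>
      ?I i (Suc j) (upd (upd m Out (eval (Lit 0) m)
        (eval (Bin Plus (scalar Out) (epair R V (eslots R Ix) (eslots R Jx))) m)) Jx 0 (Suc j)) x"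
      using I c cb[of m] cb[of ?m] by (simp only:) simp
  qed
  have inner: "hoare (?I i 0) ?fj ((n + 1) * (wcom (For Jx (scalar NumE) Skip) * b + wcom ?b * b)) (?I i n)"
    if i: "i < n" for i
  proof (rule hoare_For_const)
    show "m Jx 0 = k \<and> eval (scalar NumE) m = n \<and> bounded b m" if "?I i k m x" for k m x
      using that cb by simp
  qed (rule body[OF i])
  have prep: "hoare (?J i) ?pj (wcom ?pj * b) (?I i 0)" for i
    by (rule hoare_Put) (use cb in \<open>auto intro!: counting_upd\<close>)
  have row: "hoare (?J i) (Seq ?pj ?fj)
      (wcom ?pj * b + (n + 1) * (wcom (For Jx (scalar NumE) Skip) * b + wcom ?b * b))
      (\<lambda>m x. m Ix 0 = i \<and> bounded b m \<and> ?J (Suc i) (upd m Ix 0 (Suc i)) x)" if i: "i < n" for i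
  proof (rule hoare_conseq[OF hoare_Seq[OF prep inner[OF i]]])
    fix m x assume I: "?I i n m x"
    then have "counting (upd m Ix 0 (Suc i))" using M(2) i by (intro counting_upd) auto
    then show "m Ix 0 = i \<and> bounded b m \<and> ?J (Suc i) (upd m Ix 0 (Suc i)) x"
      using I cb[of m] by simp
  qed auto
  have outer: "hoare (?J 0) (For Ix (scalar NumE) (Seq ?pj ?fj))
      ((n + 1) * (wcom (For Ix (scalar NumE) Skip) * b +
        (wcom ?pj * b + (n + 1) * (wcom (For Jx (scalar NumE) Skip) * b + wcom ?b * b)))) (?J n)"
  proof (rule hoare_For_const)
    show "m Ix 0 = k \<and> eval (scalar NumE) m = n \<and> bounded b m" if "?J k m x" for k m x
      using that cb by simp
  qed (rule row)
  have init: "hoare (\<lambda>m x. counting m \<and> m Out 0 = 0) ?pi (wcom ?pi * b) (?J 0)"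
    by (rule hoare_Put) (use cb in \<open>auto intro!: counting_upd\<close>)
  show ?thesis unfolding count_all_def
  proof (rule hoare_conseq[OF hoare_Seq[OF init outer]])
    show "wcom ?pi * b + (n + 1) * (wcom (For Ix (scalar NumE) Skip) * b +
        (wcom ?pj * b + (n + 1) * (wcom (For Jx (scalar NumE) Skip) * b + wcom ?b * b)))
      \<le> (n + 1) * ((n + 1) * (wcom (Seq ?pi (For Ix (scalar NumE) (Seq ?pj ?fj))) * b))"
    proof -
      have "p + (n + 1) * (q + (r + (n + 1) * (s + t))) \<le> (n + 1) * ((n + 1) * (p + (q + (r + (s + t)))))"
        for p q r s t :: nat
        by (simp add: algebra_simps)
      then show ?thesis
        unfolding wcom.simps(4) wcom_For[of _ _ "Seq ?pj ?fj"] wcom_For[of _ _ ?b] distrib_right .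
    qed
  qed (auto simp: total_def)
qed

lemma hoare_count_nested:
  assumes sub: "\<And>f :: nat \<Rightarrow> nat set. fits V f \<Longrightarrow> f 1 \<subseteq> f 2"
  shows "hoare (\<lambda>m x. counting m \<and> m Out 0 = 0) (count_nested R V)
     ((n + 1) * (wcom (count_nested R V) * b)) (\<lambda>m x. counting m \<and> m Out 0 = total V)"
proof -
  \<comment> \<open>The loop runs over the second edge, so the double sum is transposed;
    \<open>sum.swap\<close> restores \<open>total\<close> at the end.\<close>
  let ?s = "\<lambda>j. \<Sum>j'<j. \<Sum>i'<n. count_from V i' j'"
  let ?I = "\<lambda>j m (x :: nat list). counting m \<and> m Jx 0 = j \<and> m Out 0 = ?s j"
  let ?b = "bump Out (esub R V)" and ?pj = "Put Jx (Lit 0) (Lit 0)"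
  have cb: "bounded b m \<and> m NumE 0 = n" if "counting m" for m
    using that by (simp add: counting_def ready_def bounded_b)
  have body: "hoare (?I j) ?b (wcom ?b * b)
      (\<lambda>m x. m Jx 0 = j \<and> bounded b m \<and> ?I (Suc j) (upd m Jx 0 (Suc j)) x)"
    if j: "j < n" for j
    unfolding bump_def
  proof (rule hoare_Put)
    fix m x assume I: "?I j m x"
    then have ev: "eval (esub R V) m = (\<Sum>i'<n. count_from V i' j)"
      using eval_esub[of m j V] j sub
      unfolding counting_def ready_def count_from_def by simp
    have "?s (Suc j) \<le> (\<Sum>j'<Suc j. \<Sum>i'<n. n)" by (intro sum_mono count_from_le)
    also have "\<dots> = Suc j * (n * n)" by simp
    also have "\<dots> \<le> n * (n * n)" using j by (intro mult_le_mono1) simp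
    finally have le: "?s (Suc j) \<le> M" using M(3) by simp
    let ?m = "upd m Out 0 (?s (Suc j))"
    have c: "counting ?m" "counting (upd ?m Jx 0 (Suc j))"
      using I le j M(2) by (auto intro!: counting_upd simp del: sum.lessThan_Suc)
    have "upd m Out (eval (Lit 0) m) (eval (Bin Plus (scalar Out) (esub R V)) m) = ?m"
      using I ev by (simp add: add.assoc)
    then show "bounded b m \<and>
      upd m Out (eval (Lit 0) m) (eval (Bin Plus (scalar Out) (esub R V)) m) Jx 0 = j \<and>
      bounded b (upd m Out (eval (Lit 0) m) (eval (Bin Plus (scalar Out) (esub R V)) m)) \<and>
      ?I (Suc j) (upd (upd m Out (eval (Lit 0) m)
        (eval (Bin Plus (scalar Out) (esub R V)) m)) Jx 0 (Suc j)) x"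
      using I c cb[of m] cb[of ?m] by (simp only:) simp
  qed
  have loop: "hoare (?I 0) (For Jx (scalar NumE) ?b)
      ((n + 1) * (wcom (For Jx (scalar NumE) Skip) * b + wcom ?b * b)) (?I n)"
  proof (rule hoare_For_const)
    show "m Jx 0 = k \<and> eval (scalar NumE) m = n \<and> bounded b m" if "?I k m x" for k m x
      using that cb by simp
  qed (rule body)
  have init: "hoare (\<lambda>m x. counting m \<and> m Out 0 = 0) ?pj (wcom ?pj * b) (?I 0)"
    by (rule hoare_Put) (use cb in \<open>auto intro!: counting_upd\<close>)
  show ?thesis unfolding count_nested_def
  proof (rule hoare_conseq[OF hoare_Seq[OF init loop]])
    show "wcom ?pj * b + (n + 1) * (wcom (For Jx (scalar NumE) Skip) * b + wcom ?b * b)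
      \<le> (n + 1) * (wcom (Seq ?pj (For Jx (scalar NumE) ?b)) * b)"
    proof -
      have "p + (n + 1) * (q + r) \<le> (n + 1) * (p + (q + r))" for p q r :: nat
        by (simp add: algebra_simps)
      then show ?thesis
        unfolding wcom.simps(4) wcom_For[of _ _ ?b] distrib_right .
    qed
  qed (auto simp: total_def intro: sum.swap)
qed

end

end

end

section \<open>Reading the input\<close>

text \<open>A new vertex is renamed to the number of its first position in the padded edge list.
  This makes all names polynomial in the number of edges, so that long vertex names are
  paid for only while they are read.\<close>

definition read_vertex :: "nat \<Rightarrow> nat \<Rightarrow> com" where
  "read_vertex R j = (let v = scalar Vtx; p = Bin Plus (Bin Times (Lit R) (scalar Ix)) (Lit j) in
     Seq (Get Vtx)
    (Seq (Put Ids v (Bin Plus (At Ids v) (Bin Times (isz (At Ids v)) (Bin Plus p (Lit 1)))))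
    (Seq (Put Slot p (At Ids v))
         (Put Vtx (Lit 0) (Lit 0)))))"

definition read_slot :: "nat \<Rightarrow> nat \<Rightarrow> com" where
  "read_slot R j = Cond (Bin Minus (scalar Len) (Lit j)) (read_vertex R j)"

definition read_edges :: "nat \<Rightarrow> com" where
  "read_edges R =
     Seq (Get NumE)
    (Seq (Put Base (Lit 0) (Bin Plus (Bin Times (Lit R) (scalar NumE)) (Lit 1)))
         (For Ix (scalar NumE) (Seq (Get Len) (seqs (map (read_slot R) [0..<R])))))"

text \<open>The \<open>Suc\<close> pays for fetching the token, as \<open>Get\<close> weighs
  0.\<close>

definition read_weight :: "nat \<Rightarrow> nat" where
  "read_weight R = Suc (\<Sum>j<R. wcom (read_slot R j))"

definition encode :: "nat list list \<Rightarrow> nat list" where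
  "encode es = concat (map (\<lambda>e. length e # e) es)"

lemma bounded_upd: "bounded b m \<Longrightarrow> bits v \<le> b \<Longrightarrow> bounded b (upd m a i v)"
  by (simp add: bounded_def)

lemma bounded_mono: "bounded b m \<Longrightarrow> b \<le> b' \<Longrightarrow> bounded b' m"
  unfolding bounded_def using order_trans by blast

lemma position_inj:
  fixes i i' j j' R :: nat
  assumes "j < R" "j' < R"
  shows "R * i' + j' = R * i + j \<longleftrightarrow> i' = i \<and> j' = j"
proof
  assume eq: "R * i' + j' = R * i + j"
  have "i' = i" using arg_cong[OF eq, of "\<lambda>x. x div R"] assms by simp
  with eq show "i' = i \<and> j' = j" by simp
qed auto

locale input =
  fixes R :: nat and es :: "nat list list"
  assumes length_le: "e \<in> set es \<Longrightarrow> length e \<le> R"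
    and distinct_edge: "e \<in> set es \<Longrightarrow> distinct e"
    and distinct_edges: "distinct (map set es)"
begin

abbreviation n :: nat where
  "n \<equiv> length es"

abbreviation B :: nat where
  "B \<equiv> R * n + 1"

text \<open>A crude common bound for \<open>B\<close>, \<open>n + 1\<close>, the number of triples
  and the edge lengths kept in \<open>Len\<close>.\<close>

definition M :: nat where
  "M = (R + 2) * (n + 1) ^ 3"

abbreviation b :: nat where
  "b \<equiv> bits M"

lemma M_bounds: "B \<le> M" "Suc n \<le> M" "n * (n * n) \<le> M" "R \<le> M"
proof -
  have M: "M = (R + 2) * ((n + 1) * ((n + 1) * (n + 1)))"
    by (simp add: M_def power3_eq_cube mult.assoc)
  show "B \<le> M" "Suc n \<le> M" "n * (n * n) \<le> M" "R \<le> M"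
    unfolding M by (simp_all add: algebra_simps)
qed

definition before :: "nat \<Rightarrow> nat \<Rightarrow> nat \<Rightarrow> nat \<Rightarrow> bool" where
  "before i j i' j' \<longleftrightarrow> i' < n \<and> j' < length (es ! i') \<and> (i' < i \<or> i' = i \<and> j' < j)"

definition seen :: "nat \<Rightarrow> nat \<Rightarrow> nat set" where
  "seen i j = {es ! i' ! j' | i' j'. before i j i' j'}"

definition read_inv :: "nat \<Rightarrow> nat \<Rightarrow> mem \<Rightarrow> bool" where
  "read_inv i j m \<longleftrightarrow>
     m NumE 0 = n \<and> m Base 0 = B \<and> m Ix 0 = i \<and> m Out 0 = 0 \<and>
     (\<forall>k. m Stamp k = 0 \<and> m Cnt k = 0 \<and> m IsEdge k = 0) \<and> small M m \<and>
     (\<forall>v. m Ids v \<le> R * i + j) \<and> (\<forall>v. m Ids v = 0 \<longleftrightarrow> v \<notin> seen i j) \<and>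
     inj_on (m Ids) (seen i j) \<and>
     (\<forall>i'<n. \<forall>j'<R. m Slot (R * i' + j') = (if before i j i' j' then m Ids (es ! i' ! j') else 0))"

lemma before_Suc:
  assumes "i < n" "j < length (es ! i)"
  shows "before i (Suc j) i' j' \<longleftrightarrow> before i j i' j' \<or> i' = i \<and> j' = j"
  using assms by (auto simp: before_def less_Suc_eq)

lemma seen_Suc:
  assumes "i < n" "j < length (es ! i)"
  shows "seen i (Suc j) = insert (es ! i ! j) (seen i j)"
  unfolding seen_def before_Suc[OF assms] by auto

lemma before_end:
  assumes "length (es ! i) \<le> j"
  shows "before i (Suc j) i' j' \<longleftrightarrow> before i j i' j'"
  using assms by (auto simp: before_def)

lemma before_next:
  assumes "length (es ! i) \<le> R"
  shows "before (Suc i) 0 i' j' \<longleftrightarrow> before i R i' j'"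
  using assms by (auto simp: before_def less_Suc_eq)

lemma length_nth_le: "i < n \<Longrightarrow> length (es ! i) \<le> R"
  by (simp add: length_le)

lemma read_inv_step:
  assumes inv: "read_inv i j m" and i: "i < n" and j: "j < length (es ! i)"
    and v: "v = es ! i ! j" and w: "w = m Ids v + of_bool (m Ids v = 0) * Suc (R * i + j)"
    and Slot: "m' Slot = (m Slot)(R * i + j := w)" and Ids: "m' Ids = (m Ids)(v := w)"
    and same: "\<And>a. a \<in> {NumE, Base, Ix, Out, Stamp, Cnt, IsEdge} \<Longrightarrow> m' a = m a"
    and small: "small M m'"
  shows "read_inv i (Suc j) m'"
proof -
  note I = inv[unfolded read_inv_def]
  have jR: "j < R" using j length_nth_le[OF i] by simp
  have ids: "m' Ids u = m Ids u" if "u \<in> seen i j" for u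
    using that I unfolding Ids w by auto
  have new: "m' Ids v \<noteq> 0" "\<forall>u\<in>seen i j. u \<noteq> v \<longrightarrow> m' Ids u \<noteq> m' Ids v"
  proof -
    show "m' Ids v \<noteq> 0" unfolding Ids w by (cases "m Ids v = 0") simp_all
    show "\<forall>u\<in>seen i j. u \<noteq> v \<longrightarrow> m' Ids u \<noteq> m' Ids v"
    proof (intro ballI impI)
      fix u assume u: "u \<in> seen i j" "u \<noteq> v"
      show "m' Ids u \<noteq> m' Ids v"
      proof (cases "v \<in> seen i j")
        case True
        then have "m Ids u \<noteq> m Ids v" using I u by (meson inj_onD)
        then show ?thesis using ids True u by simp
      next
        case False
        then have "m' Ids v = Suc (R * i + j)" using I unfolding Ids w by simp
        moreover have "m' Ids u \<le> R * i + j" using ids[OF u(1)] I by simp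
        ultimately show ?thesis by simp
      qed
    qed
  qed
  have "inj_on (m' Ids) (insert v (seen i j))"
  proof (rule inj_onI)
    fix x y assume xy: "x \<in> insert v (seen i j)" "y \<in> insert v (seen i j)" "m' Ids x = m' Ids y"
    show "x = y"
    proof (cases "x \<in> seen i j \<and> y \<in> seen i j")
      case True
      then have "m Ids x = m Ids y" using xy(3) ids by simp
      then show ?thesis using True I by (meson inj_onD)
    next
      case False
      then show ?thesis using new(2) xy by (metis insert_iff)
    qed
  qed
  moreover have "m' Ids u \<le> R * i + Suc j" for u
  proof -
    have "m Ids u \<le> R * i + j" for u using I by simp
    from this[of u] this[of v] show ?thesis unfolding Ids w by (auto simp: le_SucI)
  qed
  moreover have "m' Ids u = 0 \<longleftrightarrow> u \<notin> insert v (seen i j)" for u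
    using I new(1) unfolding Ids by auto
  moreover have "m' Slot (R * i' + j') =
      (if before i (Suc j) i' j' then m' Ids (es ! i' ! j') else 0)" if "i' < n" "j' < R" for i' j'
  proof (cases "i' = i \<and> j' = j")
    case True
    then show ?thesis unfolding before_Suc[OF i j] Slot Ids v by simp
  next
    case False
    have "m' Slot (R * i' + j') = m Slot (R * i' + j')"
      using position_inj[OF jR that(2), of i' i] False unfolding Slot by simp
    also have "\<dots> = (if before i j i' j' then m Ids (es ! i' ! j') else 0)"
      using I that by simp
    also have "\<dots> = (if before i (Suc j) i' j' then m' Ids (es ! i' ! j') else 0)"
    proof (cases "before i j i' j'")
      case True
      then have "es ! i' ! j' \<in> seen i j" unfolding seen_def by blast
      with True show ?thesis using ids before_Suc[OF i j] by simp
    next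
      case nb: False
      then have "\<not> before i (Suc j) i' j'" using False before_Suc[OF i j] by simp
      with nb show ?thesis by simp
    qed
    finally show ?thesis .
  qed
  ultimately show ?thesis
    using I small same unfolding read_inv_def seen_Suc[OF i j] v[symmetric] by simp
qed

text \<open>The original name \<open>v\<close> may be much longer than \<open>b\<close> and is in
  memory only during this command, hence the factor \<open>b + bits v\<close>. Resetting
  \<open>Vtx\<close> restores \<open>small M\<close>.\<close>

lemma run_read_vertex:
  assumes inv: "read_inv i j m" and i: "i < n" and j: "j < length (es ! i)" and v: "v = es ! i ! j"
  shows "\<exists>m'. run (read_vertex R j) (m, v # xs) (bits v + wcom (read_vertex R j) * (b + bits v)) (m', xs) \<and>
    read_inv i (Suc j) m' \<and> m' Len 0 = m Len 0"
proof -
  let ?w = "m Ids v + of_bool (m Ids v = 0) * Suc (R * i + j)"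
  let ?m1 = "upd m Vtx 0 v"
  let ?m2 = "upd ?m1 Ids v ?w"
  let ?m3 = "upd ?m2 Slot (R * i + j) ?w"
  let ?m4 = "upd ?m3 Vtx 0 0"
  let ?b = "b + bits v"
  note I = inv[unfolded read_inv_def]
  have jR: "j < R" using j length_nth_le[OF i] by simp
  have le: "Suc (R * i + j) \<le> M"
  proof -
    have "R * i + j < R * Suc i" using jR by simp
    also have "\<dots> \<le> R * n" using i by (intro mult_le_mono2) simp
    finally show ?thesis using M_bounds(1) by simp
  qed
  have "m Ids v \<le> M" using I by (simp add: small_def)
  with le have w: "?w \<le> M" by (cases "m Ids v = 0") simp_all
  have bw: "bits ?w \<le> ?b" using bits_mono[OF w] by simp
  have 0: "bounded ?b m" using small_bounded[of M m] I by (auto intro: bounded_mono)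
  have 1: "bounded ?b ?m1" by (rule bounded_upd[OF 0]) simp
  have 2: "bounded ?b ?m2" by (rule bounded_upd[OF 1 bw])
  have 3: "bounded ?b ?m3" by (rule bounded_upd[OF 2 bw])
  let ?v = "scalar Vtx" and ?p = "Bin Plus (Bin Times (Lit R) (scalar Ix)) (Lit j)"
  let ?c2 = "Put Ids ?v (Bin Plus (At Ids ?v) (Bin Times (isz (At Ids ?v)) (Bin Plus ?p (Lit 1))))"
  let ?c3 = "Put Slot ?p (At Ids ?v)" and ?c4 = "Put Vtx (Lit 0) (Lit 0)"
  have r1: "run (Get Vtx) (m, v # xs) (bits v) (?m1, xs)"
    using run_Get[of Vtx m "v # xs"] by (simp add: next_input_def)
  have r2: "run ?c2 (?m1, xs) (wcom ?c2 * ?b) (?m2, xs)"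
    using run_Put[OF 1, of Ids ?v "Bin Plus (At Ids ?v) (Bin Times (isz (At Ids ?v)) (Bin Plus ?p (Lit 1)))" xs]
      I by simp
  have r3: "run ?c3 (?m2, xs) (wcom ?c3 * ?b) (?m3, xs)"
    using run_Put[OF 2, of Slot ?p "At Ids ?v" xs] I by simp
  have r4: "run ?c4 (?m3, xs) (wcom ?c4 * ?b) (?m4, xs)"
    using run_Put[OF 3, of Vtx "Lit 0" "Lit 0" xs] by simp
  have "run (read_vertex R j) (m, v # xs)
      (bits v + (wcom ?c2 * ?b + (wcom ?c3 * ?b + wcom ?c4 * ?b))) (?m4, xs)"
    unfolding read_vertex_def Let_def by (intro run_Seq[OF r1] run_Seq[OF r2] run_Seq[OF r3 r4])
  moreover have "bits v + (wcom ?c2 * ?b + (wcom ?c3 * ?b + wcom ?c4 * ?b)) =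
      bits v + wcom (read_vertex R j) * ?b"
    unfolding read_vertex_def Let_def wcom.simps(3,4) distrib_right by simp
  ultimately have "run (read_vertex R j) (m, v # xs)
      (bits v + wcom (read_vertex R j) * ?b) (?m4, xs)" by (simp only:)
  moreover have "read_inv i (Suc j) ?m4"
  proof (rule read_inv_step[OF inv i j v refl])
    show "small M ?m4" using I w by (auto simp: small_def)
  qed (auto simp: upd_def)
  ultimately show ?thesis by (intro exI[of _ ?m4]) simp
qed

section \<open>The time for reading, charged to the tokens of the input\<close>

definition token_cost :: "nat \<Rightarrow> nat \<Rightarrow> nat" where
  "token_cost i j = (if j < length (es ! i) then bits (es ! i ! j) else 0)"

lemma wcom_read_slot: "j < R \<Longrightarrow> Suc (wcom (read_slot R j)) \<le> read_weight R"
  unfolding read_weight_def using member_le_sum[of j "{..<R}" "\<lambda>j. wcom (read_slot R j)"] by simp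

lemma hoare_read_slot:
  assumes i: "i < n" and j: "j < R"
  shows "hoare (\<lambda>m x. read_inv i j m \<and> m Len 0 = length (es ! i) \<and> x = drop j (es ! i) @ xs)
     (read_slot R j) (read_weight R * (b + token_cost i j))
     (\<lambda>m x. read_inv i (Suc j) m \<and> m Len 0 = length (es ! i) \<and> x = drop (Suc j) (es ! i) @ xs)"
    (is "hoare ?P _ _ ?Q")
proof -
  let ?e = "Bin Minus (scalar Len) (Lit j)"
  have bd: "bounded b m" if "?P m x" for m x
    using that small_bounded by (simp add: read_inv_def)
  show ?thesis
  proof (cases "j < length (es ! i)")
    case True
    let ?v = "es ! i ! j"
    have "hoare (\<lambda>m x. ?P m x \<and> 0 < eval ?e m) (read_vertex R j)
        (bits ?v + wcom (read_vertex R j) * (b + bits ?v)) ?Q"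
      unfolding hoare_def
    proof (intro allI impI)
      fix m x assume P: "?P m x \<and> 0 < eval ?e m"
      then have x: "x = ?v # drop (Suc j) (es ! i) @ xs"
        using True by (simp add: Cons_nth_drop_Suc[symmetric])
      show "\<exists>m' x'. run (read_vertex R j) (m, x)
          (bits ?v + wcom (read_vertex R j) * (b + bits ?v)) (m', x') \<and> ?Q m' x'"
      proof -
        obtain m' where m': "run (read_vertex R j) (m, ?v # drop (Suc j) (es ! i) @ xs)
            (bits ?v + wcom (read_vertex R j) * (b + bits ?v)) (m', drop (Suc j) (es ! i) @ xs)"
          "read_inv i (Suc j) m'" "m' Len 0 = m Len 0"
          using run_read_vertex[OF _ i True refl] P by blast
        then have "?Q m' (drop (Suc j) (es ! i) @ xs)" using P by simp
        with m'(1) show ?thesis unfolding x by blast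
      qed
    qed
    then have "hoare ?P (read_slot R j)
        (wcom (Cond ?e Skip) * b + (bits ?v + wcom (read_vertex R j) * (b + bits ?v))) ?Q"
      unfolding read_slot_def using bd True by (intro hoare_Cond) auto
    then show ?thesis
    proof (rule hoare_conseq)
      have w: "wcom (read_slot R j) = wcom (Cond ?e Skip) + wcom (read_vertex R j)"
        by (simp add: read_slot_def)
      have "wcom (Cond ?e Skip) * b + (bits ?v + wcom (read_vertex R j) * (b + bits ?v))
          \<le> Suc (wcom (read_slot R j)) * (b + bits ?v)"
        unfolding w by (simp add: algebra_simps)
      also have "\<dots> \<le> read_weight R * (b + bits ?v)"
        by (intro mult_le_mono1 wcom_read_slot j)
      finally show "wcom (Cond ?e Skip) * b + (bits ?v + wcom (read_vertex R j) * (b + bits ?v))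
          \<le> read_weight R * (b + token_cost i j)" using True by (simp add: token_cost_def)
    qed
  next
    case False
    have "hoare (\<lambda>m x. ?P m x \<and> 0 < eval ?e m) (read_vertex R j) 0 ?Q"
      using False by (auto simp: hoare_def)
    moreover have "?Q m x" if "?P m x" for m x
    proof -
      have len: "length (es ! i) \<le> j" using False by simp
      have "seen i (Suc j) = seen i j" unfolding seen_def before_end[OF len] ..
      then have "read_inv i (Suc j) m"
        using that unfolding read_inv_def before_end[OF len] by (auto simp: le_SucI)
      with that len show ?thesis by simp
    qed
    ultimately have "hoare ?P (read_slot R j) (wcom (Cond ?e Skip) * b + 0) ?Q"
      unfolding read_slot_def using bd by (intro hoare_Cond) auto
    then show ?thesis
    proof (rule hoare_conseq)
      have "wcom (Cond ?e Skip) \<le> read_weight R"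
        using wcom_read_slot[OF j] by (simp add: read_slot_def)
      then show "wcom (Cond ?e Skip) * b + 0 \<le> read_weight R * (b + token_cost i j)"
        by (simp add: distrib_left mult_le_mono1 trans_le_add1)
    qed
  qed
qed

lemma sum_token_cost: "i < n \<Longrightarrow> (\<Sum>j<R. token_cost i j) = sum_list (map bits (es ! i))"
proof -
  assume i: "i < n"
  have "(\<Sum>j<R. token_cost i j) = (\<Sum>j<length (es ! i). token_cost i j)"
    using length_nth_le[OF i] by (intro sum.mono_neutral_right) (auto simp: token_cost_def)
  also have "\<dots> = sum_list (map bits (es ! i))"
    by (simp add: token_cost_def sum_list_sum_nth atLeast0LessThan)
  finally show ?thesis .
qed

definition edge_cost :: "nat \<Rightarrow> nat" where
  "edge_cost i = bits (length (es ! i)) + sum_list (map bits (es ! i))"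

lemma hoare_read_edge:
  assumes i: "i < n"
  shows "hoare (\<lambda>m x. read_inv i 0 m \<and> x = encode (drop i es))
     (Seq (Get Len) (seqs (map (read_slot R) [0..<R])))
     (read_weight R * (R * b + edge_cost i))
     (\<lambda>m x. m Ix 0 = i \<and> bounded b m \<and> read_inv (Suc i) 0 (upd m Ix 0 (Suc i)) \<and>
        x = encode (drop (Suc i) es))"
proof -
  let ?xs = "encode (drop (Suc i) es)"
  let ?J = "\<lambda>j m x. read_inv i j m \<and> m Len 0 = length (es ! i) \<and> x = drop j (es ! i) @ ?xs"
  have enc: "encode (drop i es) = length (es ! i) # es ! i @ ?xs"
    using i by (simp add: encode_def Cons_nth_drop_Suc[symmetric])
  have get: "hoare (\<lambda>m x. read_inv i 0 m \<and> x = encode (drop i es)) (Get Len)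
      (bits (length (es ! i))) (?J 0)"
  proof (rule hoare_Get)
    fix m x assume P: "read_inv i 0 m \<and> x = encode (drop i es)"
    have "small M (upd m Len 0 (length (es ! i)))"
      using P length_nth_le[OF i] M_bounds(4) by (intro small_upd) (auto simp: read_inv_def)
    then have "read_inv i 0 (upd m Len 0 (length (es ! i)))"
      using P by (simp add: read_inv_def upd_def)
    then show "bits (next_input x) \<le> bits (length (es ! i)) \<and> ?J 0 (upd m Len 0 (next_input x)) (tl x)"
      using P by (simp add: enc next_input_def)
  qed
  have "hoare (?J 0) (seqs (map (read_slot R) [0..<R]))
      (\<Sum>j<length (map (read_slot R) [0..<R]). read_weight R * (b + token_cost i j))
      (?J (length (map (read_slot R) [0..<R])))"
    by (rule hoare_seqs) (use hoare_read_slot[OF i] in simp)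
  moreover have "(\<Sum>j<R. read_weight R * (b + token_cost i j)) =
      read_weight R * (R * b + sum_list (map bits (es ! i)))"
    by (simp add: sum_distrib_left[symmetric] sum.distrib sum_token_cost[OF i])
  ultimately have slots: "hoare (?J 0) (seqs (map (read_slot R) [0..<R]))
      (read_weight R * (R * b + sum_list (map bits (es ! i)))) (?J R)" by simp
  show ?thesis
  proof (rule hoare_conseq[OF hoare_Seq[OF get slots]])
    fix m x assume J: "?J R m x"
    have len: "length (es ! i) \<le> R" using length_nth_le[OF i] .
    have "seen (Suc i) 0 = seen i R" unfolding seen_def before_next[OF len] ..
    moreover have "small M (upd m Ix 0 (Suc i))"
      using J i M_bounds(2) by (intro small_upd) (auto simp: read_inv_def)
    ultimately have "read_inv (Suc i) 0 (upd m Ix 0 (Suc i))"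
      using J unfolding read_inv_def before_next[OF len] by (simp add: upd_def add.commute)
    moreover have "m Ix 0 = i \<and> bounded b m" using J small_bounded by (simp add: read_inv_def)
    ultimately show "m Ix 0 = i \<and> bounded b m \<and> read_inv (Suc i) 0 (upd m Ix 0 (Suc i)) \<and> x = ?xs"
      using J len by simp
  next
    have "bits (length (es ! i)) \<le> read_weight R * bits (length (es ! i))"
      by (simp add: read_weight_def)
    then show "bits (length (es ! i)) + read_weight R * (R * b + sum_list (map bits (es ! i)))
        \<le> read_weight R * (R * b + edge_cost i)"
      by (simp add: edge_cost_def distrib_left)
  qed
qed

definition input_size :: nat where
  "input_size = enc_size (n # encode es)"

lemma input_size_eq: "input_size = bits n + (\<Sum>i<n. edge_cost i)"
proof -
  have "sum_list (map bits (encode es)) = (\<Sum>e\<leftarrow>es. bits (length e) + sum_list (map bits e))"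
    unfolding encode_def by (induction es) auto
  also have "\<dots> = (\<Sum>i<n. edge_cost i)"
    by (simp add: sum_list_sum_nth atLeast0LessThan edge_cost_def)
  finally show ?thesis by (simp add: input_size_def enc_size_def)
qed

text \<open>Each edge contributes at least the bit of its cardinality, and the number of edges at
  least one more. So a loop over the edges is linear in the input size.\<close>

lemma n_less_input_size: "n + 1 \<le> input_size"
proof -
  have "(\<Sum>i<n. 1) \<le> (\<Sum>i<n. edge_cost i)"
    by (intro sum_mono) (simp add: edge_cost_def trans_le_add1)
  then have "n \<le> (\<Sum>i<n. edge_cost i)" by simp
  then show ?thesis using bits_pos[of n] unfolding input_size_eq by linarith
qed

text \<open>Work per slot costs multiples of \<open>b\<close>; work on long vertex names is
  proportional to the bits of each token and adds up to the input size.\<close>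

lemma hoare_read_edges:
  "hoare (\<lambda>m x. m = (\<lambda>_ _. 0) \<and> x = n # encode es) (read_edges R)
     ((n + 1) * (wcom (read_edges R) + R * read_weight R) * b + read_weight R * input_size)
     (\<lambda>m x. read_inv n 0 m)"
proof -
  let ?p = "Put Base (Lit 0) (Bin Plus (Bin Times (Lit R) (scalar NumE)) (Lit 1))"
  let ?c = "Seq (Get Len) (seqs (map (read_slot R) [0..<R]))"
  let ?m0 = "upd (\<lambda>_ _. 0) NumE 0 n"
  let ?P = "\<lambda>m x. m = ?m0 \<and> x = encode es"
  have get: "hoare (\<lambda>m x. m = (\<lambda>_ _. 0) \<and> x = n # encode es) (Get NumE) (bits n) ?P"
    by (rule hoare_Get) (simp add: next_input_def)
  have put: "hoare ?P ?p (wcom ?p * b) (\<lambda>m x. read_inv 0 0 m \<and> x = encode (drop 0 es))"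
  proof (rule hoare_Put)
    fix m x assume P: "?P m x"
    have small: "small M ?m0" "small M (upd ?m0 Base 0 B)"
      using M_bounds by (auto simp: small_def)
    have none: "\<not> before 0 0 i' j'" for i' j' by (simp add: before_def)
    then have "seen 0 0 = {}" by (simp add: seen_def)
    then have "read_inv 0 0 (upd ?m0 Base 0 B)"
      using small none by (simp add: read_inv_def)
    then show "bounded b m \<and> read_inv 0 0 (upd m Base (eval (Lit 0) m)
       (eval (Bin Plus (Bin Times (Lit R) (scalar NumE)) (Lit 1)) m)) \<and> x = encode (drop 0 es)"
      using P small_bounded[OF small(1)] by simp
  qed
  let ?wf = "wcom (For Ix (scalar NumE) Skip)"
  have loop: "hoare (\<lambda>m x. read_inv 0 0 m \<and> x = encode (drop 0 es)) (For Ix (scalar NumE) ?c)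
     ((\<Sum>i<n. read_weight R * (R * b + edge_cost i)) + (n + 1) * ?wf * b)
     (\<lambda>m x. read_inv n 0 m \<and> x = encode (drop n es))"
  proof (rule hoare_For)
    show "m Ix 0 = k \<and> eval (scalar NumE) m = n \<and> bounded b m"
      if "read_inv k 0 m \<and> x = encode (drop k es)" for k m x
      using that small_bounded by (simp add: read_inv_def)
  qed (rule hoare_read_edge)
  show ?thesis unfolding read_edges_def
  proof (rule hoare_conseq[OF hoare_Seq[OF get hoare_Seq[OF put loop]]])
    let ?w = "read_weight R" and ?s = "\<Sum>i<n. edge_cost i"
    have sum: "(\<Sum>i<n. ?w * (R * b + edge_cost i)) = n * (R * ?w * b) + ?w * ?s"
      by (simp add: sum_distrib_left[symmetric] sum.distrib distrib_left algebra_simps)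
    have "bits n \<le> ?w * bits n" by (simp add: read_weight_def)
    moreover have "wcom ?p * b \<le> (n + 1) * wcom ?p * b"
      by (simp del: wcom.simps add: distrib_right)
    moreover have "?wf + wcom ?p \<le> wcom (Seq (Get NumE) (Seq ?p (For Ix (scalar NumE) ?c)))"
      unfolding wcom.simps(3,4) wcom_For[of _ _ ?c] by (simp del: wcom.simps)
    then have "(n + 1) * (?wf + wcom ?p) * b \<le>
        (n + 1) * wcom (Seq (Get NumE) (Seq ?p (For Ix (scalar NumE) ?c))) * b"
      by (intro mult_le_mono1 mult_le_mono2)
    moreover have "n * (R * ?w * b) \<le> (n + 1) * (R * ?w) * b" by (simp add: distrib_right mult.assoc)
    ultimately show "bits n + (wcom ?p * b + ((\<Sum>i<n. ?w * (R * b + edge_cost i)) + (n + 1) * ?wf * b))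
      \<le> (n + 1) * (wcom (Seq (Get NumE) (Seq ?p (For Ix (scalar NumE) ?c))) + R * ?w) * b + ?w * input_size"
      unfolding sum
      unfolding input_size_eq distrib_left distrib_right[of _ _ b] by linarith
  qed auto
qed

section \<open>The renamed edges as slots\<close>

definition vec :: "(nat \<Rightarrow> nat) \<Rightarrow> nat \<Rightarrow> nat \<Rightarrow> nat" where
  "vec \<rho> i j = (if i < n \<and> j < length (es ! i) then \<rho> (es ! i ! j) else 0)"

definition renaming :: "(nat \<Rightarrow> nat) \<Rightarrow> bool" where
  "renaming \<rho> \<longleftrightarrow> inj_on \<rho> (\<Union>e\<in>set es. set e) \<and> (\<forall>e\<in>set es. \<forall>v\<in>set e. 0 < \<rho> v \<and> \<rho> v < B)"

lemma range_vec:
  assumes "i < n"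
  shows "insert 0 (vec \<rho> i ` {..R}) = insert 0 (\<rho> ` set (es ! i))"
proof
  show "insert 0 (vec \<rho> i ` {..R}) \<subseteq> insert 0 (\<rho> ` set (es ! i))"
    by (auto simp: vec_def)
  show "insert 0 (\<rho> ` set (es ! i)) \<subseteq> insert 0 (vec \<rho> i ` {..R})"
  proof
    fix u assume u: "u \<in> insert 0 (\<rho> ` set (es ! i))"
    show "u \<in> insert 0 (vec \<rho> i ` {..R})"
    proof (cases "u = 0")
      case False
      with u obtain j where "j < length (es ! i)" "u = \<rho> (es ! i ! j)"
        by (auto simp: in_set_conv_nth)
      then have "u = vec \<rho> i j" "j \<le> R"
        using assms length_nth_le[OF assms] by (auto simp: vec_def)
      then show ?thesis by blast
    qed simp
  qed
qed

lemma slots_vec: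
  assumes \<rho>: "renaming \<rho>"
  shows "slots R n B (vec \<rho>)"
proof
  have pos: "0 < \<rho> (es ! i ! j)" "\<rho> (es ! i ! j) < B" if "i < n" "j < length (es ! i)" for i j
    using \<rho> that unfolding renaming_def by (meson nth_mem)+
  show "vec \<rho> i s < B" if "i < n" for i s
    using pos(2)[OF that] by (simp add: vec_def)
  show "vec \<rho> i s = 0" if "R \<le> s" for i s
    using that length_nth_le[of i] by (auto simp: vec_def)
  have inj: "es ! i ! s = es ! i' ! t"
    if "i < n" "i' < n" "s < length (es ! i)" "t < length (es ! i')" "\<rho> (es ! i ! s) = \<rho> (es ! i' ! t)"
    for i i' s t
  proof -
    have "es ! i ! s \<in> (\<Union>e\<in>set es. set e)" "es ! i' ! t \<in> (\<Union>e\<in>set es. set e)"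
      using that by (meson UN_I nth_mem)+
    then show ?thesis using \<rho> that(5) unfolding renaming_def by (meson inj_onD)
  qed
  show "s = t" if "i < n" "s < R" "t < R" "vec \<rho> i s = vec \<rho> i t" "vec \<rho> i s \<noteq> 0" for i s t
  proof -
    have l: "s < length (es ! i)" "t < length (es ! i)"
      using that by (auto simp: vec_def split: if_splits)
    then have "es ! i ! s = es ! i ! t" using that inj[of i i s t] by (simp add: vec_def)
    moreover have "distinct (es ! i)" using that(1) distinct_edge by simp
    ultimately show ?thesis using l by (simp add: nth_eq_iff_index_eq)
  qed
  show "i = j" if ij: "i < n" "j < n" "vec \<rho> i ` {..R} = vec \<rho> j ` {..R}" for i j
  proof -
    have "insert 0 (\<rho> ` set (es ! i)) = insert 0 (\<rho> ` set (es ! j))"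
      using range_vec[OF ij(1), of \<rho>] range_vec[OF ij(2), of \<rho>] ij(3) by simp
    moreover have "0 \<notin> \<rho> ` set (es ! i)" "0 \<notin> \<rho> ` set (es ! j)"
      using \<rho> ij unfolding renaming_def by (metis imageE less_irrefl nth_mem)+
    ultimately have "\<rho> ` set (es ! i) = \<rho> ` set (es ! j)" by (metis insert_ident)
    moreover have "set (es ! i) \<subseteq> (\<Union>e\<in>set es. set e)" "set (es ! j) \<subseteq> (\<Union>e\<in>set es. set e)"
      using ij by (meson UN_upper nth_mem)+
    ultimately have "set (es ! i) = set (es ! j)"
      using \<rho> unfolding renaming_def by (metis inj_on_image_eq_iff)
    then show "i = j" using distinct_edges ij nth_eq_iff_index_eq[of "map set es" i j] by simp
  qed
  show "0 < B" by simp
qed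

lemma E_vec:
  assumes "renaming \<rho>" "i < n"
  shows "slots.E R (vec \<rho>) i = \<rho> ` set (es ! i)"
proof -
  interpret slots R n B "vec \<rho>" using slots_vec[OF assms(1)] .
  have "0 \<notin> \<rho> ` set (es ! i)"
    using assms unfolding renaming_def by (metis imageE less_irrefl nth_mem)
  moreover have "S i = insert 0 (\<rho> ` set (es ! i))"
    using range_vec[OF assms(2), of \<rho>] zero_in_S[of i] unfolding S_def by (simp add: insert_absorb)
  ultimately show ?thesis unfolding E_def by simp
qed

lemma read_inv_end:
  assumes "read_inv n 0 m"
  shows "\<exists>\<rho>. renaming \<rho> \<and> slots.fresh R n B (vec \<rho>) M m"
proof (intro exI conjI)
  let ?\<rho> = "m Ids"
  note I = assms[unfolded read_inv_def]
  have seen: "seen n 0 = (\<Union>e\<in>set es. set e)"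
  proof (intro equalityI subsetI)
    fix v assume "v \<in> seen n 0"
    then obtain i j where "i < n" "j < length (es ! i)" "v = es ! i ! j"
      unfolding seen_def before_def by blast
    then show "v \<in> (\<Union>e\<in>set es. set e)" by (metis UN_I nth_mem)
  next
    fix v assume "v \<in> (\<Union>e\<in>set es. set e)"
    then obtain e where "e \<in> set es" "v \<in> set e" by blast
    then obtain i j where "i < n" "es ! i = e" "j < length e" "e ! j = v"
      by (metis in_set_conv_nth)
    then show "v \<in> seen n 0" unfolding seen_def before_def by blast
  qed
  show ren: "renaming ?\<rho>"
    unfolding renaming_def
  proof (intro conjI ballI)
    fix e v assume "e \<in> set es" "v \<in> set e"
    then have "v \<in> seen n 0" unfolding seen by blast
    then have "?\<rho> v \<noteq> 0" using I by blast
    then show "0 < ?\<rho> v" by simp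
    show "?\<rho> v < B" using I by (simp add: less_Suc_eq_le)
  qed (use I seen in simp)
  interpret slots R n B "vec ?\<rho>" using slots_vec[OF ren] .
  have "m Slot (R * i + s) = vec ?\<rho> i s" if "i < n" "s < R" for i s
    using I that by (simp add: vec_def before_def)
  then show "fresh M m"
    using I unfolding fresh_def ready_def slots_loaded_def by simp
qed

end

section \<open>Correctness and running time\<close>

definition finish :: "venn \<Rightarrow> com" where
  "finish V = Put Out (Lit 0) (Bin Quot (scalar Out) (Lit (card (automorphisms V))))"

definition motif_program :: "nat \<Rightarrow> venn \<Rightarrow> com \<Rightarrow> com" where
  "motif_program R V c = Seq (read_edges R) (Seq (index_edges R) (Seq c (finish V)))"

definition overhead :: "nat \<Rightarrow> venn \<Rightarrow> nat" where
  "overhead R V = wcom (read_edges R) + R * read_weight R + read_weight R + wcom (index_edges R) +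
     wcom (finish V)"

context input
begin

text \<open>Indices correspond bijectively to edges because these are distinct, and
  \<open>fits_image\<close> removes the renaming.\<close>

lemma total_vec:
  assumes \<rho>: "renaming \<rho>"
  shows "slots.total R n (vec \<rho>) V =
    card {(a, b, c). a \<in> set (map set es) \<and> b \<in> set (map set es) \<and> c \<in> set (map set es) \<and>
      fits V (triple a b c)}"
proof -
  interpret slots R n B "vec \<rho>" using slots_vec[OF \<rho>] .
  let ?F = "\<lambda>i. set (es ! i)" and ?X = "set (map set es)"
  have bij: "bij_betw ?F {..<n} ?X"
    using bij_betw_nth[OF distinct_edges, of "{..<n}" ?X]
    by (subst bij_betw_cong[of _ _ "\<lambda>i. map set es ! i"]) simp_all
  have fits: "fits V (triple (E i) (E j) (E k)) \<longleftrightarrow> fits V (triple (?F i) (?F j) (?F k))"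
    if "i < n" "j < n" "k < n" for i j k
  proof -
    let ?t = "triple (?F i) (?F j) (?F k)"
    have "(\<Union>l\<in>three. ?t l) \<subseteq> (\<Union>e\<in>set es. set e)"
    proof -
      have "?F l \<subseteq> (\<Union>e\<in>set es. set e)" if "l < n" for l
        using that by (intro UN_upper) simp
      from this[OF that(1)] this[OF that(2)] this[OF that(3)] show ?thesis
        by (simp add: three_def)
    qed
    then have "inj_on \<rho> (\<Union>l\<in>three. ?t l)"
      using \<rho> inj_on_subset unfolding renaming_def by blast
    from fits_image[OF this, of V] have "fits V (\<lambda>l. \<rho> ` ?t l) = fits V ?t" .
    moreover have "fits V (triple (E i) (E j) (E k)) = fits V (\<lambda>l. \<rho> ` ?t l)"
      by (rule fits_cong) (use that E_vec[OF \<rho>] in \<open>auto simp: three_def\<close>)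
    ultimately show ?thesis by simp
  qed
  have "total V = (\<Sum>i<n. \<Sum>j<n. card {k. k < n \<and> fits V (triple (?F i) (?F j) (?F k))})"
    unfolding total_def count_from_def
    by (intro sum.cong refl arg_cong[of _ _ card] Collect_cong) (use fits in auto)
  also have "\<dots> = (\<Sum>i<n. \<Sum>j<n. card {c \<in> ?X. fits V (triple (?F i) (?F j) c)})"
  proof (intro sum.cong refl)
    fix i j
    have inj: "inj_on ?F {..<n}" and im: "?F ` {..<n} = ?X"
      using bij by (simp_all only: bij_betw_def)
    have "card {k. k < n \<and> fits V (triple (?F i) (?F j) (?F k))} =
        card (?F ` {k. k < n \<and> fits V (triple (?F i) (?F j) (?F k))})"
      by (intro card_image[symmetric] inj_on_subset[OF inj]) auto
    also have "?F ` {k. k < n \<and> fits V (triple (?F i) (?F j) (?F k))} =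
        {c \<in> ?F ` {..<n}. fits V (triple (?F i) (?F j) c)}" by blast
    finally show "card {k. k < n \<and> fits V (triple (?F i) (?F j) (?F k))} =
        card {c \<in> ?X. fits V (triple (?F i) (?F j) c)}" unfolding im .
  qed
  also have "\<dots> = (\<Sum>a\<in>?X. \<Sum>b\<in>?X. card {c \<in> ?X. fits V (triple a b c)})"
    by (simp only: sum.reindex_bij_betw[OF bij, of "\<lambda>b. card {c \<in> ?X. fits V (triple _ b c)}"]
        sum.reindex_bij_betw[OF bij, of "\<lambda>a. \<Sum>b\<in>?X. card {c \<in> ?X. fits V (triple a b c)}"])
  also have "\<dots> = card (SIGMA a:?X. SIGMA b:?X. {c \<in> ?X. fits V (triple a b c)})"
  proof -
    have "finite ?X" by simp
    then show ?thesis by (subst card_SigmaI; (intro ballI finite_SigmaI)?) (auto intro!: sum.cong card_SigmaI[symmetric])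
  qed
  also have "(SIGMA a:?X. SIGMA b:?X. {c \<in> ?X. fits V (triple a b c)}) =
      {(a, b, c). a \<in> ?X \<and> b \<in> ?X \<and> c \<in> ?X \<and> fits V (triple a b c)}"
    by (simp only: set_eq_iff split_paired_all mem_Sigma_iff mem_Collect_eq case_prod_conv) simp
  finally show ?thesis .
qed

lemma total_motifs:
  assumes \<rho>: "renaming \<rho>" and V: "proper_venn V" and G: "edges G = set (map set es)"
  shows "slots.total R n (vec \<rho>) V div card (automorphisms V) = HyperMotif V G"
proof -
  have "finite (edges G)" unfolding G by simp
  from card_motifs[OF this V] show ?thesis
    unfolding total_vec[OF \<rho>] HyperMotif_def G[symmetric]
    using card_automorphisms_pos[of V] by (metis div_mult_self_is_m)
qed

text \<open>\<open>M\<close> is a constant times three factors \<open>n + 1\<close>, each at most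
  the input size.\<close>

lemma log_bound: "b \<le> (bits (R + 2) + 3) * bits input_size"
proof -
  have "b \<le> bits (R + 2) + (bits (n + 1) + (bits (n + 1) + bits (n + 1)))"
    unfolding M_def power3_eq_cube
    using bits_mult[of "R + 2" "(n + 1) * (n + 1) * (n + 1)"]
      bits_mult[of "(n + 1) * (n + 1)" "n + 1"] bits_mult[of "n + 1" "n + 1"] by linarith
  also have "\<dots> = bits (R + 2) + 3 * bits (n + 1)" by simp
  also have "\<dots> \<le> bits (R + 2) * bits input_size + 3 * bits input_size"
    using bits_mono[OF n_less_input_size] bits_pos[of input_size] by (intro add_mono) auto
  finally show ?thesis by (simp add: distrib_right)
qed

text \<open>The renaming depends on the order of the input, so it is existentially quantified in the
  assertion after reading, and the rest is shown for every renaming. The counting command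
  \<open>c\<close> and its time \<open>T\<close> stay open for both parts of the theorem.\<close>

lemma motif_program_computes:
  assumes V: "proper_venn V" and G: "edges G = set (map set es)"
    and count: "\<And>\<rho>. renaming \<rho> \<Longrightarrow> hoare (\<lambda>m x. slots.counting R n B (vec \<rho>) M m \<and> m Out 0 = 0) c T
      (\<lambda>m x. slots.counting R n B (vec \<rho>) M m \<and> m Out 0 = slots.total R n (vec \<rho>) V)"
  shows "\<exists>t \<le> overhead R V * (input_size * b) + T.
    ram_computes (ccom 0 (motif_program R V c)) (n # encode es) t (HyperMotif V G)"
proof -
  let ?H = "HyperMotif V G" and ?a = "Lit (card (automorphisms V))"
  let ?T = "(n + 1) * (wcom (index_edges R) * b) + (T + wcom (finish V) * b)"
  have rest: "hoare (\<lambda>m x. renaming \<rho> \<and> slots.fresh R n B (vec \<rho>) M m)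
     (Seq (index_edges R) (Seq c (finish V))) ?T (\<lambda>m x. m Out 0 = ?H)" for \<rho>
  proof (cases "renaming \<rho>")
    case True
    interpret slots R n B "vec \<rho>" using slots_vec[OF True] .
    have fin: "hoare (\<lambda>m x. counting M m \<and> m Out 0 = total V) (finish V) (wcom (finish V) * b)
        (\<lambda>m x. m Out 0 = ?H)"
      unfolding finish_def
    proof (rule hoare_Put)
      fix m and x :: "nat list" assume m: "counting M m \<and> m Out 0 = total V"
      then have "small M m" unfolding counting_def ready_def by blast
      then have "bounded b m" by (rule small_bounded)
      then show "bounded b m \<and> upd m Out (eval (Lit 0) m) (eval (Bin Quot (scalar Out) ?a) m) Out 0 = ?H"
        using m total_motifs[OF True V G] by simp
    qed
    show ?thesis
      using hoare_Seq[OF hoare_index_edges[OF M_bounds(1-3) refl] hoare_Seq[OF count[OF True] fin]]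
      by (rule hoare_conseq) auto
  qed (simp add: hoare_def)
  have "hoare (\<lambda>m x. m = (\<lambda>_ _. 0) \<and> x = n # encode es) (motif_program R V c)
     ((n + 1) * (wcom (read_edges R) + R * read_weight R) * b + read_weight R * input_size + ?T)
     (\<lambda>m x. m Out 0 = ?H)"
    unfolding motif_program_def
  proof (rule hoare_Seq)
    show "hoare (\<lambda>m x. m = (\<lambda>_ _. 0) \<and> x = n # encode es) (read_edges R)
        ((n + 1) * (wcom (read_edges R) + R * read_weight R) * b + read_weight R * input_size)
        (\<lambda>m x. \<exists>\<rho>. renaming \<rho> \<and> slots.fresh R n B (vec \<rho>) M m)"
      by (rule hoare_conseq[OF hoare_read_edges]) (assumption | rule read_inv_end order_refl)+
    show "hoare (\<lambda>m x. \<exists>\<rho>. renaming \<rho> \<and> slots.fresh R n B (vec \<rho>) M m)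
        (Seq (index_edges R) (Seq c (finish V))) ?T (\<lambda>m x. m Out 0 = ?H)"
      by (rule hoare_ex) (rule rest)
  qed
  then have "\<exists>t \<le> (n + 1) * (wcom (read_edges R) + R * read_weight R) * b + read_weight R * input_size + ?T.
      ram_computes (ccom 0 (motif_program R V c)) (n # encode es) t ?H"
    by (rule ram_computes_hoare)
  moreover have "(n + 1) * (wcom (read_edges R) + R * read_weight R) * b + read_weight R * input_size + ?T
    \<le> overhead R V * (input_size * b) + T"
  proof -
    let ?N = "input_size"
    have N: "n + 1 \<le> ?N" by (rule n_less_input_size)
    have "(n + 1) * (wcom (read_edges R) + R * read_weight R) * b \<le>
        ?N * (wcom (read_edges R) + R * read_weight R) * b"
      by (intro mult_le_mono1 N)
    moreover have "(n + 1) * (wcom (index_edges R) * b) \<le> ?N * (wcom (index_edges R) * b)"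
      by (intro mult_le_mono1 N)
    moreover have "read_weight R * ?N \<le> read_weight R * (?N * b)" by simp
    moreover have "1 * (wcom (finish V) * b) \<le> ?N * (wcom (finish V) * b)"
      using N by (intro mult_le_mono1) simp
    moreover have "overhead R V * (?N * b) = ?N * (wcom (read_edges R) + R * read_weight R) * b
        + read_weight R * (?N * b) + ?N * (wcom (index_edges R) * b) + ?N * (wcom (finish V) * b)"
      by (simp add: overhead_def algebra_simps)
    ultimately show ?thesis by linarith
  qed
  ultimately show ?thesis using order_trans by blast
qed

end

lemma encodes_input:
  assumes G: "G \<in> rank_at_most R" and x: "encodes x G"
  obtains es where "input R es" "edges G = set (map set es)" "x = length es # encode es"
proof -
  obtain es where es: "\<forall>e\<in>set es. distinct e" "distinct (map set es)" "set (map set es) = edges G"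
    "x = length es # concat (map (\<lambda>e. length e # e) es)"
    using x unfolding encodes_def by blast
  have "length e \<le> R" if e: "e \<in> set es" for e
  proof -
    have "set e \<in> edges G" using e es(3) by auto
    moreover have "finite (edges G)" unfolding es(3)[symmetric] by simp
    ultimately have "card (set e) \<le> hrank G" unfolding hrank_def by (intro Max_ge) auto
    then show ?thesis using G e es(1) by (simp add: rank_at_most_def distinct_card)
  qed
  then have "input R es" using es(1,2) by unfold_locales auto
  with es(3,4) show ?thesis by (intro that) (auto simp: encode_def)
qed

lemma soft_O_bits: "(\<lambda>N. real (K * (N ^ d * bits N))) \<in> soft_O (\<lambda>n. real n ^ d)"
proof -
  have "(\<lambda>N. real (K * (N ^ d * bits N))) \<in> O(\<lambda>n. real n ^ d * ln (real n) ^ 1)"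
  \<comment> \<open>For \<open>N \<ge> 2\<close>, \<open>bits N\<close> is at most
    \<open>log 2 N + 1\<close>, hence at most \<open>2 * log 2 N\<close>. A single logarithm
    suffices.\<close>
  proof (rule bigoI[where c = "real K * (2 / ln 2)"], rule eventually_mono[OF eventually_ge_at_top[of 2]])
    fix N :: nat assume N: "2 \<le> N"
    have "real (bits N) \<le> 2 / ln 2 * ln (real N)"
    proof -
      have "\<not> bits N \<le> bits N - 1" by (simp add: not_le)
      moreover have "bits N \<noteq> 1" using N bits_le_iff[of 1 N] by simp
      then have "1 \<le> bits N - 1" using bits_pos[of N] by linarith
      ultimately have "2 ^ (bits N - 1) \<le> N" using bits_le_iff[of "bits N - 1" N] by simp
      then have "real (bits N - 1) \<le> log 2 (real N)"
        by (rule le_log2_of_power)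
      moreover have "1 \<le> log 2 (real N)" using N by simp
      ultimately have "real (bits N) \<le> 2 * log 2 (real N)" by linarith
      then show ?thesis by (simp add: log_def)
    qed
    then have "real K * (real N ^ d * real (bits N)) \<le> real K * (real N ^ d * (2 / ln 2 * ln (real N)))"
      by (intro mult_left_mono) auto
    also have "\<dots> = real K * (2 / ln 2) * (real N ^ d * ln (real N))" by simp
    finally show "norm (real (K * (N ^ d * bits N))) \<le> real K * (2 / ln 2) * norm (real N ^ d * ln (real N) ^ 1)"
      using N by simp
  qed
  then show ?thesis unfolding soft_O_def by blast
qed

text \<open>The exponent \<open>d\<close> is the number of nested loops over the edges while
  counting. Reading and indexing are near-linear and are absorbed because
  \<open>1 \<le> d\<close>.\<close>

lemma solvableI:
  assumes V: "proper_venn V"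
    and count: "\<And>es \<rho>. input R es \<Longrightarrow> input.renaming R es \<rho> \<Longrightarrow>
      hoare (\<lambda>m x. slots.counting R (length es) (R * length es + 1) (input.vec es \<rho>) (input.M R es) m \<and> m Out 0 = 0)
        c ((length es + 1) ^ d * (w * bits (input.M R es)))
        (\<lambda>m x. slots.counting R (length es) (R * length es + 1) (input.vec es \<rho>) (input.M R es) m \<and>
          m Out 0 = slots.total R (length es) (input.vec es \<rho>) V)"
    and d: "1 \<le> d"
  shows "solvable_in_soft_O (HyperMotif V) (rank_at_most R) (\<lambda>n. real n ^ d)"
proof -
  let ?K = "(overhead R V + w) * (bits (R + 2) + 3)"
  have "\<exists>t. ram_computes (ccom 0 (motif_program R V c)) x t (HyperMotif V G) \<and>
      real t \<le> real (?K * (enc_size x ^ d * bits (enc_size x)))"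
    if G: "G \<in> rank_at_most R" and x: "encodes x G" for G x
  proof -
    from encodes_input[OF that] obtain es where es: "input R es" "edges G = set (map set es)"
      and x: "x = length es # encode es" .
    interpret input R es by (rule es(1))
    let ?N = "enc_size x"
    have N: "input_size = ?N" by (simp add: input_size_def x)
    obtain t where t: "t \<le> overhead R V * (input_size * b) + (n + 1) ^ d * (w * b)"
      "ram_computes (ccom 0 (motif_program R V c)) x t (HyperMotif V G)"
      using motif_program_computes[OF V es(2) count[OF es(1)]] unfolding x by blast
    have Nd: "input_size \<le> input_size ^ d"
      using n_less_input_size d by (intro self_le_power) auto
    have "t \<le> overhead R V * (input_size ^ d * b) + input_size ^ d * (w * b)"
      using t(1) Nd power_mono[OF n_less_input_size, of d]
      by (meson add_le_mono le_trans mult_le_mono1 mult_le_mono2 zero_le)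
    also have "\<dots> = (overhead R V + w) * (input_size ^ d * b)" by (simp add: algebra_simps)
    also have "\<dots> \<le> (overhead R V + w) * (input_size ^ d * ((bits (R + 2) + 3) * bits input_size))"
      by (intro mult_le_mono2 log_bound)
    finally have "t \<le> ?K * (?N ^ d * bits ?N)" unfolding N by (simp add: algebra_simps)
    with t(2) show "\<exists>t. ram_computes (ccom 0 (motif_program R V c)) x t (HyperMotif V G) \<and>
        real t \<le> real (?K * (?N ^ d * bits ?N))"
      by (intro exI[of _ t]) (simp only: of_nat_le_iff)
  qed
  then show ?thesis unfolding solvable_in_soft_O_def
    by (intro exI[of _ "ccom 0 (motif_program R V c)"]
        bexI[of _ "\<lambda>N. real (?K * (N ^ d * bits N))"] ballI allI impI soft_O_bits)
qed

lemma HyperMotif_permute: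
  assumes "\<pi> permutes three"
  shows "HyperMotif (\<lambda>J. V (\<pi> ` J)) = HyperMotif V"
  unfolding HyperMotif_def motifs_def venn_sat_permute[OF assms] ..

theorem corollary1p2:
  "(\<forall>R V. proper_venn V \<longrightarrow>
      solvable_in_soft_O (HyperMotif V) (rank_at_most R) (\<lambda>n. real n ^ 2)) \<and>
   (\<forall>R V. proper_venn V \<and> degenerate V \<longrightarrow>
      solvable_in_soft_O (HyperMotif V) (rank_at_most R) (\<lambda>n. real n))"
proof (intro conjI allI impI)
  fix R V assume V: "proper_venn V"
  show "solvable_in_soft_O (HyperMotif V) (rank_at_most R) (\<lambda>n. real n ^ 2)"
  proof (rule solvableI[OF V])
    fix es \<rho> assume "input R es" and \<rho>: "input.renaming R es \<rho>"
    then interpret input R es by simp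
    interpret slots R n B "vec \<rho>" using slots_vec[OF \<rho>] .
    show "hoare (\<lambda>m x. counting M m \<and> m Out 0 = 0) (count_all R V)
        ((n + 1) ^ 2 * (wcom (count_all R V) * b)) (\<lambda>m x. counting M m \<and> m Out 0 = total V)"
      using hoare_count_all[OF M_bounds(1-3) refl, of V]
      by (simp only: power2_eq_square mult.assoc)
  qed simp
next
  fix R V assume "proper_venn V \<and> degenerate V"
  then have V: "proper_venn V" "degenerate V" by simp_all
  from degenerate_permute[OF this] obtain \<pi> where \<pi>: "\<pi> permutes three"
    and sub: "\<And>f :: nat \<Rightarrow> nat set. fits (\<lambda>J. V (\<pi> ` J)) f \<Longrightarrow> f 1 \<subseteq> f 2" by blast
  let ?V = "\<lambda>J. V (\<pi> ` J)"
  have V': "proper_venn ?V" using V(1) unfolding proper_venn_def venn_sat_permute[OF \<pi>] .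
  \<comment> \<open>The program is built for the permuted diagram, where the first edge lies inside
    the second; \<open>HyperMotif_permute\<close> shows that the problem is the same.\<close>
  have "solvable_in_soft_O (HyperMotif ?V) (rank_at_most R) (\<lambda>n. real n ^ 1)"
  proof (rule solvableI[OF V'])
    fix es \<rho> assume "input R es" and \<rho>: "input.renaming R es \<rho>"
    then interpret input R es by simp
    interpret slots R n B "vec \<rho>" using slots_vec[OF \<rho>] .
    show "hoare (\<lambda>m x. counting M m \<and> m Out 0 = 0) (count_nested R ?V)
        ((n + 1) ^ 1 * (wcom (count_nested R ?V) * b)) (\<lambda>m x. counting M m \<and> m Out 0 = total ?V)"
      using hoare_count_nested[OF M_bounds(1-3) refl sub] by (simp only: power_one_right)
  qed simp
  then show "solvable_in_soft_O (HyperMotif V) (rank_at_most R) (\<lambda>n. real n)"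
    unfolding HyperMotif_permute[OF \<pi>] by simp
qed

end
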